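(* Let $\Gamma$ be a finitely generated Abelian group of orientation-preserving $C^2$ diffeomorphisms of the circle $\mathbb{S}^1$ acting freely on $\mathbb{S}^1$ (no element other than the identity has a fixed point). Then the enlarged projective cocycle $M$ associated to $\Gamma$ (a cocycle over the diagonal action of $\Gamma$ on $(\mathbb{S}^1)^3$) is almost $\mathrm{SO}(2,\mathbb{R})$-reducible.
   Context: The circle $\mathbb{S}^1$ is identified with $\mathbb{R}/2\pi\mathbb{Z}$ via $\theta\mapsto e^{i\theta}$. All maps are orientation preserving. $\mathcal{M}$ denotes the group of Möbius transformations of the circle, i.e. the maps $z\mapsto e^{i\kappa}\,\frac{z-\sigma}{1-\bar\sigma z}$ of $\{|z|=1\}$ with $\kappa\in\mathbb{R}$ and $\sigma\in\mathbb{C}$, $|\sigma|<1$; it is identified with $\mathrm{PSL}(2,\mathbb{R})$ as a topological group, and is endowed with a fixed left-invariant metric $d$ inducing its topology. The subgroup of rotations $z\mapsto e^{i\kappa}z$ (the case $\sigma=0$) is denoted $\mathrm{SO}(2,\mathbb{R})$. Enlarged projective cocycle: for a circle homeomorphism $f$ and three pairwise distinct points $\theta_1,\theta_2,\theta_3\in\mathbb{S}^1$, $M_{f,(\theta_1,\theta_2,\theta_3)}\in\mathcal{M}$ is the unique Möbius transformation sending $\theta_i$ to $f(\theta_i)$ for $i=1,2,3$. When $f$ is a $C^2$ diffeomorphism, the map $(\theta_1,\theta_2,\theta_3)\mapsto M_{f,(\theta_1,\theta_2,\theta_3)}$ extends (uniquely) to a continuous map $(\mathbb{S}^1)^3\to\mathcal{M}$,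 still denoted $M_{f,\cdot}$. It satisfies the cocycle relation $M_{f,(g(\theta_1),g(\theta_2),g(\theta_3))}\circ M_{g,(\theta_1,\theta_2,\theta_3)}=M_{fg,(\theta_1,\theta_2,\theta_3)}$ over the diagonal action $f\cdot(\theta_1,\theta_2,\theta_3)=(f(\theta_1),f(\theta_2),f(\theta_3))$. The enlarged projective cocycle over $\Gamma$ is almost $\mathrm{SO}(2,\mathbb{R})$-reducible if there is a sequence of continuous maps $B_n:(\mathbb{S}^1)^3\to\mathcal{M}$ such that, for every $f\in\Gamma$, the $d$-distance from $B_n(f\cdot x)\circ M_{f,x}\circ B_n(x)^{-1}$ to the subgroup $\mathrm{SO}(2,\mathbb{R})$ converges to $0$ as $n\to\infty$, uniformly in $x\in(\mathbb{S}^1)^3$. *)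

theory Defs
  imports
    "HOL-Analysis.Analysis"
    "HOL-Algebra.Bij"
    "HOL-Algebra.Generated_Groups"
begin

section \<open>Diffeomorphisms of the circle\<close>

text \<open>
  The circle is the unit circle of the complex plane, and \<^term>\<open>cis t\<close> is the class of
  \<open>t\<close> modulo \<open>2\<pi>\<close>. Circle maps are extensional functions, so that they form a group under
  composition, the library's \<^term>\<open>BijGroup circle\<close>.
\<close>

abbreviation circle :: "complex set"
  where "circle \<equiv> sphere 0 1"

abbreviation circle_group :: "(complex \<Rightarrow> complex) monoid"
  where "circle_group \<equiv> BijGroup circle"

definition is_lift :: "(real \<Rightarrow> real) \<Rightarrow> (complex \<Rightarrow> complex) \<Rightarrow> bool"
  where "is_lift F f \<longleftrightarrow> continuous_on UNIV F \<and> (\<forall>t. f (cis t) = cis (F t))"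

definition C2_real :: "(real \<Rightarrow> real) \<Rightarrow> bool"
  where "C2_real F \<longleftrightarrow>
    (\<exists>F' F''. (\<forall>t. (F has_real_derivative F' t) (at t)) \<and>
              (\<forall>t. (F' has_real_derivative F'' t) (at t)) \<and>
              continuous_on UNIV F'')"

definition C2_circle :: "(complex \<Rightarrow> complex) \<Rightarrow> bool"
  where "C2_circle f \<longleftrightarrow> (\<exists>F. is_lift F f \<and> C2_real F)"

definition orientation_preserving :: "(complex \<Rightarrow> complex) \<Rightarrow> bool"
  where "orientation_preserving f \<longleftrightarrow> (\<exists>F. is_lift F f \<and> strict_mono F)"

definition C2_diffeos :: "(complex \<Rightarrow> complex) set"
  where "C2_diffeos =
    {f \<in> carrier circle_group.
       C2_circle f \<and> C2_circle (inv\<^bsub>circle_group\<^esub> f) \<and> orientation_preserving f}"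

definition finitely_generated_subgroup :: "('a, 'b) monoid_scheme \<Rightarrow> 'a set \<Rightarrow> bool"
  where "finitely_generated_subgroup G H \<longleftrightarrow>
    subgroup H G \<and> (\<exists>S. finite S \<and> S \<subseteq> H \<and> generate G S = H)"

definition acts_freely :: "(complex \<Rightarrow> complex) set \<Rightarrow> bool"
  where "acts_freely \<Gamma> \<longleftrightarrow>
    (\<forall>f\<in>\<Gamma>. f \<noteq> \<one>\<^bsub>circle_group\<^esub> \<longrightarrow> (\<forall>z\<in>circle. f z \<noteq> z))"


section \<open>The Moebius group of the circle\<close>

definition moebius_map :: "real \<Rightarrow> complex \<Rightarrow> complex \<Rightarrow> complex"
  where "moebius_map \<kappa> \<sigma> = (\<lambda>z\<in>circle. cis \<kappa> * ((z - \<sigma>) / (1 - cnj \<sigma> * z)))"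

definition moebius :: "(complex \<Rightarrow> complex) set"
  where "moebius = {moebius_map \<kappa> \<sigma> | \<kappa> \<sigma>. cmod \<sigma> < 1}"

definition rotations :: "(complex \<Rightarrow> complex) set"
  where "rotations = {moebius_map \<kappa> 0 | \<kappa>. True}"

definition SL2 :: "(real^2^2) set"
  where "SL2 = {A. det A = 1}"

text \<open>
  \<open>SL(2,\<real>)\<close> acts on the real projective line. A line \<open>\<real>w\<close>, with \<open>w\<close> a nonzero vector of
  \<open>\<real>\<^sup>2 = \<complex>\<close>, corresponds to the point \<open>w\<^sup>2 / \<bar>w\<bar>\<^sup>2\<close> of the circle; conversely, the point \<open>z\<close>
  of the circle is the line spanned by \<^term>\<open>csqrt z\<close>.
\<close>

definition line_point :: "real^2 \<Rightarrow> complex"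
  where "line_point v = (Complex (v $ 1) (v $ 2))\<^sup>2 / (complex_of_real (norm v))\<^sup>2"

definition moebius_of_SL2 :: "real^2^2 \<Rightarrow> complex \<Rightarrow> complex"
  where "moebius_of_SL2 A =
    (\<lambda>z\<in>circle. line_point (A *v vector [Re (csqrt z), Im (csqrt z)]))"

text \<open>
  The topology of \<open>PSL(2,\<real>)\<close>: the quotient topology from \<^term>\<open>SL2\<close>
  (see \<open>quotient_map_moebius_of_SL2\<close> below).
\<close>

definition moebius_topology :: "(complex \<Rightarrow> complex) topology"
  where "moebius_topology = topology (\<lambda>U. U \<subseteq> moebius \<and>
    openin (top_of_set SL2) {A \<in> SL2. moebius_of_SL2 A \<in> U})"

definition left_invariant_moebius_metric ::
    "((complex \<Rightarrow> complex) \<Rightarrow> (complex \<Rightarrow> complex) \<Rightarrow> real) \<Rightarrow> bool"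
  where "left_invariant_moebius_metric d \<longleftrightarrow>
    Metric_space moebius d \<and>
    Metric_space.mtopology moebius d = moebius_topology \<and>
    (\<forall>g\<in>moebius. \<forall>h\<in>moebius. \<forall>k\<in>moebius.
       d (g \<otimes>\<^bsub>circle_group\<^esub> h) (g \<otimes>\<^bsub>circle_group\<^esub> k) = d h k)"

lemma openin_moebius_topology:
  "openin moebius_topology U \<longleftrightarrow>
    U \<subseteq> moebius \<and> openin (top_of_set SL2) {A \<in> SL2. moebius_of_SL2 A \<in> U}"
proof -
  have "istopology (\<lambda>U. U \<subseteq> moebius \<and>
    openin (top_of_set SL2) {A \<in> SL2. moebius_of_SL2 A \<in> U})" (is "istopology ?P")
    unfolding istopology_def
  proof (intro conjI allI impI)
    fix S T assume S: "?P S" and T: "?P T"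
    have eq: "{A \<in> SL2. moebius_of_SL2 A \<in> S \<inter> T} =
        {A \<in> SL2. moebius_of_SL2 A \<in> S} \<inter> {A \<in> SL2. moebius_of_SL2 A \<in> T}" by blast
    show "S \<inter> T \<subseteq> moebius" using S by blast
    show "openin (top_of_set SL2) {A \<in> SL2. moebius_of_SL2 A \<in> S \<inter> T}"
      unfolding eq using S T by blast
  next
    fix \<U> assume U: "\<forall>K\<in>\<U>. ?P K"
    have eq: "{A \<in> SL2. moebius_of_SL2 A \<in> \<Union>\<U>} =
        \<Union> ((\<lambda>K. {A \<in> SL2. moebius_of_SL2 A \<in> K}) ` \<U>)" by blast
    show "\<Union>\<U> \<subseteq> moebius" using U by blast
    show "openin (top_of_set SL2) {A \<in> SL2. moebius_of_SL2 A \<in> \<Union>\<U>}"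
      unfolding eq using U by blast
  qed
  then show ?thesis by (simp add: moebius_topology_def)
qed

text \<open>
  Seen on \<open>\<complex>\<close>, the linear map \<open>A\<close> is \<open>w \<mapsto> \<alpha> w + \<beta> cnj w\<close>, with \<open>\<alpha>\<close> and \<open>\<beta>\<close> as follows.
\<close>

lemma moebius_of_SL2_eq:
  fixes A :: "real^2^2"
  defines "\<alpha> \<equiv> Complex ((A$1$1 + A$2$2) / 2) ((A$2$1 - A$1$2) / 2)"
    and "\<beta> \<equiv> Complex ((A$1$1 - A$2$2) / 2) ((A$1$2 + A$2$1) / 2)"
  assumes A: "A \<in> SL2" and z: "z \<in> circle"
  shows "moebius_of_SL2 A z = (\<alpha> * z + \<beta>) / (cnj \<alpha> + cnj \<beta> * z)"
    and "(cmod \<alpha>)\<^sup>2 - (cmod \<beta>)\<^sup>2 = 1"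
proof -
  have "A$1$1 * A$2$2 - A$1$2 * A$2$1 = 1"
    using A by (simp add: SL2_def det_2)
  then show ab: "(cmod \<alpha>)\<^sup>2 - (cmod \<beta>)\<^sup>2 = 1"
    unfolding \<alpha>_def \<beta>_def cmod_power2 by (simp add: power2_eq_square field_simps)
  define w where "w = csqrt z"
  have ww: "w\<^sup>2 = z" by (simp add: w_def)
  have nw: "cmod w = 1" using z by (simp add: w_def)
  have wc: "w * cnj w = 1" using nw by (simp add: complex_norm_square [symmetric])
  have w0: "w \<noteq> 0" using nw by auto
  let ?v = "A *v vector [Re w, Im w]"
  define v where "v = Complex (?v $ 1) (?v $ 2)"
  have v: "v = \<alpha> * w + \<beta> * cnj w"
    by (simp add: v_def \<alpha>_def \<beta>_def complex_eq_iff matrix_vector_mult_def sum_2 field_simps)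
  have nv: "norm ?v = cmod v"
    by (simp add: v_def norm_vec_def L2_set_def sum_2 cmod_def)
  have "cmod (\<beta> * cnj w) < cmod (\<alpha> * w)"
    using ab nw by (simp add: norm_mult power2_less_imp_less)
  then have v0: "v \<noteq> 0" unfolding v by (metis add_eq_0_iff2 less_irrefl norm_minus_cancel)
  have "moebius_of_SL2 A z = v\<^sup>2 / (complex_of_real (cmod v))\<^sup>2"
    using z unfolding moebius_of_SL2_def restrict_apply line_point_def w_def [symmetric] nv
      v_def [symmetric] by simp
  also have "\<dots> = v / cnj v"
    using v0 unfolding of_real_power [symmetric] complex_norm_square
    by (simp add: power2_eq_square)
  also have "\<dots> = (w * v) / (w * cnj v)" using w0 by simp
  also have "w * v = \<alpha> * z + \<beta>"
    using wc unfolding v ww [symmetric] by algebra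
  also have "w * cnj v = cnj \<alpha> + cnj \<beta> * z"
    using wc unfolding v ww [symmetric] by (simp add: power2_eq_square algebra_simps)
  finally show "moebius_of_SL2 A z = (\<alpha> * z + \<beta>) / (cnj \<alpha> + cnj \<beta> * z)" .
qed

lemma moebius_of_SL2_eq_moebius_map:
  fixes A :: "real^2^2"
  defines "\<alpha> \<equiv> Complex ((A$1$1 + A$2$2) / 2) ((A$2$1 - A$1$2) / 2)"
    and "\<beta> \<equiv> Complex ((A$1$1 - A$2$2) / 2) ((A$1$2 + A$2$1) / 2)"
  assumes A: "A \<in> SL2" and k: "cis \<kappa> * cnj \<alpha> = \<alpha>" and s: "\<beta> = - (\<sigma> * \<alpha>)"
  shows "moebius_of_SL2 A = moebius_map \<kappa> \<sigma>"
proof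
  fix z
  have ab: "(cmod \<alpha>)\<^sup>2 - (cmod \<beta>)\<^sup>2 = 1"
    using moebius_of_SL2_eq(2)[OF A, of 1] by (simp add: \<alpha>_def \<beta>_def)
  then have a0: "cnj \<alpha> \<noteq> 0" by auto (smt (verit) zero_le_power2)
  show "moebius_of_SL2 A z = moebius_map \<kappa> \<sigma> z"
  proof (cases "z \<in> circle")
    case True
    have "moebius_of_SL2 A z = (\<alpha> * z + \<beta>) / (cnj \<alpha> + cnj \<beta> * z)"
      using moebius_of_SL2_eq(1)[OF A True] by (simp add: \<alpha>_def \<beta>_def)
    also have "\<alpha> * z + \<beta> = cnj \<alpha> * (cis \<kappa> * (z - \<sigma>))"
      unfolding s by (subst (1 2) k [symmetric]) (simp add: algebra_simps)
    also have "cnj \<alpha> + cnj \<beta> * z = cnj \<alpha> * (1 - cnj \<sigma> * z)"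
      unfolding s by (simp add: algebra_simps)
    finally show ?thesis using True a0 by (simp add: moebius_map_def)
  next
    case False
    then show ?thesis by (simp add: moebius_of_SL2_def moebius_map_def)
  qed
qed

lemma moebius_eq_image_SL2: "moebius = moebius_of_SL2 ` SL2"
proof (intro equalityI subsetI)
  fix g assume "g \<in> moebius"
  then obtain \<kappa> \<sigma> where g: "g = moebius_map \<kappa> \<sigma>" and s: "cmod \<sigma> < 1"
    by (auto simp: moebius_def)
  define r where "r = 1 / sqrt (1 - (cmod \<sigma>)\<^sup>2)"
  have "(cmod \<sigma>)\<^sup>2 < 1" using s by (simp add: abs_square_less_1)
  then have r: "r\<^sup>2 * (1 - (cmod \<sigma>)\<^sup>2) = 1" by (simp add: r_def power_divide)
  define a where "a = of_real r * cis (\<kappa> / 2)"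
  define b where "b = - (\<sigma> * a)"
  define A :: "real^2^2" where
    "A = vector [vector [Re a + Re b, Im b - Im a], vector [Im a + Im b, Re a - Re b]]"
  have ka: "cis \<kappa> * cnj a = a"
    by (simp add: a_def cis_cnj cis_mult)
  have "(cmod a)\<^sup>2 - (cmod b)\<^sup>2 = 1"
    using r by (simp add: a_def b_def norm_mult power_mult_distrib algebra_simps)
  then have A: "A \<in> SL2"
    unfolding cmod_power2 by (simp add: SL2_def det_2 A_def power2_eq_square algebra_simps)
  have al: "Complex ((A$1$1 + A$2$2) / 2) ((A$2$1 - A$1$2) / 2) = a"
    and be: "Complex ((A$1$1 - A$2$2) / 2) ((A$1$2 + A$2$1) / 2) = b"
    by (simp_all add: A_def complex_eq_iff)
  have "moebius_of_SL2 A = g"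
    unfolding g by (rule moebius_of_SL2_eq_moebius_map[OF A]) (simp_all only: al be ka b_def)
  then show "g \<in> moebius_of_SL2 ` SL2" using A by blast
next
  fix g assume "g \<in> moebius_of_SL2 ` SL2"
  then obtain A where A: "A \<in> SL2" and g: "g = moebius_of_SL2 A" by blast
  let ?a = "Complex ((A$1$1 + A$2$2) / 2) ((A$2$1 - A$1$2) / 2)"
  let ?b = "Complex ((A$1$1 - A$2$2) / 2) ((A$1$2 + A$2$1) / 2)"
  have ab: "(cmod ?a)\<^sup>2 - (cmod ?b)\<^sup>2 = 1"
    using moebius_of_SL2_eq(2)[OF A, of 1] by simp
  then have lt: "cmod ?b < cmod ?a" by (simp add: power2_less_imp_less)
  then have a0: "?a \<noteq> 0" by (metis norm_ge_zero norm_zero not_less)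
  have "cis (2 * Arg ?a) * cnj ?a = ?a"
  proof -
    have "?a = of_real (cmod ?a) * cis (Arg ?a)"
      by (metis rcis_cmod_Arg rcis_def)
    then show ?thesis
      by (smt (verit) cis_cnj cis_mult complex_cnj_complex_of_real complex_cnj_mult
          mult.left_commute)
  qed
  then have "g = moebius_map (2 * Arg ?a) (- ?b / ?a)"
    unfolding g using a0 by (intro moebius_of_SL2_eq_moebius_map[OF A]) simp_all
  moreover have "cmod (- ?b / ?a) < 1" using lt a0 by (simp add: norm_divide)
  ultimately show "g \<in> moebius" unfolding moebius_def by blast
qed

lemma quotient_map_moebius_of_SL2:
  "quotient_map (top_of_set SL2) moebius_topology moebius_of_SL2"
proof -
  have "{A \<in> SL2. moebius_of_SL2 A \<in> moebius} = SL2"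
    using moebius_eq_image_SL2 by blast
  then have "openin moebius_topology moebius"
    by (simp add: openin_moebius_topology)
  then have "topspace moebius_topology = moebius"
    by (metis openin_moebius_topology openin_subset openin_topspace subset_antisym)
  then show ?thesis
    by (auto simp: quotient_map_def openin_moebius_topology moebius_eq_image_SL2)
qed


section \<open>The enlarged projective cocycle\<close>

abbreviation circle3 :: "(complex \<times> complex \<times> complex) set"
  where "circle3 \<equiv> circle \<times> circle \<times> circle"

definition diag_act ::
    "(complex \<Rightarrow> complex) \<Rightarrow> complex \<times> complex \<times> complex \<Rightarrow> complex \<times> complex \<times> complex"
  where "diag_act f = (\<lambda>(a, b, c). (f a, f b, f c))"

definition three_point_moebius ::
    "(complex \<Rightarrow> complex) \<Rightarrow> complex \<times> complex \<times> complex \<Rightarrow> complex \<Rightarrow> complex"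
  where "three_point_moebius f x = (THE g. g \<in> moebius \<and> diag_act g x = diag_act f x)"

text \<open>
  The continuous extension is unique on \<^term>\<open>circle3\<close> (triples of distinct points are dense);
  membership in \<^term>\<open>extensional circle3\<close> pins down the irrelevant values elsewhere. The
  extension exists when \<open>f\<close> is a \<open>C\<^sup>2\<close> diffeomorphism.
\<close>

definition enlarged_cocycle ::
    "(complex \<Rightarrow> complex) \<Rightarrow> complex \<times> complex \<times> complex \<Rightarrow> complex \<Rightarrow> complex"
  where "enlarged_cocycle f =
    (THE M. M \<in> extensional circle3 \<and>
       continuous_map (top_of_set circle3) moebius_topology M \<and>
       (\<forall>a\<in>circle. \<forall>b\<in>circle. \<forall>c\<in>circle.
          distinct [a, b, c] \<longrightarrow> M (a, b, c) = three_point_moebius f (a, b, c)))"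

definition almost_rotation_reducible ::
    "((complex \<Rightarrow> complex) \<Rightarrow> (complex \<Rightarrow> complex) \<Rightarrow> real) \<Rightarrow> (complex \<Rightarrow> complex) set \<Rightarrow>
     ((complex \<Rightarrow> complex) \<Rightarrow> complex \<times> complex \<times> complex \<Rightarrow> complex \<Rightarrow> complex) \<Rightarrow> bool"
  where "almost_rotation_reducible d \<Gamma> M \<longleftrightarrow>
    (\<exists>B. (\<forall>n::nat. continuous_map (top_of_set circle3) moebius_topology (B n)) \<and>
         (\<forall>f\<in>\<Gamma>. uniform_limit circle3
            (\<lambda>n x. INF r\<in>rotations.
               d (B n (diag_act f x) \<otimes>\<^bsub>circle_group\<^esub> M f x \<otimes>\<^bsub>circle_group\<^esub> inv\<^bsub>circle_group\<^esub> (B n x)) r)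
            (\<lambda>x. 0) sequentially))"

end

theory Submission
  imports Defs
begin

text \<open>
  The Moebius group acts by isometries on the hyperbolic plane, and the rotations are the
  stabilizer of a base point. Continuous maps \<open>B\<close> into the Moebius group therefore
  correspond, up to rotations, to continuous sections \<open>\<phi>\<close> that choose a point of the plane
  above each triple, and the conjugated cocycle at \<open>x\<close> is close to a rotation when
  \<open>M\<^bsub>f,x\<^esub>\<close> carries \<open>\<phi> x\<close> close to \<open>\<phi> (f x)\<close> (\<open>distance_to_rotations\<close>). So the task is to find
  sections \<open>\<phi>\<^sub>n\<close> whose displacement under the operator \<open>push f\<close> induced by each \<open>f\<close> tends
  uniformly to \<open>0\<close> (\<open>almost_invariant_sections\<close>).

  They are obtained by averaging in nonpositive curvature. For an isometry \<open>U\<close> let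
  \<open>P\<^sub>0 U \<phi> = \<phi>\<close>, and let \<open>P\<^bsub>k+1\<^esub> U \<phi>\<close> be the midpoint of \<open>\<Phi> = P\<^sub>k (U \<circ> U) \<phi>\<close> and \<open>U \<Phi>\<close>; this is a
  mean of \<open>\<phi>, U \<phi>, ..., U\<^bsup>N-1\<^esup> \<phi>\<close> with \<open>N = 2\<^sup>k\<close>. Since \<open>U\<close> moves this midpoint to the midpoint of
  \<open>U \<Phi>\<close> and \<open>U (U \<Phi>)\<close>, one of the two points is kept and the other one is moved by
  \<open>U \<circ> U\<close>; so convexity of the distance (\<open>hdist_hmid\<close>) halves the displacement in each step, and the
  mean is moved by at most \<open>2\<^bsup>-k\<^esup>\<close> times the distance from \<open>\<phi>\<close> to \<open>U\<^sup>N \<phi>\<close>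
  (\<open>power_mean_almost_invariant\<close>). Means are equivariant and do not expand distances, so those
  for commuting isometries can be composed and one section serves all generators
  (\<open>joint_almost_invariant\<close>).

  It remains to see that \<open>M\<^bsub>f^n,x\<^esub>\<close> moves the base point by \<open>o(n)\<close>, uniformly in \<open>x\<close>
  (\<open>drift_sublinear\<close>). Up to constants, the displacement is bounded by the logarithms of bounds for
  the first two derivatives of \<open>f\<^sup>n\<close> and for the inverse of the first one (\<open>fst_hact_interp_le\<close>), and the
  chain rule controls second derivatives by first ones (\<open>subexponential_C2_growth\<close>). If \<open>f\<close> has
  infinite order, freeness makes all its positive powers fixed-point free, so for
  each \<open>L\<close> all arcs of some length \<open>\<eta> > 0\<close> are disjoint from their first \<open>L\<close> images. Hence any \<open>L\<close>
  consecutive images of such an arc have bounded total length, and the oscillation of \<open>log Df\<^sup>n\<close> on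
  the arc is \<open>O(n/L) + O(1)\<close>. As the image of the arc has length at most \<open>2\<pi>\<close>, this bounds \<open>Df\<^sup>n\<close>
  from above; arcs whose \<open>n\<close>-th image has length \<open>\<eta>\<close> bound it from below (\<open>ln_DF_sublinear\<close>).

  The extension of the cocycle to triples with repetitions comes from an explicit formula. Newton
  interpolation by continued fractions writes the Moebius map through three points as a
  matrix of divided differences of order at most two, and these extend continuously because \<open>f\<close> is
  \<open>C\<^sup>2\<close>. The matrices even satisfy the cocycle relation exactly, not only up to scalars
  (\<open>interp_compose\<close>).
\<close>

type_synonym triple = "complex \<times> complex \<times> complex"

abbreviation circle_mult :: "(complex \<Rightarrow> complex) \<Rightarrow> (complex \<Rightarrow> complex) \<Rightarrow> complex \<Rightarrow> complex"
    (infixl "\<cdot>" 70)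
  where "f \<cdot> g \<equiv> f \<otimes>\<^bsub>circle_group\<^esub> g"

abbreviation cinv :: "(complex \<Rightarrow> complex) \<Rightarrow> complex \<Rightarrow> complex"
  where "cinv f \<equiv> inv\<^bsub>circle_group\<^esub> f"

abbreviation cone :: "complex \<Rightarrow> complex"
  where "cone \<equiv> \<one>\<^bsub>circle_group\<^esub>"

section \<open>The hyperboloid model\<close>

text \<open>
  The Lorentz form of signature \<open>(1,2)\<close>; the hyperbolic plane is the sheet
  \<open>lor p p = 1\<close>, \<open>fst p > 0\<close>, and \<open>lor p q\<close> is the hyperbolic cosine of the distance.
\<close>

definition lor :: "real \<times> complex \<Rightarrow> real \<times> complex \<Rightarrow> real"
  where "lor p q = fst p * fst q - snd p \<bullet> snd q"

definition hyp :: "(real \<times> complex) set"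
  where "hyp = {p. lor p p = 1 \<and> fst p > 0}"

definition hdist :: "real \<times> complex \<Rightarrow> real \<times> complex \<Rightarrow> real"
  where "hdist p q = arcosh (lor p q)"

text \<open>
  The midpoint of a geodesic segment is the sum of its endpoints, scaled back to the
  hyperboloid. So linear isometries visibly preserve midpoints.
\<close>

definition hmid :: "real \<times> complex \<Rightarrow> real \<times> complex \<Rightarrow> real \<times> complex"
  where "hmid p q = (1 / sqrt (2 + 2 * lor p q)) *\<^sub>R (p + q)"

lemma lor_commute: "lor p q = lor q p"
  by (simp add: lor_def inner_commute mult.commute)

lemma lor_add_left: "lor (p + q) r = lor p r + lor q r"
  by (simp add: lor_def inner_add_left algebra_simps)

lemma lor_add_right: "lor r (p + q) = lor r p + lor r q"
  by (simp add: lor_def inner_add_right algebra_simps)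

lemma lor_scaleR_left: "lor (c *\<^sub>R p) q = c * lor p q"
  by (simp add: lor_def algebra_simps)

lemma lor_scaleR_right: "lor p (c *\<^sub>R q) = c * lor p q"
  by (simp add: lor_def algebra_simps)

lemma hyp_lor_self: "p \<in> hyp \<Longrightarrow> lor p p = 1"
  by (simp add: hyp_def)

lemma hyp_cmod: "p \<in> hyp \<Longrightarrow> (cmod (snd p))\<^sup>2 = (fst p)\<^sup>2 - 1"
  unfolding power2_norm_eq_inner by (simp add: hyp_def lor_def power2_eq_square)

lemma lor_ge_1:
  assumes p: "p \<in> hyp" and q: "q \<in> hyp"
  shows "lor p q \<ge> 1"
proof -
  define x where "x = cmod (snd p)"
  define y where "y = cmod (snd q)"
  have "(fst p * fst q)\<^sup>2 = (1 + x\<^sup>2) * (1 + y\<^sup>2)"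
    using hyp_cmod[OF p] hyp_cmod[OF q] by (simp add: x_def y_def power_mult_distrib)
  also have "\<dots> = (1 + x * y)\<^sup>2 + (x - y)\<^sup>2" by (simp add: power2_eq_square algebra_simps)
  finally have "(1 + x * y)\<^sup>2 \<le> (fst p * fst q)\<^sup>2" by simp
  moreover have "fst p * fst q \<ge> 0" using p q by (simp add: hyp_def)
  ultimately have "1 + x * y \<le> fst p * fst q" by (rule power2_le_imp_le)
  moreover have "snd p \<bullet> snd q \<le> x * y" unfolding x_def y_def by (rule norm_cauchy_schwarz)
  ultimately show ?thesis by (simp add: lor_def)
qed

text \<open>
  Three vectors have Gram matrix \<open>V\<^sup>T J V\<close>, and \<open>J = diag(1,-1,-1)\<close> has determinant
  \<open>1\<close>; so the Gram determinant is the square of \<open>det V\<close>. Both the triangle inequality and the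
  convexity of the distance are restatements of its nonnegativity.
\<close>

lemma lor_gram:
  "lor p p * lor q q * lor r r + 2 * lor p q * lor p r * lor q r
     - lor p p * (lor q r)\<^sup>2 - lor q q * (lor p r)\<^sup>2 - lor r r * (lor p q)\<^sup>2 \<ge> 0"
proof -
  obtain t a b where p: "p = (t, Complex a b)" by (metis complex_surj surj_pair)
  obtain t' a' b' where q: "q = (t', Complex a' b')" by (metis complex_surj surj_pair)
  obtain t'' a'' b'' where r: "r = (t'', Complex a'' b'')" by (metis complex_surj surj_pair)
  have "lor p p * lor q q * lor r r + 2 * lor p q * lor p r * lor q r
     - lor p p * (lor q r)\<^sup>2 - lor q q * (lor p r)\<^sup>2 - lor r r * (lor p q)\<^sup>2
     = (t * (a' * b'' - a'' * b') - t' * (a * b'' - a'' * b) + t'' * (a * b' - a' * b))\<^sup>2"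
    unfolding p q r lor_def inner_complex_def fst_conv snd_conv complex.sel by algebra
  then show ?thesis by simp
qed

lemma lor_gram_hyp:
  assumes "p \<in> hyp" "q \<in> hyp" "r \<in> hyp"
  shows "1 + 2 * lor p q * lor p r * lor q r \<ge> (lor p q)\<^sup>2 + (lor p r)\<^sup>2 + (lor q r)\<^sup>2"
  using lor_gram[of p q r] assms by (simp add: hyp_lor_self)

lemma hdist_commute: "hdist p q = hdist q p"
  by (simp add: hdist_def lor_commute)

lemma hdist_self: "p \<in> hyp \<Longrightarrow> hdist p p = 0"
  by (simp add: hdist_def hyp_lor_self)

lemma hdist_nonneg: "p \<in> hyp \<Longrightarrow> q \<in> hyp \<Longrightarrow> hdist p q \<ge> 0"
  using lor_ge_1 by (simp add: hdist_def)

lemma cosh_hdist: "p \<in> hyp \<Longrightarrow> q \<in> hyp \<Longrightarrow> cosh (hdist p q) = lor p q"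
  using lor_ge_1 by (simp add: hdist_def cosh_arcosh_real)

lemma hdist_le_iff:
  assumes "p \<in> hyp" "q \<in> hyp" "c \<ge> 0"
  shows "hdist p q \<le> c \<longleftrightarrow> lor p q \<le> cosh c"
  using assms by (metis cosh_hdist cosh_real_nonneg_le_iff hdist_nonneg)

text \<open>
  With \<open>a, b, c\<close> the cosines of the three distances, nonnegativity of the Gram determinant reads
  \<open>(c - a b)\<^sup>2 \<le> (a\<^sup>2 - 1) (b\<^sup>2 - 1)\<close>, and the addition theorem for \<open>cosh\<close> finishes.
\<close>

lemma hdist_triangle:
  assumes p: "p \<in> hyp" and q: "q \<in> hyp" and r: "r \<in> hyp"
  shows "hdist p r \<le> hdist p q + hdist q r"
proof -
  define a b c where "a = lor p q" and "b = lor q r" and "c = lor p r"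
  define x y where "x = hdist p q" and "y = hdist q r"
  have xy: "x \<ge> 0" "y \<ge> 0" using p q r by (simp_all add: x_def y_def hdist_nonneg)
  have ab: "cosh x = a" "cosh y = b" using p q r by (simp_all add: a_def b_def x_def y_def cosh_hdist)
  have "1 + 2 * a * c * b \<ge> a\<^sup>2 + c\<^sup>2 + b\<^sup>2"
    using lor_gram_hyp[OF p q r] by (simp add: a_def b_def c_def)
  then have "(c - a * b)\<^sup>2 \<le> (a\<^sup>2 - 1) * (b\<^sup>2 - 1)"
    by (simp add: power2_eq_square algebra_simps)
  also have "\<dots> = (sinh x * sinh y)\<^sup>2"
    unfolding ab[symmetric] by (simp add: cosh_square_eq power_mult_distrib)
  finally have "c - a * b \<le> sinh x * sinh y"
    by (rule power2_le_imp_le) (use xy in simp)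
  then have "c \<le> cosh (x + y)" by (simp add: cosh_add ab)
  then show ?thesis using xy p r by (simp add: hdist_le_iff x_def y_def c_def)
qed

lemma hmid_in_hyp:
  assumes p: "p \<in> hyp" and q: "q \<in> hyp"
  shows "hmid p q \<in> hyp"
proof -
  have l: "2 + 2 * lor p q > 0" using lor_ge_1[OF p q] by simp
  have "lor (p + q) (p + q) = 2 + 2 * lor p q"
    using p q by (simp add: lor_add_left lor_add_right hyp_lor_self lor_commute)
  then have "lor (hmid p q) (hmid p q) = 1"
    using l by (simp add: hmid_def lor_scaleR_left lor_scaleR_right)
  moreover have "fst (hmid p q) > 0" using l p q by (simp add: hmid_def hyp_def add_pos_pos)
  ultimately show ?thesis by (simp add: hyp_def)
qed

lemma hmid_commute: "hmid p q = hmid q p"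
  by (simp add: hmid_def lor_commute add.commute)

text \<open>
  In a triangle, the segment between the midpoints of two sides is at most half as
  long as the third side. After squaring, this becomes \<open>(1 + a + b + c)\<^sup>2 \<le> 2 (1 + a) (1 + b) (1 + c)\<close>,
  which again says that the Gram determinant is nonnegative.
\<close>

lemma hdist_hmid_common:
  assumes p: "p \<in> hyp" and q: "q \<in> hyp" and r: "r \<in> hyp"
  shows "hdist (hmid p q) (hmid p r) \<le> hdist q r / 2"
proof -
  define a b c where "a = lor p q" and "b = lor p r" and "c = lor q r"
  have ge: "a \<ge> 1" "b \<ge> 1" "c \<ge> 1" using p q r by (simp_all add: a_def b_def c_def lor_ge_1)
  have gram: "1 + 2 * a * b * c \<ge> a\<^sup>2 + b\<^sup>2 + c\<^sup>2"
    using lor_gram_hyp[OF p q r] by (simp add: a_def b_def c_def)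
  have half: "(cosh (hdist q r / 2))\<^sup>2 = (1 + c) / 2"
    using cosh_double_cosh[of "hdist q r / 2"] cosh_hdist[OF q r] by (simp add: c_def)
  have "lor (hmid p q) (hmid p r) = (1 + a + b + c) / (sqrt (2 + 2 * a) * sqrt (2 + 2 * b))"
    using p by (simp add: hmid_def lor_scaleR_left lor_scaleR_right lor_add_left lor_add_right
        hyp_lor_self a_def b_def c_def lor_commute[of q] add_divide_distrib)
  then have "(lor (hmid p q) (hmid p r))\<^sup>2 = (1 + a + b + c)\<^sup>2 / ((2 + 2 * a) * (2 + 2 * b))"
    using ge by (simp add: power_divide power_mult_distrib)
  also have "\<dots> \<le> (1 + c) / 2"
  proof -
    have "(1 + a + b + c)\<^sup>2 \<le> (1 + c) / 2 * ((2 + 2 * a) * (2 + 2 * b))"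
      using gram by (simp add: power2_eq_square algebra_simps add_divide_distrib)
    moreover have "(2 + 2 * a) * (2 + 2 * b) > 0" using ge by simp
    ultimately show ?thesis by (simp only: pos_divide_le_eq)
  qed
  finally have "lor (hmid p q) (hmid p r) \<le> cosh (hdist q r / 2)"
    unfolding half[symmetric] by (rule power2_le_imp_le) (rule cosh_real_nonneg)
  then show ?thesis
    using p q r by (intro hdist_le_iff[THEN iffD2]) (auto simp: hmid_in_hyp hdist_nonneg)
qed

text \<open>
  Busemann convexity: cut the quadrilateral along a diagonal and use the triangle
  case twice.
\<close>

lemma hdist_hmid:
  assumes "p \<in> hyp" "q \<in> hyp" "p' \<in> hyp" "q' \<in> hyp"
  shows "hdist (hmid p q) (hmid p' q') \<le> (hdist p p' + hdist q q') / 2"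
proof -
  have "hdist (hmid p q) (hmid p' q') \<le> hdist (hmid p q) (hmid p q') + hdist (hmid p q') (hmid p' q')"
    using assms by (intro hdist_triangle hmid_in_hyp)
  also have "hdist (hmid p q) (hmid p q') \<le> hdist q q' / 2"
    using assms by (intro hdist_hmid_common)
  also have "hdist (hmid p q') (hmid p' q') \<le> hdist p p' / 2"
    using hdist_hmid_common[of q' p p'] assms by (simp add: hmid_commute)
  finally show ?thesis by simp
qed

lemma continuous_on_hmid:
  assumes "continuous_on S p" "continuous_on S q"
    and "\<And>x. x \<in> S \<Longrightarrow> p x \<in> hyp" "\<And>x. x \<in> S \<Longrightarrow> q x \<in> hyp"
  shows "continuous_on S (\<lambda>x. hmid (p x) (q x))"
proof -
  have "2 + 2 * lor (p x) (q x) \<noteq> 0" if "x \<in> S" for x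
    using lor_ge_1[of "p x" "q x"] assms that by fastforce
  then show ?thesis
    unfolding hmid_def lor_def
    by (intro continuous_intros assms(1,2)) (auto simp: lor_def)
qed

section \<open>Matrices of Moebius maps and their action on the hyperboloid\<close>

definition mat2 :: "complex \<Rightarrow> complex \<Rightarrow> complex \<Rightarrow> complex \<Rightarrow> complex^2^2"
  where "mat2 a b c d = vector [vector [a, b], vector [c, d]]"

lemma mat2_nth [simp]:
  "mat2 a b c d $ 1 $ 1 = a" "mat2 a b c d $ 1 $ 2 = b"
  "mat2 a b c d $ 2 $ 1 = c" "mat2 a b c d $ 2 $ 2 = d"
  by (simp_all add: mat2_def)

lemma mat2_eta: "mat2 (A$1$1) (A$1$2) (A$2$1) (A$2$2) = A"
  by (simp add: vec_eq_iff forall_2)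

lemma mat2_mult:
  "mat2 a b c d ** mat2 a' b' c' d' =
    mat2 (a * a' + b * c') (a * b' + b * d') (c * a' + d * c') (c * b' + d * d')"
  by (simp add: vec_eq_iff forall_2 matrix_matrix_mult_def sum_2)

text \<open>
  Positive multiples of the matrices in \<open>U(1,1)\<close>. With \<open>u = 1\<close> and \<open>\<bar>a\<bar>\<^sup>2 - \<bar>b\<bar>\<^sup>2 = 1\<close> these are the
  elements of \<open>SU(1,1)\<close>. The phase \<open>u\<close> and the scale are kept free because the
  interpolation matrices below are not normalized.
\<close>

definition GU :: "(complex^2^2) set"
  where "GU = {mat2 a b (u * cnj b) (u * cnj a) | a b u. cmod u = 1 \<and> cmod b < cmod a}"

lemma GU_I: "A = mat2 a b (u * cnj b) (u * cnj a) \<Longrightarrow> cmod u = 1 \<Longrightarrow> cmod b < cmod a \<Longrightarrow> A \<in> GU"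
  unfolding GU_def by blast

text \<open>
  The modulus of the determinant for elements of \<open>GU\<close>.
\<close>

definition gscale :: "complex^2^2 \<Rightarrow> real"
  where "gscale A = (cmod (A$1$1))\<^sup>2 - (cmod (A$1$2))\<^sup>2"

lemma GU_E:
  assumes "A \<in> GU"
  obtains a b u where "A = mat2 a b (u * cnj b) (u * cnj a)" "u * cnj u = 1" "cmod u = 1" "cmod b < cmod a"
proof -
  obtain a b u where A: "A = mat2 a b (u * cnj b) (u * cnj a)" "cmod u = 1" "cmod b < cmod a"
    using assms by (auto simp: GU_def)
  then have "u * cnj u = 1" by (simp add: complex_norm_square[symmetric])
  then show ?thesis using that A by blast
qed

lemma gscale_mat2: "complex_of_real (gscale (mat2 a b c d)) = a * cnj a - b * cnj b"
  unfolding gscale_def by (simp add: complex_norm_square[symmetric])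

lemma gscale_pos: "A \<in> GU \<Longrightarrow> gscale A > 0"
  by (auto simp: GU_def gscale_def power_strict_mono)

lemma GU_mult:
  assumes "A \<in> GU" "B \<in> GU"
  shows "A ** B \<in> GU" and "gscale (A ** B) = gscale A * gscale B"
proof -
  obtain a b u where A: "A = mat2 a b (u * cnj b) (u * cnj a)" "u * cnj u = 1" "cmod u = 1"
    by (rule GU_E[OF assms(1)])
  obtain a' b' u' where B: "B = mat2 a' b' (u' * cnj b') (u' * cnj a')" "u' * cnj u' = 1" "cmod u' = 1"
    by (rule GU_E[OF assms(2)])
  define a'' b'' where "a'' = a * a' + b * (u' * cnj b')" and "b'' = a * b' + b * (u' * cnj a')"
  have AB: "A ** B = mat2 a'' b'' (u * u' * cnj b'') (u * u' * cnj a'')"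
  proof -
    have "u * cnj b * a' + u * cnj a * (u' * cnj b') = u * u' * cnj a * cnj b' + u * (u' * cnj u') * cnj b * a'"
      "u * cnj b * b' + u * cnj a * (u' * cnj a') = u * u' * cnj a * cnj a' + u * (u' * cnj u') * cnj b * b'"
      unfolding B(2) by (simp_all add: algebra_simps)
    then show ?thesis
      unfolding A(1) B(1) mat2_mult a''_def b''_def complex_cnj_add complex_cnj_mult complex_cnj_cnj
      by (simp only:) (simp add: algebra_simps)
  qed
  have "complex_of_real (gscale (A ** B)) = (a * cnj a - (u' * cnj u') * (b * cnj b)) * (a' * cnj a' - b' * cnj b')"
    unfolding AB gscale_mat2 by (simp add: a''_def b''_def algebra_simps)
  also have "\<dots> = (a * cnj a - b * cnj b) * (a' * cnj a' - b' * cnj b')"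
    unfolding B(2) by (simp add: algebra_simps)
  also have "\<dots> = complex_of_real (gscale A * gscale B)"
    unfolding A(1) B(1) of_real_mult gscale_mat2 ..
  finally show g: "gscale (A ** B) = gscale A * gscale B" by (simp only: of_real_eq_iff)
  have "gscale (A ** B) > 0" using g assms by (simp add: gscale_pos)
  then have "cmod b'' < cmod a''" by (simp add: AB gscale_def power2_less_imp_less)
  moreover have "cmod (u * u') = 1" using A B by (simp add: norm_mult)
  ultimately show "A ** B \<in> GU" unfolding AB GU_def by blast
qed

text \<open>
  A point \<open>(T, X)\<close> stands for the Hermitian matrix \<open>P\<close> with diagonal entries \<open>T\<close> and
  off-diagonal entries \<open>X\<close>, \<open>cnj X\<close>, whose determinant is the Lorentz form. The action is
  \<open>P \<mapsto> A P A\<^sup>*\<close>; dividing it by \<open>\<bar>det A\<bar>\<close> in the next definition makes it isometric.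
  It does not see the phase of \<open>A\<close>.
\<close>

definition hact_raw :: "complex^2^2 \<Rightarrow> real \<times> complex \<Rightarrow> real \<times> complex"
  where "hact_raw A p =
    (((cmod (A$1$1))\<^sup>2 + (cmod (A$1$2))\<^sup>2) * fst p + 2 * Re (A$1$1 * cnj (A$1$2) * snd p),
     (A$1$1 * cnj (A$2$1) + A$1$2 * cnj (A$2$2)) * of_real (fst p)
       + A$1$1 * cnj (A$2$2) * snd p + A$1$2 * cnj (A$2$1) * cnj (snd p))"

definition hact :: "complex^2^2 \<Rightarrow> real \<times> complex \<Rightarrow> real \<times> complex"
  where "hact A p = (1 / gscale A) *\<^sub>R hact_raw A p"

lemma hact_raw_linear:
  "hact_raw A (p + q) = hact_raw A p + hact_raw A q" "hact_raw A (c *\<^sub>R p) = c *\<^sub>R hact_raw A p"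
  by (simp_all add: hact_raw_def algebra_simps scaleR_conv_of_real)

lemma fst_hact_raw_complex:
  "complex_of_real (fst (hact_raw (mat2 a b c d) (t, x))) =
     (a * cnj a + b * cnj b) * of_real t + a * cnj b * x + cnj a * b * cnj x"
proof -
  have "complex_of_real (2 * Re (a * cnj b * x)) = a * cnj b * x + cnj (a * cnj b * x)"
    by (rule complex_add_cnj[symmetric])
  then show ?thesis
    by (simp add: hact_raw_def complex_norm_square[symmetric] algebra_simps)
qed

lemma hact_raw_mult:
  assumes "B \<in> GU" "A \<in> GU"
  shows "hact_raw (A ** B) p = hact_raw A (hact_raw B p)"
proof -
  obtain a b u where A: "A = mat2 a b (u * cnj b) (u * cnj a)" "u * cnj u = 1" "cmod u = 1"
    by (rule GU_E[OF assms(2)])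
  obtain a' b' u' where B: "B = mat2 a' b' (u' * cnj b') (u' * cnj a')" "u' * cnj u' = 1" "cmod u' = 1"
    by (rule GU_E[OF assms(1)])
  obtain t x where p: "p = (t, x)" by force
  define t' where "t' = fst (hact_raw B p)"
  define x' where "x' = snd (hact_raw B p)"
  have t': "complex_of_real t' = (a' * cnj a' + b' * cnj b') * of_real t + a' * cnj b' * x + cnj a' * b' * cnj x"
    unfolding t'_def B(1) p fst_hact_raw_complex by (simp add: algebra_simps)
  have x': "x' = cnj u' * (2 * a' * b' * of_real t + a'\<^sup>2 * x + b'\<^sup>2 * cnj x)"
    unfolding x'_def B(1) p by (simp add: hact_raw_def algebra_simps power2_eq_square)
  have q: "hact_raw B p = (t', x')" by (simp add: t'_def x'_def)
  have cx: "cnj x' = u' * (2 * cnj a' * cnj b' * of_real t + (cnj a')\<^sup>2 * cnj x + (cnj b')\<^sup>2 * x)"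
    unfolding x' by simp
  have "complex_of_real (fst (hact_raw (A ** B) p)) = complex_of_real (fst (hact_raw A (hact_raw B p)))"
    unfolding q unfolding p A(1) B(1) mat2_mult fst_hact_raw_complex t' x' cx
      complex_cnj_add complex_cnj_mult complex_cnj_cnj complex_cnj_power complex_cnj_numeral
      complex_cnj_complex_of_real
    using B(2) by algebra
  moreover have "snd (hact_raw (A ** B) p) = snd (hact_raw A (hact_raw B p))"
    unfolding q unfolding p A(1) B(1) mat2_mult hact_raw_def mat2_nth fst_conv snd_conv t' x' cx
      complex_cnj_add complex_cnj_mult complex_cnj_cnj complex_cnj_power complex_cnj_numeral
      complex_cnj_complex_of_real
    using A(2) B(2) by algebra
  ultimately show ?thesis by (simp add: prod_eq_iff)
qed

lemma hact_mult:
  assumes "A \<in> GU" "B \<in> GU"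
  shows "hact (A ** B) p = hact A (hact B p)"
  using assms by (simp add: hact_def GU_mult hact_raw_mult hact_raw_linear)

lemma lor_complex: "complex_of_real (lor p q) = of_real (fst p) * of_real (fst q)
   - (snd p * cnj (snd q) + cnj (snd p) * snd q) / 2"
  by (simp add: lor_def complex_eq_iff inner_complex_def add_divide_distrib diff_divide_distrib)

lemma lor_hact_raw:
  assumes "A \<in> GU"
  shows "lor (hact_raw A p) (hact_raw A q) = (gscale A)\<^sup>2 * lor p q"
proof -
  obtain a b u where A: "A = mat2 a b (u * cnj b) (u * cnj a)" "u * cnj u = 1"
    by (rule GU_E[OF assms])
  obtain t x where p: "p = (t, x)" by force
  obtain s y where q: "q = (s, y)" by force
  have sn: "snd (hact_raw A (t, x)) = cnj u * (2 * a * b * of_real t + a\<^sup>2 * x + b\<^sup>2 * cnj x)" for t x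
    unfolding A(1) by (simp add: hact_raw_def algebra_simps power2_eq_square)
  have "complex_of_real (lor (hact_raw A p) (hact_raw A q)) = complex_of_real ((gscale A)\<^sup>2 * lor p q)"
    unfolding p q lor_complex sn of_real_mult of_real_power fst_conv snd_conv
      complex_cnj_add complex_cnj_mult complex_cnj_cnj complex_cnj_power complex_cnj_numeral
      complex_cnj_complex_of_real
    unfolding A(1) fst_hact_raw_complex gscale_mat2
    using A(2) by algebra
  then show ?thesis by (simp only: of_real_eq_iff)
qed

lemma lor_hact: "A \<in> GU \<Longrightarrow> lor (hact A p) (hact A q) = lor p q"
  using gscale_pos[of A]
  by (simp add: hact_def lor_scaleR_left lor_scaleR_right lor_hact_raw power2_eq_square)

lemma hact_in_hyp:
  assumes A: "A \<in> GU" and p: "p \<in> hyp"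
  shows "hact A p \<in> hyp"
proof -
  obtain a b u where A': "A = mat2 a b (u * cnj b) (u * cnj a)" "cmod b < cmod a"
    using GU_E[OF A] by metis
  have "(cmod (snd p))\<^sup>2 < (fst p)\<^sup>2" using hyp_cmod[OF p] by simp
  moreover have T: "fst p > 0" using p by (simp add: hyp_def)
  ultimately have X: "cmod (snd p) < fst p" by (simp add: power2_less_imp_less)
  have "\<bar>Re (a * cnj b * snd p)\<bar> \<le> cmod a * cmod b * cmod (snd p)"
    by (rule order_trans[OF abs_Re_le_cmod]) (simp add: norm_mult)
  also have "\<dots> \<le> cmod a * cmod b * fst p"
    using X by (intro mult_left_mono) auto
  finally have "2 * Re (a * cnj b * snd p) \<ge> - (2 * (cmod a * cmod b * fst p))" by linarith
  then have "fst (hact_raw A p) \<ge> (cmod a - cmod b)\<^sup>2 * fst p"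
    by (simp add: hact_raw_def A' power2_eq_square algebra_simps)
  moreover have "(cmod a - cmod b)\<^sup>2 * fst p > 0" using A' T by simp
  ultimately have "fst (hact A p) > 0" using gscale_pos[OF A] by (simp add: hact_def)
  then show ?thesis using p lor_hact[OF A, of p p] by (simp add: hyp_def)
qed

lemma hdist_hact: "A \<in> GU \<Longrightarrow> hdist (hact A p) (hact A q) = hdist p q"
  by (simp add: hdist_def lor_hact)

lemma hact_hmid: "A \<in> GU \<Longrightarrow> hact A (hmid p q) = hmid (hact A p) (hact A q)"
  unfolding hmid_def lor_hact by (simp add: hact_def hact_raw_linear scaleR_add_right mult.commute)

abbreviation hbase :: "real \<times> complex" where "hbase \<equiv> (1, 0)"

lemma hbase_in_hyp: "hbase \<in> hyp"
  by (simp add: hyp_def lor_def)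

definition mob :: "complex^2^2 \<Rightarrow> complex \<Rightarrow> complex"
  where "mob A = (\<lambda>z\<in>circle. (A$1$1 * z + A$1$2) / (A$2$1 * z + A$2$2))"

lemma mob_denominator_nonzero:
  assumes "A \<in> GU" "z \<in> circle"
  shows "A$2$1 * z + A$2$2 \<noteq> 0"
proof -
  obtain a b u where A: "A = mat2 a b (u * cnj b) (u * cnj a)" "cmod u = 1" "cmod b < cmod a"
    using GU_E[OF assms(1)] by metis
  have "cmod (u * cnj b * z) < cmod (u * cnj a)"
    using A assms(2) by (simp add: norm_mult)
  then show ?thesis
    by (metis A(1) add_eq_0_iff less_irrefl mat2_nth(3,4) norm_minus_cancel)
qed

lemma mob_eq_moebius_map:
  assumes "A \<in> GU" "cis \<kappa> = A$1$1 / A$2$2"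
  shows "mob A = moebius_map \<kappa> (- A$1$2 / A$1$1)"
proof -
  obtain a b u where A: "A = mat2 a b (u * cnj b) (u * cnj a)" "cmod u = 1" "cmod b < cmod a"
    using GU_E[OF assms(1)] by metis
  have a0: "a \<noteq> 0" "u \<noteq> 0" using A by auto
  have "mob A z = moebius_map \<kappa> (- A$1$2 / A$1$1) z" for z
  proof (cases "z \<in> circle")
    case True
    have "mob A z = (a * z + b) / (u * cnj b * z + u * cnj a)"
      using True by (simp add: mob_def A(1))
    also have "\<dots> = (a * (z + b / a)) / ((u * cnj a) * (1 + cnj b / cnj a * z))"
      using a0 by (simp add: algebra_simps)
    also have "\<dots> = cis \<kappa> * ((z - (- b / a)) / (1 - cnj (- b / a) * z))"
      using assms(2) by (simp add: A(1))
    finally show ?thesis using True by (simp add: moebius_map_def A(1))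
  qed (simp_all add: mob_def moebius_map_def)
  then show ?thesis by blast
qed

lemma mob_in_moebius:
  assumes "A \<in> GU"
  obtains \<kappa> where "mob A = moebius_map \<kappa> (- A$1$2 / A$1$1)" "cmod (- A$1$2 / A$1$1) < 1"
proof -
  obtain a b u where A: "A = mat2 a b (u * cnj b) (u * cnj a)" "cmod u = 1" "cmod b < cmod a"
    using GU_E[OF assms(1)] by metis
  then have a0: "a \<noteq> 0" by auto
  then have "cmod (A$1$1 / A$2$2) = 1" using A by (simp add: norm_divide norm_mult)
  then have "cis (Arg (A$1$1 / A$2$2)) = A$1$1 / A$2$2"
    by (subst cis_Arg) (auto simp: sgn_eq)
  moreover have "cmod (- A$1$2 / A$1$1) < 1" using A a0 by (simp add: norm_divide)
  ultimately show ?thesis using that mob_eq_moebius_map[OF assms] by blast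
qed

lemma moebius_eq_image_GU: "moebius = mob ` GU"
proof (intro equalityI subsetI)
  fix g assume "g \<in> moebius"
  then obtain \<kappa> \<sigma> where g: "g = moebius_map \<kappa> \<sigma>" "cmod \<sigma> < 1" by (auto simp: moebius_def)
  define A where "A = mat2 (cis \<kappa>) (- cis \<kappa> * \<sigma>) (- cnj \<sigma>) 1"
  have "A = mat2 (cis \<kappa>) (- cis \<kappa> * \<sigma>) (cis \<kappa> * cnj (- cis \<kappa> * \<sigma>)) (cis \<kappa> * cnj (cis \<kappa>))"
    by (simp add: A_def cis_cnj cis_mult flip: mult.assoc)
  then have A: "A \<in> GU"
    by (rule GU_I) (use g(2) in \<open>simp_all add: norm_mult\<close>)
  have "mob A = moebius_map \<kappa> (- A$1$2 / A$1$1)"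
    by (rule mob_eq_moebius_map[OF A]) (simp add: A_def)
  then have "mob A = g" by (simp add: g A_def)
  then show "g \<in> mob ` GU" using A by blast
next
  fix g assume "g \<in> mob ` GU"
  then obtain A where "A \<in> GU" "g = mob A" by blast
  then show "g \<in> moebius" unfolding moebius_def by (metis (mono_tags, lifting) mem_Collect_eq mob_in_moebius)
qed

lemma mob_circle:
  assumes "A \<in> GU" "z \<in> circle"
  shows "mob A z \<in> circle"
proof -
  obtain a b u where A: "A = mat2 a b (u * cnj b) (u * cnj a)" "cmod u = 1" "cmod b < cmod a"
    using GU_E[OF assms(1)] by metis
  have zz: "z * cnj z = 1" using assms(2) by (simp add: complex_norm_square[symmetric])
  have "u * cnj b * z + u * cnj a = u * z * cnj (a * z + b)"
    using zz by (simp add: algebra_simps)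
  then have "cmod (u * cnj b * z + u * cnj a) = cmod (a * z + b)"
    using assms(2) A by (simp add: norm_mult del: complex_cnj_add complex_cnj_mult)
  moreover have "cmod (u * cnj b * z + u * cnj a) \<noteq> 0"
    using mob_denominator_nonzero[OF assms] by (simp add: A)
  ultimately have "cmod ((a * z + b) / (u * cnj b * z + u * cnj a)) = 1"
    unfolding norm_divide by simp
  then show ?thesis using assms(2) by (simp add: mob_def A)
qed

lemma mob_mult:
  assumes A: "A \<in> GU" and B: "B \<in> GU"
  shows "mob (A ** B) = compose circle (mob A) (mob B)"
proof
  fix z
  show "mob (A ** B) z = compose circle (mob A) (mob B) z"
  proof (cases "z \<in> circle")
    case True
    define n where "n = B$1$1 * z + B$1$2"
    define d where "d = B$2$1 * z + B$2$2"
    have d0: "d \<noteq> 0" unfolding d_def using mob_denominator_nonzero[OF B True] .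
    have Bz: "mob B z = n / d" using True by (simp add: mob_def n_def d_def)
    have "compose circle (mob A) (mob B) z = (A$1$1 * (n / d) + A$1$2) / (A$2$1 * (n / d) + A$2$2)"
      using True mob_circle[OF B True] Bz by (simp add: compose_def mob_def)
    also have "\<dots> = (d * (A$1$1 * (n / d) + A$1$2)) / (d * (A$2$1 * (n / d) + A$2$2))"
      using d0 by simp
    also have "\<dots> = (A$1$1 * n + A$1$2 * d) / (A$2$1 * n + A$2$2 * d)"
      using d0 by (simp add: algebra_simps)
    also have "\<dots> = mob (A ** B) z"
      using True by (simp add: mob_def n_def d_def matrix_matrix_mult_def sum_2 algebra_simps)
    finally show ?thesis ..
  qed (simp add: mob_def compose_def)
qed

lemma mob_scalar: "c \<noteq> 0 \<Longrightarrow> mob (mat2 c 0 0 c) = cone"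
  by (auto simp: mob_def BijGroup_def fun_eq_iff)

lemma mob_in_Bij:
  assumes "A \<in> GU"
  shows "mob A \<in> carrier circle_group"
proof -
  obtain a b u where A: "A = mat2 a b (u * cnj b) (u * cnj a)" "u * cnj u = 1" "cmod u = 1" "cmod b < cmod a"
    using GU_E[OF assms] by metis
  define B where "B = mat2 (u * cnj a) (- b) (- (u * cnj b)) a"
  have "B = mat2 (u * cnj a) (- b) (u * cnj (- b)) (u * cnj (u * cnj a))"
    using A(2) by (simp add: B_def flip: mult.assoc)
  then have B: "B \<in> GU" by (rule GU_I) (use A in \<open>simp_all add: norm_mult\<close>)
  define c where "c = u * (a * cnj a - b * cnj b)"
  have "complex_of_real (gscale A) \<noteq> 0"
    using gscale_pos[OF assms] by simp
  then have c0: "c \<noteq> 0" using A(3) unfolding c_def A(1) gscale_mat2 by auto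
  have "A ** B = mat2 c 0 0 c" "B ** A = mat2 c 0 0 c"
    by (simp_all add: A(1) B_def mat2_mult c_def algebra_simps)
  then have "compose circle (mob A) (mob B) = cone" "compose circle (mob B) (mob A) = cone"
    using mob_mult[OF assms B] mob_mult[OF B assms] mob_scalar[OF c0] by simp_all
  then have "compose circle (mob A) (mob B) = (\<lambda>z\<in>circle. z)" "compose circle (mob B) (mob A) = (\<lambda>z\<in>circle. z)"
    by (simp_all only: BijGroup_def monoid.simps)
  note inv_fun = fun_cong[OF this(1)] fun_cong[OF this(2)]
  have inv: "mob A (mob B z) = z" "mob B (mob A z) = z" if "z \<in> circle" for z
    using inv_fun[of z] that by (simp_all only: compose_eq restrict_apply if_True)
  have "bij_betw (mob A) circle circle"
    by (rule bij_betw_byWitness[where f' = "mob B"]) (use inv mob_circle assms B in auto)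
  then show ?thesis by (simp add: BijGroup_def Bij_def mob_def)
qed

lemma mob_mult': "A \<in> GU \<Longrightarrow> B \<in> GU \<Longrightarrow> mob A \<cdot> mob B = mob (A ** B)"
  using mob_in_Bij[of A] mob_in_Bij[of B] by (simp add: mob_mult BijGroup_def)

text \<open>
  A multiple of the hyperbolic translation along the geodesic through \<open>p\<close> that carries
  \<open>p\<close> to the base point; \<open>unboost\<close> below inverts it up to a scalar. Depending continuously on \<open>p\<close>, it
  turns sections of the plane into maps to the Moebius group.
\<close>

definition boost :: "real \<times> complex \<Rightarrow> complex^2^2"
  where "boost p = mat2 (of_real (fst p + 1)) (- snd p) (- cnj (snd p)) (of_real (fst p + 1))"

definition unboost :: "real \<times> complex \<Rightarrow> complex^2^2"
  where "unboost p = mat2 (of_real (fst p + 1)) (snd p) (cnj (snd p)) (of_real (fst p + 1))"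

lemma hyp_fst_ge_1: "p \<in> hyp \<Longrightarrow> fst p \<ge> 1"
  using lor_ge_1[OF hbase_in_hyp, of p] by (simp add: lor_def)

lemma unboost_in_GU:
  assumes "p \<in> hyp" shows "unboost p \<in> GU" and "boost p \<in> GU"
proof -
  have "(cmod (snd p))\<^sup>2 < (fst p + 1)\<^sup>2"
    unfolding hyp_cmod[OF assms] using hyp_fst_ge_1[OF assms] by (simp add: power2_eq_square algebra_simps)
  then have lt: "cmod (snd p) < cmod (of_real (fst p + 1))"
    using hyp_fst_ge_1[OF assms] by (simp add: power2_less_imp_less del: of_real_add)
  have u: "unboost p = mat2 (of_real (fst p + 1)) (snd p) (1 * cnj (snd p)) (1 * cnj (of_real (fst p + 1)))"
    and b: "boost p = mat2 (of_real (fst p + 1)) (- snd p) (1 * cnj (- snd p)) (1 * cnj (of_real (fst p + 1)))"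
    by (simp_all add: boost_def unboost_def)
  show "unboost p \<in> GU" by (rule GU_I[OF u norm_one lt])
  show "boost p \<in> GU" by (rule GU_I[OF b norm_one]) (simp only: norm_minus_cancel lt)
qed

lemma hact_unboost:
  assumes "p \<in> hyp" shows "hact (unboost p) hbase = p"
proof -
  obtain t x where p: "p = (t, x)" by force
  have x: "(cmod x)\<^sup>2 = t\<^sup>2 - 1" using hyp_cmod[OF assms] by (simp add: p)
  have t: "t \<ge> 1" using hyp_fst_ge_1[OF assms] by (simp add: p)
  have c: "cmod (1 + of_real t) = 1 + t" using t by (metis abs_of_nonneg add_nonneg_nonneg norm_of_real of_real_1 of_real_add order_trans zero_le_one)
  have g: "gscale (unboost p) = 2 * (t + 1)"
    by (simp add: gscale_def unboost_def p x c add.commute) (simp add: power2_eq_square algebra_simps)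
  have h: "hact_raw (unboost p) hbase = ((2 * (t + 1)) *\<^sub>R p)"
    by (simp add: hact_raw_def unboost_def p x c add.commute)
      (simp add: power2_eq_square algebra_simps scaleR_conv_of_real)
  show ?thesis using t by (simp add: hact_def g h)
qed

lemma mob_unboost:
  assumes "p \<in> hyp"
  shows "cinv (mob (boost p)) = mob (unboost p)"
proof -
  interpret group circle_group by (rule group_BijGroup)
  define c where "c = complex_of_real ((fst p + 1)\<^sup>2 - (cmod (snd p))\<^sup>2)"
  have "(fst p + 1)\<^sup>2 - (cmod (snd p))\<^sup>2 \<noteq> 0"
    unfolding hyp_cmod[OF assms] using hyp_fst_ge_1[OF assms] by (simp add: power2_eq_square algebra_simps)
  then have c0: "c \<noteq> 0" unfolding c_def by (simp only: of_real_eq_0_iff not_False_eq_True)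
  have "unboost p ** boost p = mat2 c 0 0 c"
    by (simp add: boost_def unboost_def mat2_mult c_def complex_norm_square[symmetric] power2_eq_square algebra_simps)
  then have "mob (unboost p) \<cdot> mob (boost p) = cone"
    using mob_mult'[of "unboost p" "boost p"] mob_scalar[OF c0] assms by (simp add: unboost_in_GU)
  then show ?thesis
    using mob_in_Bij unboost_in_GU[OF assms] by (intro inv_equality) auto
qed

lemma fst_hact_base:
  "fst (hact A hbase) = ((cmod (A$1$1))\<^sup>2 + (cmod (A$1$2))\<^sup>2) / gscale A"
  by (simp add: hact_def hact_raw_def)

section \<open>Continuity into the Moebius group\<close>

text \<open>
  The inverse of the passage from real matrices to pairs \<open>(\<alpha>, \<beta>)\<close> in
  \<open>moebius_of_SL2_eq\<close>.
\<close>

definition real_form :: "complex \<Rightarrow> complex \<Rightarrow> real^2^2"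
  where "real_form \<alpha> \<beta> =
    vector [vector [Re \<alpha> + Re \<beta>, Im \<beta> - Im \<alpha>], vector [Im \<alpha> + Im \<beta>, Re \<alpha> - Re \<beta>]]"

lemma moebius_of_real_form:
  assumes "(cmod \<alpha>)\<^sup>2 - (cmod \<beta>)\<^sup>2 = 1"
  shows "real_form \<alpha> \<beta> \<in> SL2"
    and "moebius_of_SL2 (real_form \<alpha> \<beta>) = mob (mat2 \<alpha> \<beta> (cnj \<beta>) (cnj \<alpha>))"
proof -
  let ?A = "real_form \<alpha> \<beta>"
  show A: "?A \<in> SL2"
    using assms unfolding cmod_power2
    by (simp add: SL2_def det_2 real_form_def power2_eq_square algebra_simps)
  have al: "Complex ((?A$1$1 + ?A$2$2) / 2) ((?A$2$1 - ?A$1$2) / 2) = \<alpha>"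
    and be: "Complex ((?A$1$1 - ?A$2$2) / 2) ((?A$1$2 + ?A$2$1) / 2) = \<beta>"
    by (simp_all add: real_form_def complex_eq_iff)
  show "moebius_of_SL2 ?A = mob (mat2 \<alpha> \<beta> (cnj \<beta>) (cnj \<alpha>))"
  proof
    fix z
    show "moebius_of_SL2 ?A z = mob (mat2 \<alpha> \<beta> (cnj \<beta>) (cnj \<alpha>)) z"
      using moebius_of_SL2_eq(1)[OF A, of z] unfolding al be
      by (cases "z \<in> circle") (simp_all add: mob_def moebius_of_SL2_def add.commute)
  qed
qed

lemma mob_scale: 
  assumes "k \<noteq> 0"
  shows "mob (mat2 (k * a) (k * b) (k * c) (k * d)) = mob (mat2 a b c d)"
proof
  fix z
  have "(k * a * z + k * b) / (k * c * z + k * d) = (k * (a * z + b)) / (k * (c * z + d))"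
    by (simp add: algebra_simps)
  also have "\<dots> = (a * z + b) / (c * z + d)" using assms by simp
  finally show "mob (mat2 (k * a) (k * b) (k * c) (k * d)) z = mob (mat2 a b c d) z"
    by (simp add: mob_def)
qed

text \<open>
  The topology of the Moebius group is a quotient of \<open>SL(2,\<real>)\<close>, so continuity follows
  from a continuous lift to \<open>SL(2,\<real>)\<close>. The matrix \<open>N\<close> with phase \<open>u\<close> is normalized by dividing it
  by a square root \<open>s\<close> of \<open>u\<close> and by the root of its scale.
\<close>

lemma continuous_map_mob_of_root:
  fixes N :: "'a::topological_space \<Rightarrow> complex^2^2"
  assumes N: "continuous_on X N" "\<And>x. x \<in> X \<Longrightarrow> N x \<in> GU"
    and s: "continuous_on X s" "\<And>x. x \<in> X \<Longrightarrow> (s x)\<^sup>2 = N x $2$2 / cnj (N x $1$1)"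
  shows "continuous_map (top_of_set X) moebius_topology (\<lambda>x. mob (N x))"
proof -
  \<comment> \<open>\<open>N = k \<cdot> (\<alpha>, \<beta>; cnj \<beta>, cnj \<alpha>)\<close> with the second factor in \<open>SU(1,1)\<close>\<close>
  define k where "k x = s x * of_real (sqrt (gscale (N x)))" for x
  define a where "a x = N x $1$1 / k x" for x
  define b where "b x = N x $1$2 / k x" for x
  have main: "k x \<noteq> 0 \<and> (cmod (a x))\<^sup>2 - (cmod (b x))\<^sup>2 = 1 \<and> 
      N x = mat2 (k x * a x) (k x * b x) (k x * cnj (b x)) (k x * cnj (a x))" if x: "x \<in> X" for x
  proof -
    obtain \<alpha> \<beta> u where A: "N x = mat2 \<alpha> \<beta> (u * cnj \<beta>) (u * cnj \<alpha>)" "u * cnj u = 1" "cmod u = 1" "cmod \<beta> < cmod \<alpha>"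
      using GU_E[OF N(2)[OF x]] by metis
    have a0: "\<alpha> \<noteq> 0" using A by auto
    then have su: "(s x)\<^sup>2 = u" using s(2)[OF x] by (simp add: A)
    then have "(cmod (s x))\<^sup>2 = 1" using A(3) by (simp flip: norm_power)
    then have sn: "cmod (s x) = 1" using power2_eq_iff_nonneg[of "cmod (s x)" 1] by simp
    have g: "gscale (N x) > 0" using N(2)[OF x] by (rule gscale_pos)
    have k0: "k x \<noteq> 0" using g sn by (auto simp: k_def)
    have kn: "(cmod (k x))\<^sup>2 = gscale (N x)" using g sn by (simp add: k_def norm_mult)
    have "(cmod (a x))\<^sup>2 - (cmod (b x))\<^sup>2 = gscale (N x) / gscale (N x)"
      unfolding a_def b_def norm_divide power_divide kn by (simp add: gscale_def diff_divide_distrib[symmetric])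
    moreover have "k x / cnj (k x) = u"
    proof -
      have "s x * cnj (s x) = 1" using sn by (simp add: complex_norm_square[symmetric])
      moreover have "cnj (s x) \<noteq> 0" using sn by auto
      ultimately have "s x / cnj (s x) = (s x)\<^sup>2"
        by (simp add: divide_eq_eq power2_eq_square mult.assoc)
      then show ?thesis using g by (simp add: k_def su)
    qed
    then have "k x * cnj (b x) = u * cnj \<beta>" "k x * cnj (a x) = u * cnj \<alpha>"
      by (auto simp: a_def b_def A(1))
    moreover have "k x * a x = \<alpha>" "k x * b x = \<beta>"
      using k0 by (simp_all add: a_def b_def A(1))
    ultimately show ?thesis using k0 g A(1) by simp
  qed
  have "continuous_on X (\<lambda>x. gscale (N x))" unfolding gscale_def by (intro continuous_intros N)
  then have "continuous_on X k" unfolding k_def by (intro continuous_intros s)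
  moreover have "\<forall>x\<in>X. k x \<noteq> 0" using main by blast
  ultimately have "continuous_on X (\<lambda>x. N x $1$1 / k x)" "continuous_on X (\<lambda>x. N x $1$2 / k x)"
    by (auto intro!: continuous_intros N)
  then have ab: "continuous_on X a" "continuous_on X b" by (simp_all add: a_def[abs_def] b_def[abs_def])
  have "continuous_on X (\<lambda>x. real_form (a x) (b x))"
  proof -
    have "continuous_on X (\<lambda>x. real_form (a x) (b x) $ i $ j)" if "i \<in> {1, 2}" "j \<in> {1, 2}" for i j
      using that unfolding real_form_def
      by (elim insertE emptyE; hypsubst; unfold vector_2) (intro continuous_intros ab)+
    then have "continuous_on X (\<lambda>x. real_form (a x) (b x) $ i $ j)" for i j
      using exhaust_2[of i] exhaust_2[of j] by blast
    then have "continuous_on X (\<lambda>x. \<chi> i j. real_form (a x) (b x) $ i $ j)"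
      by (intro continuous_on_vec_lambda)
    then show ?thesis by simp
  qed
  moreover have "(\<lambda>x. real_form (a x) (b x)) \<in> X \<rightarrow> SL2"
    using main moebius_of_real_form(1) by blast
  ultimately have "continuous_map (top_of_set X) (top_of_set SL2) (\<lambda>x. real_form (a x) (b x))"
    by (simp add: image_subset_iff_funcset)
  then have "continuous_map (top_of_set X) moebius_topology (moebius_of_SL2 \<circ> (\<lambda>x. real_form (a x) (b x)))"
    by (rule continuous_map_compose[OF _ quotient_imp_continuous_map[OF quotient_map_moebius_of_SL2]])
  moreover have "(moebius_of_SL2 \<circ> (\<lambda>x. real_form (a x) (b x))) x = mob (N x)" if "x \<in> X" for x
  proof -
    have "N x = mat2 (k x * a x) (k x * b x) (k x * cnj (b x)) (k x * cnj (a x))" "k x \<noteq> 0"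
      using main[OF that] by auto
    then have "mob (N x) = mob (mat2 (a x) (b x) (cnj (b x)) (cnj (a x)))"
      by (metis mob_scale)
    then show ?thesis using main[OF that] moebius_of_real_form(2)[of "a x" "b x"] by simp
  qed
  ultimately show ?thesis by (rule continuous_map_eq) simp
qed

text \<open>
  A square root of the phase need not exist globally. But one exists where \<open>u\<close>
  avoids the negative half line, and another one where \<open>- u\<close> does; these two open sets cover.
\<close>

lemma continuous_map_mob:
  fixes N :: "'a::topological_space \<Rightarrow> complex^2^2"
  assumes N: "continuous_on X N" "\<And>x. x \<in> X \<Longrightarrow> N x \<in> GU"
  shows "continuous_map (top_of_set X) moebius_topology (\<lambda>x. mob (N x))"
proof -
  define u where "u x = N x $2$2 / cnj (N x $1$1)" for x
  have nz: "cnj (N x $ 1 $ 1) \<noteq> 0" and u0: "u x \<noteq> 0" if x: "x \<in> X" for x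
  proof -
    obtain a b v where A: "N x = mat2 a b (v * cnj b) (v * cnj a)" "cmod v = 1" "cmod b < cmod a"
      using GU_E[OF N(2)[OF x]] by metis
    then have "a \<noteq> 0" "v \<noteq> 0" by auto
    then show "cnj (N x $ 1 $ 1) \<noteq> 0" "u x \<noteq> 0" by (simp_all add: A(1) u_def)
  qed
  have cu: "continuous_on X u" unfolding u_def by (intro continuous_intros N ballI nz)
  define T where "T i = {x \<in> X. (if i then u x else - u x) \<in> - \<real>\<^sub>\<le>\<^sub>0}" for i :: bool
  define r where "r i x = (if i then csqrt (u x) else \<i> * csqrt (- u x))" for i x
  have T: "T i = X \<inter> (\<lambda>x. if i then u x else - u x) -` (- \<real>\<^sub>\<le>\<^sub>0)" for i by (auto simp: T_def)
  have ci: "continuous_on X (\<lambda>x. if i then u x else - u x)" for i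
    by (cases i) (auto intro!: continuous_intros cu)
  have op: "openin (top_of_set X) (T i)" for i
    unfolding T by (intro continuous_openin_preimage_gen ci) (simp add: open_Compl)
  have loc: "continuous_map (subtopology (top_of_set X) (T i)) moebius_topology (\<lambda>x. mob (N x))" for i
  proof -
    have TX: "T i \<subseteq> X" by (auto simp: T_def)
    have cT: "continuous_on (T i) (\<lambda>x. csqrt (if i then u x else - u x))"
      by (rule continuous_on_compose2[OF continuous_on_csqrt continuous_on_subset[OF ci TX]])
        (auto simp: T_def)
    have "continuous_on (T i) (r i)"
    proof (cases i)
      case True
      then show ?thesis using cT by (simp add: r_def[abs_def])
    next
      case False
      then show ?thesis using cT by (simp add: r_def[abs_def] continuous_on_mult_left)
    qed
    moreover have "(r i x)\<^sup>2 = u x" for x by (simp add: r_def power_mult_distrib)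
    ultimately have "continuous_map (top_of_set (T i)) moebius_topology (\<lambda>x. mob (N x))"
      using N TX by (intro continuous_map_mob_of_root[of _ _ "r i"])
        (auto simp: u_def intro: continuous_on_subset)
    then show ?thesis using TX by (simp add: subtopology_subtopology inf.absorb2)
  qed
  have cover: "\<exists>i. x \<in> T i" if x: "x \<in> X" for x
  proof (cases "u x \<in> \<real>\<^sub>\<le>\<^sub>0")
    case True
    then have "- u x \<notin> \<real>\<^sub>\<le>\<^sub>0"
      using u0[OF x] by (auto simp: complex_nonpos_Reals_iff complex_nonneg_Reals_iff complex_eq_iff)
    then have "x \<in> T False" using x by (simp add: T_def)
    then show ?thesis ..
  next
    case False
    then have "x \<in> T True" using x by (simp add: T_def)
    then show ?thesis ..
  qed
  show ?thesis
  proof (rule pasting_lemma)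
    show "openin (top_of_set X) (T i)" if "i \<in> UNIV" for i by (rule op)
    show "continuous_map (subtopology (top_of_set X) (T i)) moebius_topology (\<lambda>x. mob (N x))" if "i \<in> UNIV" for i
      by (rule loc)
    show "\<exists>j. j \<in> UNIV \<and> x \<in> T j \<and> mob (N x) = mob (N x)" if "x \<in> topspace (top_of_set X)" for x
      using cover[of x] that by simp
  qed (rule refl)
qed

section \<open>Growth of the derivatives of iterates\<close>

lemma periodic_int:
  fixes h :: "real \<Rightarrow> real"
  assumes "\<And>t. h (t + 2 * pi) = h t + c"
  shows "h (t + 2 * pi * of_int k) = h t + c * of_int k"
proof (induction k rule: int_induct[where k = 0])
  case (step1 i)
  have "h (t + 2 * pi * of_int (i + 1)) = h ((t + 2 * pi * of_int i) + 2 * pi)" by (simp add: algebra_simps)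
  also have "\<dots> = h (t + 2 * pi * of_int i) + c" by (rule assms)
  finally show ?case using step1 by (simp add: algebra_simps)
next
  case (step2 i)
  have "h (t + 2 * pi * of_int i) = h ((t + 2 * pi * of_int (i - 1)) + 2 * pi)" by (simp add: algebra_simps)
  also have "\<dots> = h (t + 2 * pi * of_int (i - 1)) + c" by (rule assms)
  finally show ?case using step2 by (simp add: algebra_simps)
qed simp

lemma mod_2pi: obtains k :: int where "t + 2 * pi * of_int k \<in> {0..<2 * pi}"
proof -
  define x where "x = t / (2 * pi)"
  have t: "t = 2 * pi * x" by (simp add: x_def)
  have fr: "0 \<le> x - of_int \<lfloor>x\<rfloor>" "x - of_int \<lfloor>x\<rfloor> < 1" by linarith+
  have "t + 2 * pi * of_int (- \<lfloor>x\<rfloor>) = 2 * pi * (x - of_int \<lfloor>x\<rfloor>)" by (simp add: t algebra_simps)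
  moreover have "2 * pi * (x - of_int \<lfloor>x\<rfloor>) \<in> {0..<2 * pi}" using fr by simp
  ultimately show ?thesis using that by metis
qed

lemma periodic_bounded:
  fixes h :: "real \<Rightarrow> real"
  assumes "continuous_on UNIV h" "\<And>t. h (t + 2 * pi) = h t"
  obtains K where "K > 0" "\<And>t. \<bar>h t\<bar> \<le> K"
proof -
  have "compact (h ` {0..2 * pi})"
    using assms(1) by (intro compact_continuous_image continuous_on_subset[OF assms(1)]) auto
  then obtain B where B: "B > 0" "\<forall>x\<in>h ` {0..2 * pi}. norm x \<le> B"
    using compact_imp_bounded bounded_pos by blast
  have "\<bar>h t\<bar> \<le> B" for t
  proof -
    obtain k :: int where k: "t + 2 * pi * of_int k \<in> {0..<2 * pi}" by (rule mod_2pi)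
    have "h (t + 2 * pi * of_int k) = h t" using periodic_int[of h 0 t k] assms(2) by simp
    then show ?thesis using B(2) k by (metis atLeastLessThan_iff atLeastAtMost_iff image_eqI less_imp_le real_norm_def)
  qed
  then show ?thesis using that B(1) by blast
qed

lemma periodic_bounded_below:
  fixes h :: "real \<Rightarrow> real"
  assumes "continuous_on UNIV h" "\<And>t. h (t + 2 * pi) = h t" "\<And>t. h t > 0"
  obtains m where "m > 0" "\<And>t. h t \<ge> m"
proof -
  have "\<exists>K>0. \<forall>t. \<bar>inverse (h t)\<bar> \<le> K"
    by (rule periodic_bounded[of "\<lambda>t. inverse (h t)"])
      (use assms in \<open>auto intro!: continuous_intros simp: less_imp_neq[symmetric]\<close>)
  then obtain K where K: "K > 0" "\<And>t. \<bar>inverse (h t)\<bar> \<le> K" by blast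
  have "h t \<ge> inverse K" for t
  proof -
    have "inverse (h t) \<le> K" using K(2)[of t] by linarith
    then have "inverse K \<le> inverse (inverse (h t))" using assms(3)[of t] by (intro le_imp_inverse_le) auto
    then show ?thesis by simp
  qed
  then show ?thesis using that K(1) by (metis positive_imp_inverse_positive)
qed

text \<open>
  Disjoint arcs of the circle have total length at most \<open>2\<pi>\<close>. Translating all
  left endpoints into \<open>[0, 2\<pi>)\<close> gives disjoint intervals in \<open>[0, 4\<pi>]\<close>; the weaker constant is
  the price of not cutting arcs at \<open>0\<close>.
\<close>

lemma sum_lengths_disjoint_arcs:
  fixes a len :: "'i \<Rightarrow> real"
  assumes fin: "finite T"
    and len: "\<And>t. t \<in> T \<Longrightarrow> 0 \<le> len t \<and> len t \<le> 2 * pi"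
    and dis: "\<And>s t p k. s \<in> T \<Longrightarrow> t \<in> T \<Longrightarrow> s \<noteq> t \<Longrightarrow> p \<in> {a s..a s + len s} \<Longrightarrow>
      p + 2 * pi * of_int k \<notin> {a t..a t + len t}"
  shows "sum len T \<le> 4 * pi"
proof -
  have "\<exists>k::int. a t + 2 * pi * of_int k \<in> {0..<2 * pi}" for t by (metis mod_2pi)
  then obtain k :: "'i \<Rightarrow> int" where k: "\<And>t. a t + 2 * pi * of_int (k t) \<in> {0..<2 * pi}" by metis
  define A where "A t = {a t + 2 * pi * of_int (k t)..a t + 2 * pi * of_int (k t) + len t}" for t
  have disj: "disjoint_family_on A T"
    unfolding disjoint_family_on_def
  proof (intro ballI impI)
    fix s t assume st: "s \<in> T" "t \<in> T" "s \<noteq> t"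
    show "A s \<inter> A t = {}"
    proof (rule ccontr)
      assume "A s \<inter> A t \<noteq> {}"
      then obtain p where p: "p \<in> A s" "p \<in> A t" by blast
      have "p - 2 * pi * of_int (k s) \<in> {a s..a s + len s}" using p(1) by (auto simp: A_def)
      from dis[OF st this, of "k s - k t"] show False using p(2) by (auto simp: A_def algebra_simps)
    qed
  qed
  have "sum len T = (\<Sum>t\<in>T. measure lborel (A t))"
    using len by (intro sum.cong) (auto simp: A_def)
  also have "\<dots> = measure lborel (\<Union>t\<in>T. A t)"
    using fin disj by (intro measure_finite_Union[symmetric]) (auto simp: A_def[abs_def] emeasure_lborel_Icc_eq)
  also have "\<dots> \<le> measure lborel {0..4 * pi}"
  proof (rule measure_mono_fmeasurable)
    have "A t \<subseteq> {0..4 * pi}" if "t \<in> T" for t using k[of t] len[OF that] by (auto simp: A_def)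
    then show "(\<Union>t\<in>T. A t) \<subseteq> {0..4 * pi}" by blast
    show "(\<Union>t\<in>T. A t) \<in> sets lborel" using fin by (auto simp: A_def)
  qed (simp add: fmeasurable_def)
  finally show ?thesis by simp
qed

text \<open>
  Lifts of orientation-preserving \<open>C\<^sup>2\<close> diffeomorphisms of the circle, with their first two
  derivatives.
\<close>

locale circle_lift =
  fixes F F' F'' :: "real \<Rightarrow> real"
  assumes F_deriv: "\<And>t. (F has_real_derivative F' t) (at t)"
    and F'_deriv: "\<And>t. (F' has_real_derivative F'' t) (at t)"
    and F''_cont: "continuous_on UNIV F''"
    and F'_pos: "\<And>t. F' t > 0"
    and F_period: "\<And>t. F (t + 2 * pi) = F t + 2 * pi"
begin

lemma F_cont: "continuous_on S F"
  using F_deriv by (intro continuous_at_imp_continuous_on ballI DERIV_isCont)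

lemma F'_cont: "continuous_on S F'"
  using F'_deriv by (intro continuous_at_imp_continuous_on ballI DERIV_isCont)

lemma F_strict_mono: "s < t \<Longrightarrow> F s < F t"
  by (rule DERIV_pos_imp_increasing[of s t F]) (use F_deriv F'_pos in blast)+

lemma F_mono: "s \<le> t \<Longrightarrow> F s \<le> F t"
  using F_strict_mono[of s t] by (cases "s = t") auto

lemma F_inj: "F s = F t \<Longrightarrow> s = t"
  using F_strict_mono[of s t] F_strict_mono[of t s] by (cases s t rule: linorder_cases) auto

lemma F_period_int: "F (t + 2 * pi * of_int k) = F t + 2 * pi * of_int k"
  by (rule periodic_int) (rule F_period)

lemma F'_period: "F' (t + 2 * pi) = F' t"
proof -
  have "((\<lambda>x. F (x + 2 * pi)) has_real_derivative F' (t + 2 * pi)) (at t)"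
    using F_deriv[of "t + 2 * pi"] by (simp add: DERIV_shift)
  moreover have "((\<lambda>x. F (x + 2 * pi)) has_real_derivative F' t) (at t)"
    unfolding F_period using F_deriv by (auto intro!: derivative_eq_intros)
  ultimately show ?thesis by (rule DERIV_unique)
qed

lemma F''_period: "F'' (t + 2 * pi) = F'' t"
proof -
  have "((\<lambda>x. F' (x + 2 * pi)) has_real_derivative F'' (t + 2 * pi)) (at t)"
    using F'_deriv[of "t + 2 * pi"] by (simp add: DERIV_shift)
  then show ?thesis unfolding F'_period using F'_deriv DERIV_unique by blast
qed

lemma F_intermediate:
  assumes "a \<le> b" "p \<in> {F a..F b}"
  obtains w where "w \<in> {a..b}" "F w = p"
proof -
  have "\<exists>x\<ge>a. x \<le> b \<and> F x = p" by (rule IVT') (use assms F_cont in auto)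
  then show ?thesis using that by auto
qed

lemma F_mvt:
  assumes "a < b"
  obtains w where "w \<in> {a..b}" "F b - F a = (b - a) * F' w"
proof -
  have "\<exists>z>a. z < b \<and> F b - F a = (b - a) * F' z" by (rule MVT2[OF assms]) (rule F_deriv)
  then show ?thesis using that by (metis atLeastAtMost_iff less_imp_le)
qed

definition DF :: "nat \<Rightarrow> real \<Rightarrow> real"
  where "DF n t = (\<Prod>i<n. F' ((F ^^ i) t))"

text \<open>
  The derivative of \<open>DF n\<close>, written as \<open>DF n\<close> times its logarithmic derivative; the latter is a
  Birkhoff type sum of \<open>F'' / F'\<close> in which only first derivatives of iterates occur.
\<close>

definition D2F :: "nat \<Rightarrow> real \<Rightarrow> real"
  where "D2F n t = DF n t * (\<Sum>i<n. F'' ((F ^^ i) t) / F' ((F ^^ i) t) * DF i t)"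

lemma iterate: "circle_lift (F ^^ n) (DF n) (D2F n)"
proof (induction n)
  case 0
  show ?case by unfold_locales (auto simp: DF_def D2F_def id_def intro!: derivative_eq_intros)
next
  case (Suc n)
  interpret G: circle_lift "F ^^ n" "DF n" "D2F n" by (rule Suc)
  have DF: "DF (Suc n) t = F' ((F ^^ n) t) * DF n t" for t by (simp add: DF_def)
  have D2F: "D2F (Suc n) t = F'' ((F ^^ n) t) * DF n t * DF n t + F' ((F ^^ n) t) * D2F n t" for t
    using F'_pos[of "(F ^^ n) t"] by (simp add: D2F_def DF algebra_simps)
  have d: "((\<lambda>t. F ((F ^^ n) t)) has_real_derivative DF (Suc n) t) (at t)" for t
    unfolding DF by (rule DERIV_chain2[OF F_deriv G.F_deriv])
  have d': "((\<lambda>t. F' ((F ^^ n) t)) has_real_derivative F'' ((F ^^ n) t) * DF n t) (at t)" for t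
    by (rule DERIV_chain2[OF F'_deriv G.F_deriv])
  have d2: "(DF (Suc n) has_real_derivative D2F (Suc n) t) (at t)" for t
    unfolding D2F DF[abs_def] by (rule DERIV_cong[OF DERIV_mult[OF d' G.F'_deriv]]) (simp add: algebra_simps)
  show ?case
  proof unfold_locales
    show "((F ^^ Suc n) has_real_derivative DF (Suc n) t) (at t)" for t using d by (simp add: o_def)
    show "(DF (Suc n) has_real_derivative D2F (Suc n) t) (at t)" for t by (rule d2)
    show "continuous_on UNIV (D2F (Suc n))"
      unfolding D2F[abs_def]
      by (intro continuous_intros continuous_on_compose2[OF F''_cont] continuous_on_compose2[OF F'_cont]
        G.F_cont G.F'_cont G.F''_cont) auto
    show "DF (Suc n) t > 0" for t unfolding DF using F'_pos G.F'_pos by simp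
    show "(F ^^ Suc n) (t + 2 * pi) = (F ^^ Suc n) t + 2 * pi" for t
      using G.F_period F_period by simp
  qed
qed

text \<open>
  The displacement of \<open>F\<^sup>n\<close> avoids \<open>2\<pi>\<int>\<close> and is periodic, so by compactness it keeps a
  positive distance; \<open>\<bar>sin\<bar>\<close> of half the displacement measures it.
\<close>

lemma iterate_separated:
  assumes "\<And>t k. (F ^^ n) t \<noteq> t + 2 * pi * of_int k"
  obtains \<epsilon> where "\<epsilon> > 0" "\<And>t k. \<bar>(F ^^ n) t - t - 2 * pi * of_int k\<bar> \<ge> \<epsilon>"
proof -
  interpret G: circle_lift "F ^^ n" "DF n" "D2F n" by (rule iterate)
  define h where "h t = ((F ^^ n) t - t) / 2" for t
  have "\<exists>m>0. \<forall>t. \<bar>sin (h t)\<bar> \<ge> m"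
  proof (rule periodic_bounded_below[of "\<lambda>t. \<bar>sin (h t)\<bar>"])
    show "continuous_on UNIV (\<lambda>t. \<bar>sin (h t)\<bar>)" unfolding h_def by (intro continuous_intros G.F_cont) simp
    show "\<bar>sin (h (t + 2 * pi))\<bar> = \<bar>sin (h t)\<bar>" for t by (simp add: h_def G.F_period)
    show "\<bar>sin (h t)\<bar> > 0" for t
    proof -
      have "h t \<noteq> of_int k * pi" for k using assms[of t k] by (simp add: h_def field_simps)
      then show ?thesis by (simp add: sin_zero_iff_int2)
    qed
  qed blast
  then obtain m where m: "m > 0" "\<And>t. \<bar>sin (h t)\<bar> \<ge> m" by blast
  show ?thesis
  proof (rule that[of "2 * m"])
    fix t k
    have "sin (h t - pi * of_int k) = sin (h t) * cos (pi * of_int k)"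
      by (simp add: sin_diff sin_npi_int)
    then have "\<bar>sin (h t - of_int k * pi)\<bar> = \<bar>sin (h t)\<bar>"
      by (simp add: cos_npi_int mult.commute)
    moreover have "\<bar>sin (h t - of_int k * pi)\<bar> \<le> \<bar>h t - of_int k * pi\<bar>" by (rule abs_sin_x_le_abs_x)
    ultimately have "m \<le> \<bar>h t - of_int k * pi\<bar>" using m(2)[of t] by linarith
    then show "\<bar>(F ^^ n) t - t - 2 * pi * of_int k\<bar> \<ge> 2 * m" by (simp add: h_def abs_if field_simps split: if_splits)
  qed (use m in simp)
qed


text \<open>
  The arc \<open>[u, v]\<close> is disjoint, on the circle, from its first \<open>L\<close> images.
\<close>

definition returns_free :: "nat \<Rightarrow> real \<Rightarrow> real \<Rightarrow> bool"
  where "returns_free L u v \<longleftrightarrow>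
    (\<forall>t\<in>{1..L}. \<forall>w\<in>{u..v}. \<forall>k::int. (F ^^ t) w + 2 * pi * of_int k \<notin> {u..v})"

lemma returns_free_pullback:
  assumes "returns_free L ((F ^^ n) u) ((F ^^ n) v)"
  shows "returns_free L u v"
  unfolding returns_free_def
proof (intro ballI allI notI)
  interpret G: circle_lift "F ^^ n" "DF n" "D2F n" by (rule iterate)
  fix t w k assume t: "t \<in> {1..L}" and w: "w \<in> {u..v}" and "(F ^^ t) w + 2 * pi * of_int k \<in> {u..v}"
  then have "(F ^^ n) ((F ^^ t) w + 2 * pi * of_int k) \<in> {(F ^^ n) u..(F ^^ n) v}"
    by (simp add: G.F_mono)
  then have "(F ^^ t) ((F ^^ n) w) + 2 * pi * of_int k \<in> {(F ^^ n) u..(F ^^ n) v}"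
    unfolding G.F_period_int by (metis add.commute comp_apply funpow_add)
  moreover have "(F ^^ n) w \<in> {(F ^^ n) u..(F ^^ n) v}" using w by (simp add: G.F_mono)
  ultimately show False using assms t unfolding returns_free_def by blast
qed

text \<open>
  If two images with times less than \<open>L\<close> apart met, pulling back by the earlier one
  would make the arc meet one of its first images. So \<open>L\<close> consecutive images are disjoint.
\<close>

lemma sum_lengths_block:
  assumes free: "returns_free L u v" and uv: "u \<le> v" "v \<le> u + 2 * pi"
  shows "(\<Sum>t\<in>{s..<s + L}. (F ^^ t) v - (F ^^ t) u) \<le> 4 * pi"
proof (rule sum_lengths_disjoint_arcs[where a = "\<lambda>t. (F ^^ t) u"])
  fix t
  interpret G: circle_lift "F ^^ t" "DF t" "D2F t" by (rule iterate)
  show "0 \<le> (F ^^ t) v - (F ^^ t) u \<and> (F ^^ t) v - (F ^^ t) u \<le> 2 * pi"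
    using G.F_mono[OF uv(1)] G.F_mono[OF uv(2)] G.F_period[of u] by simp
next
  have apart: False if st: "i < j" "j < i + L" and p: "p \<in> {(F ^^ i) u..(F ^^ i) v}"
    and q: "p + 2 * pi * of_int k \<in> {(F ^^ j) u..(F ^^ j) v}" for i j p and k :: int
  proof -
    interpret G: circle_lift "F ^^ i" "DF i" "D2F i" by (rule iterate)
    interpret H: circle_lift "F ^^ j" "DF j" "D2F j" by (rule iterate)
    obtain w where w: "w \<in> {u..v}" "(F ^^ i) w = p" using G.F_intermediate[OF uv(1) p] by blast
    obtain w' where w': "w' \<in> {u..v}" "(F ^^ j) w' = p + 2 * pi * of_int k"
      using H.F_intermediate[OF uv(1) q] by blast
    have "(F ^^ i) ((F ^^ (j - i)) w' + 2 * pi * of_int (- k)) = (F ^^ i) w"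
      unfolding G.F_period_int using w(2) w'(2) st funpow_add[of i "j - i" F] by simp
    then have "(F ^^ (j - i)) w' + 2 * pi * of_int (- k) = w" by (rule G.F_inj)
    moreover have "j - i \<in> {1..L}" using st by auto
    ultimately show False using free w(1) w'(1) unfolding returns_free_def by blast
  qed
  fix i j p and k :: int
  assume ij: "i \<in> {s..<s + L}" "j \<in> {s..<s + L}" "i \<noteq> j"
    and p: "p \<in> {(F ^^ i) u..(F ^^ i) u + ((F ^^ i) v - (F ^^ i) u)}"
  show "p + 2 * pi * of_int k \<notin> {(F ^^ j) u..(F ^^ j) u + ((F ^^ j) v - (F ^^ j) u)}"
  proof
    assume q: "p + 2 * pi * of_int k \<in> {(F ^^ j) u..(F ^^ j) u + ((F ^^ j) v - (F ^^ j) u)}"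
    show False
    proof (cases "i < j")
      case True
      then show False using apart[of i j p k] ij p q by simp
    next
      case False
      then show False using apart[of j i "p + 2 * pi * of_int k" "- k"] ij p q by simp
    qed
  qed
qed simp

lemma sum_lengths:
  assumes free: "returns_free L u v" and uv: "u \<le> v" "v \<le> u + 2 * pi" and L: "L > 0"
  shows "(\<Sum>t<n. (F ^^ t) v - (F ^^ t) u) \<le> 4 * pi * (real n / real L + 1)"
proof -
  let ?l = "\<lambda>t. (F ^^ t) v - (F ^^ t) u"
  have nonneg: "?l t \<ge> 0" for t
  proof -
    interpret G: circle_lift "F ^^ t" "DF t" "D2F t" by (rule iterate)
    show ?thesis using G.F_mono[OF uv(1)] by simp
  qed
  have blocks: "(\<Sum>t<L * q. ?l t) \<le> 4 * pi * q" for q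
  proof (induction q)
    case (Suc q)
    have "{..<L * Suc q} = {..<L * q} \<union> {L * q..<L * q + L}" by auto
    then have "(\<Sum>t<L * Suc q. ?l t) = (\<Sum>t<L * q. ?l t) + (\<Sum>t\<in>{L * q..<L * q + L}. ?l t)"
      by (simp add: sum.union_disjoint ivl_disj_int)
    then show ?case using Suc sum_lengths_block[OF free uv, of "L * q"] by (simp add: algebra_simps)
  qed simp
  \<comment> \<open>enough whole blocks of length \<open>L\<close> to cover all times below \<open>n\<close>\<close>
  define q where "q = n div L + 1"
  have "n \<le> L * q" 
    using mult_div_mod_eq[of L n] mod_less_divisor[OF L, of n] unfolding q_def distrib_left by linarith
  then have "(\<Sum>t<n. ?l t) \<le> (\<Sum>t<L * q. ?l t)" using nonneg by (intro sum_mono2) auto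
  also have "\<dots> \<le> 4 * pi * q" by (rule blocks)
  also have "real q \<le> real n / real L + 1" unfolding q_def by (simp add: of_nat_div_le_of_nat)
  finally show ?thesis by (simp add: mult_left_mono)
qed

lemma DF_pos: "DF n t > 0"
proof -
  interpret G: circle_lift "F ^^ n" "DF n" "D2F n" by (rule iterate)
  show ?thesis by (rule G.F'_pos)
qed

lemma ln_DF: "ln (DF n t) = (\<Sum>i<n. ln (F' ((F ^^ i) t)))"
  unfolding DF_def by (rule ln_prod) (use F'_pos in \<open>simp_all add: less_imp_neq[symmetric]\<close>)

lemma nonlinearity_bounded:
  obtains K where "K > 0" "\<And>t. \<bar>F'' t / F' t\<bar> \<le> K"
proof (rule periodic_bounded[of "\<lambda>t. F'' t / F' t"])
  show "continuous_on UNIV (\<lambda>t. F'' t / F' t)"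
    using F'_pos by (intro continuous_intros F''_cont F'_cont) (auto simp: less_imp_neq[symmetric])
qed (auto simp: F'_period F''_period)

lemma ln_F'_lipschitz:
  assumes K: "\<And>t. \<bar>F'' t / F' t\<bar> \<le> K"
  shows "\<bar>ln (F' a) - ln (F' b)\<bar> \<le> K * \<bar>a - b\<bar>"
proof -
  have d: "((\<lambda>t. ln (F' t)) has_real_derivative F'' t / F' t) (at t within UNIV)" for t
    using F'_pos[of t] by (auto intro!: derivative_eq_intros F'_deriv)
  show ?thesis
    using field_differentiable_bound[of UNIV "\<lambda>t. ln (F' t)" "\<lambda>t. F'' t / F' t" K a b] d K by simp
qed

text \<open>
  The classical distortion estimate of Denjoy: \<open>ln F'\<close> is Lipschitz, so \<open>ln DF n\<close>
  oscillates on the arc by at most a constant times the total length of its first \<open>n\<close> images.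
\<close>

lemma distortion:
  assumes K: "\<And>t. \<bar>F'' t / F' t\<bar> \<le> K"
    and free: "returns_free L u v" and uv: "u \<le> v" "v \<le> u + 2 * pi" and L: "L > 0"
    and w: "w \<in> {u..v}" "w' \<in> {u..v}"
  shows "\<bar>ln (DF n w) - ln (DF n w')\<bar> \<le> K * (4 * pi * (real n / real L + 1))"
proof -
  have K0: "K \<ge> 0" using K[of 0] by linarith
  have "\<bar>ln (DF n w) - ln (DF n w')\<bar> \<le> (\<Sum>i<n. \<bar>ln (F' ((F ^^ i) w)) - ln (F' ((F ^^ i) w'))\<bar>)"
    unfolding ln_DF sum_subtractf[symmetric] by (rule sum_abs)
  also have "\<dots> \<le> (\<Sum>i<n. K * ((F ^^ i) v - (F ^^ i) u))"
  proof (rule sum_mono)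
    fix i
    interpret G: circle_lift "F ^^ i" "DF i" "D2F i" by (rule iterate)
    have "(F ^^ i) u \<le> (F ^^ i) w" "(F ^^ i) w \<le> (F ^^ i) v" "(F ^^ i) u \<le> (F ^^ i) w'" "(F ^^ i) w' \<le> (F ^^ i) v"
      using w by (auto simp: G.F_mono)
    then have "\<bar>(F ^^ i) w - (F ^^ i) w'\<bar> \<le> (F ^^ i) v - (F ^^ i) u" by linarith
    then have "K * \<bar>(F ^^ i) w - (F ^^ i) w'\<bar> \<le> K * ((F ^^ i) v - (F ^^ i) u)"
      using K0 by (intro mult_left_mono)
    then show "\<bar>ln (F' ((F ^^ i) w)) - ln (F' ((F ^^ i) w'))\<bar> \<le> K * ((F ^^ i) v - (F ^^ i) u)"
      using ln_F'_lipschitz[OF K] order_trans by blast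
  qed
  also have "\<dots> = K * (\<Sum>i<n. (F ^^ i) v - (F ^^ i) u)" by (simp add: sum_distrib_left)
  also have "\<dots> \<le> K * (4 * pi * (real n / real L + 1))"
    using K0 sum_lengths[OF free uv L] by (intro mult_left_mono)
  finally show ?thesis .
qed

text \<open>
  An arc shorter than every displacement of the first \<open>L\<close> iterates cannot meet its
  images: a common point of \<open>J\<close> and \<open>F\<^sup>t J\<close> would be displaced by at most the length of \<open>J\<close>.
\<close>

lemma returns_free_short:
  assumes no_return: "\<And>n t k. n > 0 \<Longrightarrow> (F ^^ n) t \<noteq> t + 2 * pi * of_int k"
  obtains \<eta> where "\<eta> > 0" "\<eta> \<le> 2 * pi" "\<And>u. returns_free L u (u + \<eta>)"
proof -
  have "\<exists>\<eta>>0. \<eta> \<le> 2 * pi \<and> (\<forall>n\<in>{1..L}. \<forall>t k. \<bar>(F ^^ n) t - t - 2 * pi * of_int k\<bar> > \<eta>)"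
  proof (induction L)
    case 0
    then show ?case by (intro exI[of _ 1]) (use pi_gt3 in auto)
  next
    case (Suc L)
    then obtain \<eta> where \<eta>: "\<eta> > 0" "\<eta> \<le> 2 * pi"
      "\<And>n t k. n \<in> {1..L} \<Longrightarrow> \<bar>(F ^^ n) t - t - 2 * pi * of_int k\<bar> > \<eta>" by blast
    obtain \<epsilon> where \<epsilon>: "\<epsilon> > 0" "\<And>t k. \<bar>(F ^^ (Suc L)) t - t - 2 * pi * of_int k\<bar> \<ge> \<epsilon>"
      using iterate_separated[of "Suc L"] no_return[of "Suc L"] by blast
    have "\<bar>(F ^^ n) t - t - 2 * pi * of_int k\<bar> > min \<eta> (\<epsilon> / 2)" if "n \<in> {1..Suc L}" for n t k
    proof (cases "n = Suc L")
      case True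
      have "\<epsilon> > min \<eta> (\<epsilon> / 2)" using \<epsilon>(1) by simp
      then show ?thesis using \<epsilon>(2)[of t k] unfolding True by linarith
    next
      case False
      then show ?thesis using \<eta>(3)[of n t k] that by force
    qed
    then show ?case using \<eta>(1,2) \<epsilon>(1) by (intro exI[of _ "min \<eta> (\<epsilon> / 2)"]) auto
  qed
  then obtain \<eta> where \<eta>: "\<eta> > 0" "\<eta> \<le> 2 * pi"
    "\<And>n t k. n \<in> {1..L} \<Longrightarrow> \<bar>(F ^^ n) t - t - 2 * pi * of_int k\<bar> > \<eta>" by blast
  have "returns_free L u (u + \<eta>)" for u
    unfolding returns_free_def
  proof (intro ballI allI notI)
    fix t w k assume "t \<in> {1..L}" and w: "w \<in> {u..u + \<eta>}" "(F ^^ t) w + 2 * pi * real_of_int k \<in> {u..u + \<eta>}"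
    then have "\<bar>(F ^^ t) w - w - 2 * pi * of_int (- k)\<bar> > \<eta>" using \<eta>(3) by blast
    then show False using w by (auto simp: abs_if split: if_splits)
  qed
  then show ?thesis using that \<eta>(1,2) by blast
qed

text \<open>
  By distortion it is enough to know the derivative at one point of a short arc,
  which the mean value theorem gives up to a constant. Taking \<open>L\<close> large makes the
  distortion \<open>4\<pi>K(n/L + 1)\<close> grow with slope at most \<open>e\<close>. The upper bound uses an arc of length
  \<open>\<eta>\<close> at time \<open>0\<close>, the lower bound an arc of length \<open>\<eta>\<close> at time \<open>n\<close>.
\<close>

lemma ln_DF_sublinear:
  assumes no_return: "\<And>n t k. n > 0 \<Longrightarrow> (F ^^ n) t \<noteq> t + 2 * pi * of_int k" and e: "e > 0"
  obtains C where "C \<ge> 0" "\<And>n t. \<bar>ln (DF n t)\<bar> \<le> C + e * real n"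
proof -
  obtain K where K: "K > 0" "\<And>t. \<bar>F'' t / F' t\<bar> \<le> K" using nonlinearity_bounded by blast
  obtain L :: nat where L0: "4 * pi * K / e < real L" using reals_Archimedean2 by blast
  have "4 * pi * K / e > 0" using K e by simp
  then have L: "L > 0" using L0 by (metis of_nat_0 not_gr_zero less_asym)
  have Le: "4 * pi * K / real L \<le> e" using L0 L e by (simp add: field_simps)
  obtain \<eta> where \<eta>: "\<eta> > 0" "\<eta> \<le> 2 * pi" "\<And>u. returns_free L u (u + \<eta>)"
    using returns_free_short[OF no_return] by blast
  \<comment> \<open>the constant part of the distortion, and the comparison of the lengths \<open>\<eta>\<close> and \<open>2\<pi>\<close>\<close>
  define C where "C = 4 * pi * K + ln (2 * pi / \<eta>)"
  have ln0: "ln (2 * pi / \<eta>) \<ge> 0" using \<eta> by simp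
  have bound: "K * (4 * pi * (real n / real L + 1)) \<le> 4 * pi * K + e * real n" for n
  proof -
    have "K * (4 * pi * (real n / real L + 1)) = 4 * pi * K + (4 * pi * K / real L) * real n"
      using L by (simp add: field_simps)
    moreover have "(4 * pi * K / real L) * real n \<le> e * real n" by (rule mult_right_mono[OF Le]) simp
    ultimately show ?thesis by linarith
  qed
  have "\<bar>ln (DF n y)\<bar> \<le> C + e * real n" for n y
  proof -
    interpret G: circle_lift "F ^^ n" "DF n" "D2F n" by (rule iterate)
    \<comment> \<open>upper bound: the arc \<open>[y, y + \<eta>]\<close>, whose image has length at most \<open>2\<pi>\<close>\<close>
    obtain w where w: "w \<in> {y..y + \<eta>}" "(F ^^ n) (y + \<eta>) - (F ^^ n) y = \<eta> * DF n w"
      using G.F_mvt[of y "y + \<eta>"] \<eta> by auto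
    have "\<eta> * DF n w \<le> 2 * pi"
      using w(2) G.F_mono[of "y + \<eta>" "y + 2 * pi"] G.F_period[of y] \<eta> by linarith
    then have "DF n w \<le> 2 * pi / \<eta>" using \<eta> by (simp add: field_simps)
    then have "ln (DF n w) \<le> ln (2 * pi / \<eta>)" using DF_pos[of n w] \<eta> by (subst ln_le_cancel_iff) auto
    moreover have "\<bar>ln (DF n y) - ln (DF n w)\<bar> \<le> K * (4 * pi * (real n / real L + 1))"
      by (rule distortion[OF K(2) \<eta>(3)[of y]]) (use \<eta> L w in auto)
    ultimately have up: "ln (DF n y) \<le> C + e * real n" using bound[of n] by (simp add: C_def)
    \<comment> \<open>lower bound: the arc \<open>[y, v]\<close>, whose image has length \<open>\<eta>\<close>\<close>
    have "(F ^^ n) y + \<eta> \<in> {(F ^^ n) y..(F ^^ n) (y + 2 * pi)}" using \<eta> by (simp add: G.F_period)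
    then obtain v where v: "v \<in> {y..y + 2 * pi}" "(F ^^ n) v = (F ^^ n) y + \<eta>"
      using G.F_intermediate[of y "y + 2 * pi" "(F ^^ n) y + \<eta>"] by auto
    have free: "returns_free L y v"
      by (rule returns_free_pullback[of L n]) (simp add: v(2) \<eta>(3))
    have yv: "y < v" using v \<eta>(1) by (cases "y = v") auto
    obtain w' where w': "w' \<in> {y..v}" "(F ^^ n) v - (F ^^ n) y = (v - y) * DF n w'"
      using G.F_mvt[OF yv] by auto
    have "\<eta> \<le> 2 * pi * DF n w'"
      using w'(2) v DF_pos[of n w'] mult_right_mono[of "v - y" "2 * pi" "DF n w'"] by simp
    then have "inverse (2 * pi / \<eta>) \<le> DF n w'" using \<eta> by (simp add: field_simps)
    then have "ln (inverse (2 * pi / \<eta>)) \<le> ln (DF n w')" using \<eta> DF_pos[of n w'] by (subst ln_le_cancel_iff) auto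
    then have "- ln (2 * pi / \<eta>) \<le> ln (DF n w')" using \<eta> by (subst (asm) ln_inverse) auto
    moreover have "\<bar>ln (DF n y) - ln (DF n w')\<bar> \<le> K * (4 * pi * (real n / real L + 1))"
      by (rule distortion[OF K(2) free]) (use v yv w' L in auto)
    ultimately have "- ln (DF n y) \<le> C + e * real n" using bound[of n] by (simp add: C_def)
    then show ?thesis using up by linarith
  qed
  moreover have "C \<ge> 0" using ln0 K by (simp add: C_def)
  ultimately show ?thesis using that by blast
qed

text \<open>
  The formula for \<open>D2F\<close> bounds it by \<open>K n\<close> times the square of a bound of the
  first derivatives. So a third of the exponent is given to each of the two first-derivative factors and
  to \<open>n\<close>.
\<close>

lemma subexponential_C2_growth:
  assumes no_return: "\<And>n t k. n > 0 \<Longrightarrow> (F ^^ n) t \<noteq> t + 2 * pi * of_int k" and e: "e > 0"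
  obtains C where "C \<ge> 0" "\<And>n t. DF n t \<le> exp (C + e * real n)"
    "\<And>n t. DF n t \<ge> exp (- (C + e * real n))" "\<And>n t. \<bar>D2F n t\<bar> \<le> exp (C + e * real n)"
proof -
  obtain K where K: "K > 0" "\<And>t. \<bar>F'' t / F' t\<bar> \<le> K" using nonlinearity_bounded by blast
  define d where "d = e / 3"
  have d: "d > 0" using e by (simp add: d_def)
  obtain C where C: "C \<ge> 0" "\<And>n t. \<bar>ln (DF n t)\<bar> \<le> C + d * real n"
    using ln_DF_sublinear[OF no_return d] by blast
  have up: "DF n t \<le> exp (C + d * real n)" and lo: "DF n t \<ge> exp (- (C + d * real n))" for n t
  proof -
    have "DF n t = exp (ln (DF n t))" using DF_pos by simp
    moreover have "ln (DF n t) \<le> C + d * real n" "ln (DF n t) \<ge> - (C + d * real n)"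
      using C(2)[of n t] by linarith+
    ultimately show "DF n t \<le> exp (C + d * real n)" "DF n t \<ge> exp (- (C + d * real n))"
      by (metis exp_le_cancel_iff)+
  qed
  \<comment> \<open>\<open>K n \<le> (K / d) exp (d n)\<close> absorbs the linear factor\<close>
  define C' where "C' = 2 * C + ln (1 + K / d)"
  have Kd: "K / d > 0" using K d by simp
  have C': "C' \<ge> C" using C(1) Kd by (simp add: C'_def)
  have le: "C + d * real n \<le> C' + e * real n" for n
    using C' e by (intro add_mono mult_right_mono) (auto simp: d_def)
  have D2: "\<bar>D2F n t\<bar> \<le> exp (C' + e * real n)" for n t
  proof -
    have Di: "\<bar>F'' ((F ^^ i) t) / F' ((F ^^ i) t) * DF i t\<bar> \<le> K * exp (C + d * real n)" if "i < n" for i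
    proof -
      have "DF i t \<le> exp (C + d * real i)" by (rule up)
      also have "\<dots> \<le> exp (C + d * real n)" using that d by simp
      finally have "DF i t \<le> exp (C + d * real n)" .
      then show ?thesis unfolding abs_mult using K DF_pos[of i t] by (intro mult_mono) auto
    qed
    have "\<bar>\<Sum>i<n. F'' ((F ^^ i) t) / F' ((F ^^ i) t) * DF i t\<bar> \<le> (\<Sum>i<n. K * exp (C + d * real n))"
      by (rule order_trans[OF sum_abs sum_mono]) (use Di in simp)
    also have "\<dots> = (K * real n) * exp (C + d * real n)" by simp
    finally have s: "\<bar>\<Sum>i<n. F'' ((F ^^ i) t) / F' ((F ^^ i) t) * DF i t\<bar> \<le> (K * real n) * exp (C + d * real n)" .
    have "d * real n \<le> exp (d * real n)" using exp_ge_add_one_self[of "d * real n"] by linarith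
    then have "K * real n \<le> K / d * exp (d * real n)"
      using K d by (simp add: field_simps)
    also have "\<dots> \<le> (1 + K / d) * exp (d * real n)" by (intro mult_right_mono) auto
    also have "\<dots> = exp (ln (1 + K / d) + d * real n)" using Kd by (simp add: exp_add)
    finally have Kn: "K * real n \<le> exp (ln (1 + K / d) + d * real n)" .
    have "\<bar>D2F n t\<bar> \<le> exp (C + d * real n) * (exp (ln (1 + K / d) + d * real n) * exp (C + d * real n))"
      unfolding D2F_def abs_mult using up[of n t] DF_pos[of n t]
      by (intro mult_mono order_trans[OF s] mult_right_mono Kn) auto
    also have "\<dots> = exp (C' + e * real n)" by (simp add: C'_def d_def exp_add[symmetric] algebra_simps)
    finally show ?thesis .
  qed
  show ?thesis
  proof (rule that[of C'])
    show "DF n t \<le> exp (C' + e * real n)" for n t using up[of n t] le[of n] by (smt (verit) exp_le_cancel_iff)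
    show "DF n t \<ge> exp (- (C' + e * real n))" for n t using lo[of n t] le[of n] by (smt (verit) exp_le_cancel_iff)
  qed (use C C' D2 in auto)
qed

end

section \<open>Divided differences\<close>

text \<open>
  The divided difference of a function with derivative \<open>g'\<close>. The integral is
  meaningful and continuous also at coinciding arguments.
\<close>

definition dd1 :: "(real \<Rightarrow> complex) \<Rightarrow> real \<Rightarrow> real \<Rightarrow> complex"
  where "dd1 g' s t = integral {0..1} (\<lambda>\<tau>. g' (t + \<tau> * (s - t)))"

text \<open>
  The divided difference of order two of a function with second derivative \<open>g''\<close>, as an
  iterated integral.
\<close>

definition dd2 :: "(real \<Rightarrow> complex) \<Rightarrow> real \<Rightarrow> real \<Rightarrow> real \<Rightarrow> complex"
  where "dd2 g'' r s t =
    integral {0..1} (\<lambda>\<tau>. of_real \<tau> * dd1 g'' (r + \<tau> * (t - r)) (r + \<tau> * (s - r)))"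

lemma continuous_on_dd1:
  fixes a b :: "'a::topological_space \<Rightarrow> real"
  assumes "continuous_on UNIV g'" "continuous_on X a" "continuous_on X b"
  shows "continuous_on X (\<lambda>x. dd1 g' (a x) (b x))"
proof -
  have "continuous_on (X \<times> cbox 0 1) (\<lambda>(x, \<tau>). g' (b x + \<tau> * (a x - b x)))"
    unfolding case_prod_unfold
    by (rule continuous_on_compose2[OF assms(1)])
      (auto intro!: continuous_intros continuous_on_compose2[OF assms(2)] continuous_on_compose2[OF assms(3)])
  from integral_continuous_on_param[OF this] show ?thesis
    by (simp add: dd1_def[abs_def])
qed

lemma continuous_on_dd2:
  fixes a b c :: "'a::topological_space \<Rightarrow> real"
  assumes g: "continuous_on UNIV g''" and abc: "continuous_on X a" "continuous_on X b" "continuous_on X c"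
  shows "continuous_on X (\<lambda>x. dd2 g'' (a x) (b x) (c x))"
proof -
  have f: "continuous_on (X \<times> cbox 0 1) (\<lambda>p. h (fst p))" if "continuous_on X h" for h :: "'a \<Rightarrow> real"
    by (rule continuous_on_compose2[OF that]) (auto intro!: continuous_intros)
  have "continuous_on (X \<times> cbox 0 1)
    (\<lambda>(x, \<tau>). of_real \<tau> * dd1 g'' (a x + \<tau> * (c x - a x)) (a x + \<tau> * (b x - a x)))"
    unfolding case_prod_unfold
    by (intro continuous_intros continuous_on_dd1[OF g] f abc)
  from integral_continuous_on_param[OF this] show ?thesis
    by (simp add: dd2_def[abs_def])
qed

lemma dd1_eq:
  assumes "\<And>t. (g has_vector_derivative g' t) (at t)"
  shows "of_real (s - t) * dd1 g' s t = g s - g t"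
proof -
  have "((\<lambda>\<tau>. (s - t) *\<^sub>R g' (t + \<tau> * (s - t))) has_integral (g (t + 1 * (s - t)) - g (t + 0 * (s - t)))) {0..1}"
  proof (rule fundamental_theorem_of_calculus)
    fix \<tau> :: real
    have "((\<lambda>\<tau>. t + \<tau> * (s - t)) has_vector_derivative (s - t)) (at \<tau> within {0..1})"
      by (auto intro!: derivative_eq_intros simp: has_real_derivative_iff_has_vector_derivative[symmetric])
    from vector_diff_chain_within[OF this, of g "g' (t + \<tau> * (s - t))"]
    show "((\<lambda>\<tau>. g (t + \<tau> * (s - t))) has_vector_derivative (s - t) *\<^sub>R g' (t + \<tau> * (s - t))) (at \<tau> within {0..1})"
      using assms has_vector_derivative_at_within by (force simp: o_def)
  qed simp
  from integral_unique[OF this]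
  have "integral {0..1} (\<lambda>\<tau>. (s - t) *\<^sub>R g' (t + \<tau> * (s - t))) = g s - g t"
    by simp
  then show ?thesis by (simp add: dd1_def scaleR_conv_of_real)
qed

lemma dd2_eq:
  assumes d: "\<And>t. (g' has_vector_derivative g'' t) (at t)" and c: "continuous_on UNIV g''"
  shows "of_real (t - s) * dd2 g'' r s t = dd1 g' t r - dd1 g' s r"
proof -
  have cg: "continuous_on UNIV g'"
    using d by (intro continuous_at_imp_continuous_on ballI has_vector_derivative_continuous)
  have i: "(\<lambda>\<tau>. g' (r + \<tau> * (x - r))) integrable_on {0..1}" for x
    by (intro integrable_continuous_real continuous_on_compose2[OF cg] continuous_intros) auto
  have "of_real (t - s) * dd2 g'' r s t
     = integral {0..1} (\<lambda>\<tau>. of_real (t - s) * (of_real \<tau> * dd1 g'' (r + \<tau> * (t - r)) (r + \<tau> * (s - r))))"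
    unfolding dd2_def by simp
  also have "\<dots> = integral {0..1} (\<lambda>\<tau>. g' (r + \<tau> * (t - r)) - g' (r + \<tau> * (s - r)))"
  proof (rule integral_cong)
    fix \<tau> :: real
    have "g' (r + \<tau> * (t - r)) - g' (r + \<tau> * (s - r)) =
      of_real ((r + \<tau> * (t - r)) - (r + \<tau> * (s - r))) * dd1 g'' (r + \<tau> * (t - r)) (r + \<tau> * (s - r))"
      by (rule dd1_eq[OF d, symmetric])
    also have "(r + \<tau> * (t - r)) - (r + \<tau> * (s - r)) = (t - s) * \<tau>" by (simp add: algebra_simps)
    finally show "of_real (t - s) * (of_real \<tau> * dd1 g'' (r + \<tau> * (t - r)) (r + \<tau> * (s - r))) =
      g' (r + \<tau> * (t - r)) - g' (r + \<tau> * (s - r))" by (simp add: mult.assoc)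
  qed
  also have "\<dots> = dd1 g' t r - dd1 g' s r"
    unfolding dd1_def by (rule integral_diff[OF i i])
  finally show ?thesis .
qed

lemma dd1_same: "dd1 g' t t = g' t"
  by (simp add: dd1_def)

lemma norm_dd1_le:
  assumes "continuous_on UNIV g'" "\<And>t. cmod (g' t) \<le> B"
  shows "cmod (dd1 g' s t) \<le> B"
proof -
  have "norm (integral {0..1} (\<lambda>\<tau>. g' (t + \<tau> * (s - t)))) \<le> B * (1 - 0)"
    by (rule integral_bound) (auto intro!: continuous_on_compose2[OF assms(1)] continuous_intros assms)
  then show ?thesis by (simp add: dd1_def)
qed

lemma norm_dd2_le:
  assumes c: "continuous_on UNIV g''" and B: "\<And>t. cmod (g'' t) \<le> B"
  shows "cmod (dd2 g'' r s t) \<le> B"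
proof -
  have "B \<ge> 0" using B[of 0] norm_ge_zero order_trans by blast
  then have "cmod (of_real \<tau> * dd1 g'' x y) \<le> B" if "\<tau> \<in> {0..1}" for \<tau> x y
    using mult_mono[of "\<bar>\<tau>\<bar>" 1 "cmod (dd1 g'' x y)" B] norm_dd1_le[OF c B, of x y] that by (simp add: norm_mult)
  then have "norm (integral {0..1} (\<lambda>\<tau>. of_real \<tau> * dd1 g'' (r + \<tau> * (t - r)) (r + \<tau> * (s - r)))) \<le> B * (1 - 0)"
    by (intro integral_bound continuous_intros continuous_on_dd1[OF c]) auto
  then show ?thesis by (simp add: dd2_def)
qed

section \<open>Moebius interpolation\<close>

definition dquot :: "(complex \<Rightarrow> complex) \<Rightarrow> complex \<Rightarrow> complex \<Rightarrow> complex"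
  where "dquot f z w = (f z - f w) / (z - w)"

text \<open>
  Interpolation by the continued fraction \<open>w1 + (z - z1) / (c0 + c1 (z - z2))\<close>, where
  \<open>c0 = 1/d12\<close> and \<open>c1 = - D / (d12 d13)\<close>. Multiplying the numerator and the denominator by \<open>d12 d13\<close>
  removes all divisions, and the entries stay meaningful for coinciding nodes.
\<close>

definition thiele :: "complex \<Rightarrow> complex \<Rightarrow> complex \<Rightarrow> complex \<Rightarrow> complex \<Rightarrow> complex \<Rightarrow> complex^2^2"
  where "thiele z1 z2 w1 d12 d13 D =
    mat2 (d12 * d13 - w1 * D) (w1 * (d13 + D * z2) - d12 * d13 * z1) (- D) (d13 + D * z2)"

definition interp_mat :: "(complex \<Rightarrow> complex) \<Rightarrow> triple \<Rightarrow> complex^2^2"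
  where "interp_mat f = (\<lambda>(z1, z2, z3). thiele z1 z2 (f z1) (dquot f z2 z1) (dquot f z3 z1)
    ((dquot f z3 z1 - dquot f z2 z1) / (z3 - z2)))"

text \<open>
  The vectors \<open>(z, 1)\<close> and \<open>(w, 1)\<close> are a basis.
\<close>

lemma mat2_eqI:
  fixes A B :: "complex^2^2"
  assumes "z \<noteq> w" "A$1$1 * z + A$1$2 = B$1$1 * z + B$1$2" "A$1$1 * w + A$1$2 = B$1$1 * w + B$1$2"
    "A$2$1 * z + A$2$2 = B$2$1 * z + B$2$2" "A$2$1 * w + A$2$2 = B$2$1 * w + B$2$2"
  shows "A = B"
proof -
  have "(A$1$1 - B$1$1) * (z - w) = 0" using assms(2,3) by algebra
  moreover have "(A$2$1 - B$2$1) * (z - w) = 0" using assms(4,5) by algebra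
  ultimately have "A$1$1 = B$1$1" "A$2$1 = B$2$1" using assms(1) by auto
  moreover from this have "A$1$2 = B$1$2" "A$2$2 = B$2$2" using assms by auto
  ultimately show ?thesis by (simp add: vec_eq_iff forall_2)
qed

lemma dquot_commute: "dquot f z w = dquot f w z"
  unfolding dquot_def by (metis minus_diff_eq minus_divide_divide)

text \<open>
  The matrix maps \<open>(z\<^sub>i, 1)\<close> to \<open>\<mu>\<^sub>i (f z\<^sub>i, 1)\<close>, where \<open>\<mu>\<^sub>i\<close> is the divided difference at
  the other two nodes. The other algebraic properties of the matrix follow from these equations.
\<close>

lemma interp_mat_apply:
  fixes f :: "complex \<Rightarrow> complex"
  assumes d: "z1 \<noteq> z2" "z1 \<noteq> z3" "z2 \<noteq> z3"
  defines "A \<equiv> interp_mat f (z1, z2, z3)"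
  shows "A$2$1 * z1 + A$2$2 = dquot f z2 z3" "A$1$1 * z1 + A$1$2 = dquot f z2 z3 * f z1"
    "A$2$1 * z2 + A$2$2 = dquot f z1 z3" "A$1$1 * z2 + A$1$2 = dquot f z1 z3 * f z2"
    "A$2$1 * z3 + A$2$2 = dquot f z1 z2" "A$1$1 * z3 + A$1$2 = dquot f z1 z2 * f z3"
proof -
  define D where "D = (dquot f z3 z1 - dquot f z2 z1) / (z3 - z2)"
  define p q where "p = dquot f z1 z2" and "q = dquot f z1 z3"
  have A: "A = thiele z1 z2 (f z1) p q D"
    by (simp add: A_def interp_mat_def D_def p_def q_def dquot_commute)
  have pq: "p * (z1 - z2) = f z1 - f z2" "q * (z1 - z3) = f z1 - f z3"
    using d by (simp_all add: p_def q_def dquot_def)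
  have D: "D * (z3 - z2) = q - p" using d by (simp add: D_def p_def q_def dquot_commute)
  have r: "dquot f z2 z3 * (z2 - z3) = f z2 - f z3" using d by (simp add: dquot_def)
  have "(D * (z2 - z1) + q) * (z3 - z2) = (f z3 - f z2)" using D pq by algebra
  then have 1: "D * (z2 - z1) + q = dquot f z2 z3" using r d
    by (smt (verit, ccfv_threshold) dquot_commute dquot_def eq_iff_diff_eq_0 nonzero_divide_eq_eq)
  show "A$2$1 * z1 + A$2$2 = dquot f z2 z3" unfolding 1[symmetric] A thiele_def by (simp add: algebra_simps)
  show "A$1$1 * z1 + A$1$2 = dquot f z2 z3 * f z1" unfolding 1[symmetric] A thiele_def by (simp add: algebra_simps)
  show "A$2$1 * z2 + A$2$2 = dquot f z1 z3" unfolding A thiele_def by (simp add: q_def)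
  show "A$1$1 * z2 + A$1$2 = dquot f z1 z3 * f z2" unfolding A thiele_def mat2_nth q_def[symmetric]
    using pq by algebra
  show "A$2$1 * z3 + A$2$2 = dquot f z1 z2" unfolding A thiele_def mat2_nth p_def[symmetric]
    using D by algebra
  show "A$1$1 * z3 + A$1$2 = dquot f z1 z2 * f z3" unfolding A thiele_def mat2_nth p_def[symmetric]
    using D pq by algebra
qed

text \<open>
  The factors \<open>\<mu>\<^sub>i\<close> are multiplicative, as divided differences obey a chain rule.
  So both sides agree on the vectors \<open>(z\<^sub>i, 1)\<close>, without any scalar.
\<close>

lemma interp_mat_mult:
  assumes d: "z1 \<noteq> z2" "z1 \<noteq> z3" "z2 \<noteq> z3" and e: "f z1 \<noteq> f z2" "f z1 \<noteq> f z3" "f z2 \<noteq> f z3"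
    and h: "h z1 = g (f z1)" "h z2 = g (f z2)" "h z3 = g (f z3)"
  shows "interp_mat h (z1, z2, z3) = interp_mat g (f z1, f z2, f z3) ** interp_mat f (z1, z2, z3)"
proof -
  define G F where "G = interp_mat g (f z1, f z2, f z3)" and "F = interp_mat f (z1, z2, z3)"
  note H = interp_mat_apply[OF d, of h] and F = interp_mat_apply[OF d, of f, folded F_def]
    and G = interp_mat_apply[OF e, of g, folded G_def]
  have "dquot h z2 z3 = dquot g (f z2) (f z3) * dquot f z2 z3" "dquot h z1 z3 = dquot g (f z1) (f z3) * dquot f z1 z3"
    using d e h by (simp_all add: dquot_def)
  note H = H[unfolded this h]
  have M: "(G ** F)$i$1 * z + (G ** F)$i$2 = G$i$1 * (F$1$1 * z + F$1$2) + G$i$2 * (F$2$1 * z + F$2$2)"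
    for i z by (simp add: matrix_matrix_mult_def sum_2 algebra_simps)
  have c: "a * (k * w) + b * k = (a * w + b) * k" for a b k w :: complex by (simp add: algebra_simps)
  have "interp_mat h (z1, z2, z3) = G ** F"
    by (rule mat2_eqI[OF d(1)]; unfold M F H c G) (simp_all add: mult_ac)
  then show ?thesis by (simp add: G_def F_def)
qed

lemma det_interp_mat:
  fixes f :: "complex \<Rightarrow> complex"
  assumes d: "z1 \<noteq> z2" "z1 \<noteq> z3" "z2 \<noteq> z3"
  defines "A \<equiv> interp_mat f (z1, z2, z3)"
  shows "A$1$1 * A$2$2 - A$1$2 * A$2$1 = dquot f z1 z2 * dquot f z1 z3 * dquot f z2 z3"
proof -
  note F = interp_mat_apply[OF d, of f, folded A_def]
  have "dquot f z1 z2 * (z1 - z2) = f z1 - f z2" using d by (simp add: dquot_def)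
  then have "(A$1$1 * A$2$2 - A$1$2 * A$2$1) * (z1 - z2) = dquot f z1 z2 * dquot f z1 z3 * dquot f z2 z3 * (z1 - z2)"
    using F(1-4) by algebra
  then show ?thesis using d by simp
qed

text \<open>
  The reflection \<open>z \<mapsto> 1 / cnj z\<close> fixes the circle, so the reflected matrix interpolates
  the same points. Comparing the factors \<open>\<mu>\<^sub>i\<close> shows that the two matrices differ exactly by the
  phase \<open>u\<close>.
\<close>

lemma interp_mat_symmetry:
  fixes f :: "complex \<Rightarrow> complex"
  assumes d: "z1 \<noteq> z2" "z1 \<noteq> z3" "z2 \<noteq> z3"
    and z: "cmod z1 = 1" "cmod z2 = 1" "cmod z3 = 1" and w: "cmod (f z1) = 1" "cmod (f z2) = 1" "cmod (f z3) = 1"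
  defines "A \<equiv> interp_mat f (z1, z2, z3)"
    and "u \<equiv> (f z1 * f z2 * f z3) / (z1 * z2 * z3)"
  shows "A$2$2 = u * cnj (A$1$1)" "A$2$1 = u * cnj (A$1$2)"
proof -
  note F = interp_mat_apply[OF d, of f, folded A_def]
  have inv: "cnj x = inverse x" "x \<noteq> 0" if "cmod x = 1" for x
    using that by (auto simp: inverse_eq_divide divide_conv_cnj)
  have dq: "cnj (dquot f x y) = dquot f x y * (x * y) / (f x * f y)"
    if "x \<noteq> y" "cmod x = 1" "cmod y = 1" "cmod (f x) = 1" "cmod (f y) = 1" for x y
  proof -
    have "cnj (dquot f x y) = (inverse (f x) - inverse (f y)) / (inverse x - inverse y)"
      using that by (simp add: dquot_def inv(1))
    also have "\<dots> = dquot f x y * (x * y) / (f x * f y)"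
      using that inv(2)[of x] inv(2)[of y] inv(2)[of "f x"] inv(2)[of "f y"]
      by (simp add: dquot_def divide_simps) (simp add: algebra_simps)
    finally show ?thesis .
  qed
  \<comment> \<open>the reflected matrix\<close>
  define B where "B = mat2 (u * cnj (A$2$2)) (u * cnj (A$2$1)) (u * cnj (A$1$2)) (u * cnj (A$1$1))"
  have B: "B$1$1 * z + B$1$2 = u * z * cnj (A$2$1 * z + A$2$2)" "B$2$1 * z + B$2$2 = u * z * cnj (A$1$1 * z + A$1$2)"
    if "cmod z = 1" for z
  proof -
    have "z * cnj z = 1" using that by (simp add: complex_norm_square[symmetric])
    then have "z * (cnj x * cnj z) = cnj x" for x by (metis mult.commute mult.left_commute mult_1)
    then show "B$1$1 * z + B$1$2 = u * z * cnj (A$2$1 * z + A$2$2)" "B$2$1 * z + B$2$2 = u * z * cnj (A$1$1 * z + A$1$2)"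
      by (simp_all add: B_def algebra_simps)
  qed
  have nz: "z1 \<noteq> 0" "z2 \<noteq> 0" "z3 \<noteq> 0" "f z1 \<noteq> 0" "f z2 \<noteq> 0" "f z3 \<noteq> 0" using z w inv(2) by blast+
  have "A = B"
  proof (rule mat2_eqI[OF d(1)])
    show "A$1$1 * z1 + A$1$2 = B$1$1 * z1 + B$1$2"
      unfolding B[OF z(1)] F dq[OF d(3) z(2,3) w(2,3)] using nz by (simp add: u_def)
    show "A$1$1 * z2 + A$1$2 = B$1$1 * z2 + B$1$2"
      unfolding B[OF z(2)] F dq[OF d(2) z(1,3) w(1,3)] using nz by (simp add: u_def)
    show "A$2$1 * z1 + A$2$2 = B$2$1 * z1 + B$2$2"
      unfolding B[OF z(1)] F complex_cnj_mult dq[OF d(3) z(2,3) w(2,3)] inv(1)[OF w(1)] using nz by (simp add: u_def)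
    show "A$2$1 * z2 + A$2$2 = B$2$1 * z2 + B$2$2"
      unfolding B[OF z(2)] F complex_cnj_mult dq[OF d(2) z(1,3) w(1,3)] inv(1)[OF w(2)] using nz by (simp add: u_def)
  qed
  then show "A$2$2 = u * cnj (A$1$1)" "A$2$1 = u * cnj (A$1$2)"
    using mat2_nth(3,4) unfolding B_def by metis+
qed

section \<open>The interpolation matrix in lifted coordinates\<close>

lemma cis_diff: "cis a - cis b = of_real (2 * sin ((a - b) / 2)) * (\<i> * cis ((a + b) / 2))"
proof -
  define x y where "x = (a + b) / 2" and "y = (a - b) / 2"
  have "cis a = cis (x + y)" "cis b = cis (x - y)" by (simp_all add: x_def y_def field_simps)
  then show ?thesis
    unfolding x_def[symmetric] y_def[symmetric]
    by (simp add: complex_eq_iff cos_add cos_diff sin_add sin_diff)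
qed

lemma cmod_cis_diff: "cmod (cis a - cis b) = 2 * \<bar>sin ((a - b) / 2)\<bar>"
  unfolding cis_diff by (simp add: norm_mult)

lemma sin_half_nz:
  assumes "\<bar>s - t\<bar> < 2 * pi" "s \<noteq> t"
  shows "sin ((s - t) / 2) \<noteq> 0"
proof (cases "s > t")
  case True
  then show ?thesis using assms sin_gt_zero[of "(s - t) / 2"] by force
next
  case False
  then have "sin ((t - s) / 2) > 0" using assms by (intro sin_gt_zero) auto
  moreover have "sin ((s - t) / 2) = - sin ((t - s) / 2)" by (metis minus_diff_eq minus_divide_left sin_minus)
  ultimately show ?thesis by simp
qed

lemma cis_neq: "\<bar>s - t\<bar> < 2 * pi \<Longrightarrow> s \<noteq> t \<Longrightarrow> cis s \<noteq> cis t"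
  using sin_half_nz[of s t] cmod_cis_diff[of s t] by auto

text \<open>
  A crude form of Jordan's inequality.
\<close>

lemma sin_ge_quarter:
  assumes "0 \<le> x" "x \<le> pi / 2"
  shows "x / 4 \<le> sin x"
proof (cases "x \<le> pi / 3")
  case True
  show ?thesis
  proof (cases "x = 0")
    case False
    then have x: "0 < x" using assms by simp
    have "\<exists>z>0. z < x \<and> sin x - sin 0 = (x - 0) * cos z"
      by (rule MVT2[OF x]) (rule DERIV_sin)
    then obtain z where z: "0 < z" "z < x" "sin x = x * cos z" by auto
    have "cos z \<ge> cos (pi / 3)" using z True assms by (intro cos_monotone_0_pi_le) auto
    then have "x * cos z \<ge> x * (1 / 2)" using x by (intro mult_left_mono) (auto simp: cos_60)
    then show ?thesis using z x by simp
  qed simp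
next
  case False
  have "sin x \<ge> sin (pi / 6)" using False assms by (intro sin_monotone_2pi_le) auto
  then show ?thesis using assms pi_less_4 by (simp add: sin_30)
qed

lemma quarter_trans: "a / 4 \<le> c \<Longrightarrow> b \<le> a \<Longrightarrow> b / 4 \<le> (c::real)"
  by linarith

lemma sin_ge_min:
  assumes "0 \<le> y" "y \<le> pi"
  shows "min y (pi - y) / 4 \<le> sin y"
proof (cases "y \<le> pi / 2")
  case True
  then show ?thesis using sin_ge_quarter[of y] assms by simp
next
  case False
  then show ?thesis using sin_ge_quarter[of "pi - y"] assms by simp
qed

text \<open>
  The first two derivatives of \<open>cis\<close>; they enter when divided differences on the circle are
  written in real coordinates.
\<close>

abbreviation E1 :: "real \<Rightarrow> complex" where "E1 t \<equiv> \<i> * cis t"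
abbreviation E2 :: "real \<Rightarrow> complex" where "E2 t \<equiv> - cis t"

lemma E1_deriv: "(cis has_vector_derivative E1 t) (at t)"
  by (auto simp: has_vector_derivative_def intro!: derivative_eq_intros)

lemma E2_deriv: "(E1 has_vector_derivative E2 t) (at t)"
  by (auto simp: has_vector_derivative_def intro!: derivative_eq_intros)

lemma E_cont: "continuous_on X E1" "continuous_on X E2"
  by (intro continuous_intros)+

lemma dd1_E1: "of_real (s - t) * dd1 E1 s t = cis s - cis t"
  by (rule dd1_eq[OF E1_deriv])

lemma dd1_E1_nz: "\<bar>s - t\<bar> < 2 * pi \<Longrightarrow> dd1 E1 s t \<noteq> 0"
  using cis_neq[of s t] dd1_E1[of s t] by (cases "s = t") (auto simp: dd1_same)

text \<open>
  Real coordinates for triples. The bounds by \<open>2\<pi>\<close> ensure that distinct coordinates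
  give distinct points, so that the divided differences of \<open>cis\<close> do not vanish.
\<close>

definition lifts3 :: "(real \<times> real \<times> real) set"
  where "lifts3 = {(r, s, t). \<bar>s - r\<bar> < 2 * pi \<and> \<bar>t - r\<bar> < 2 * pi \<and> \<bar>t - s\<bar> < 2 * pi}"

lemma open_lifts3: "open lifts3"
  unfolding lifts3_def case_prod_unfold
  by (intro open_Collect_conj open_Collect_less continuous_intros)

text \<open>
  The three coordinates are moved at different speeds, so that each
  coincidence happens for one value of the parameter only.
\<close>

lemma eventually_perturbed_distinct:
  assumes "(r, s, t) \<in> lifts3"
  shows "\<forall>\<^sub>F \<tau> in at (0::real). (r, s + \<tau>, t + 2 * \<tau>) \<in> lifts3 \<and> r \<noteq> s + \<tau> \<and> r \<noteq> t + 2 * \<tau> \<and> s + \<tau> \<noteq> t + 2 * \<tau>"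
proof -
  have "((\<lambda>\<tau>. (r, s + \<tau>, t + 2 * \<tau>)) \<longlongrightarrow> (r, s + 0, t + 2 * 0)) (at (0::real))"
    by (intro tendsto_intros)
  then have 1: "\<forall>\<^sub>F \<tau> in at (0::real). (r, s + \<tau>, t + 2 * \<tau>) \<in> lifts3"
    using assms by (intro topological_tendstoD[OF _ open_lifts3]) auto
  have n: "\<forall>\<^sub>F \<tau> in at (0::real). \<tau> \<noteq> c" for c by (rule eventually_neq_at_within)
  show ?thesis using 1 n[of "r - s"] n[of "(r - t) / 2"] n[of "s - t"]
    by eventually_elim auto
qed

lemma eq_on_lifts3:
  fixes \<phi> \<psi> :: "real \<times> real \<times> real \<Rightarrow> 'a::t2_space"
  assumes "continuous_on lifts3 \<phi>" "continuous_on lifts3 \<psi>"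
    and eq: "\<And>r s t. (r, s, t) \<in> lifts3 \<Longrightarrow> r \<noteq> s \<Longrightarrow> r \<noteq> t \<Longrightarrow> s \<noteq> t \<Longrightarrow> \<phi> (r, s, t) = \<psi> (r, s, t)"
    and p: "(r, s, t) \<in> lifts3"
  shows "\<phi> (r, s, t) = \<psi> (r, s, t)"
proof -
  have lim: "((\<lambda>\<tau>. h (r, s + \<tau>, t + 2 * \<tau>)) \<longlongrightarrow> h (r, s, t)) (at (0::real))"
    if "continuous_on lifts3 h" for h :: "real \<times> real \<times> real \<Rightarrow> 'a"
  proof -
    have "((\<lambda>\<tau>. (r, s + \<tau>, t + 2 * \<tau>)) \<longlongrightarrow> (r, s + 0, t + 2 * 0)) (at (0::real))"
      by (intro tendsto_intros)
    moreover have "isCont h (r, s, t)"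
      using that p open_lifts3 continuous_on_eq_continuous_at by blast
    ultimately show ?thesis using isCont_tendsto_compose by fastforce
  qed
  have "\<forall>\<^sub>F \<tau> in at (0::real). \<phi> (r, s + \<tau>, t + 2 * \<tau>) = \<psi> (r, s + \<tau>, t + 2 * \<tau>)"
    using eventually_perturbed_distinct[OF p] by eventually_elim (use eq in auto)
  then have "((\<lambda>\<tau>. \<phi> (r, s + \<tau>, t + 2 * \<tau>)) \<longlongrightarrow> \<psi> (r, s, t)) (at (0::real))"
    using lim[OF assms(2)] tendsto_cong by fastforce
  then show ?thesis using lim[OF assms(1)] tendsto_unique[OF trivial_limit_at] by blast
qed

lemma continuous_on_mat2:
  assumes "continuous_on X a" "continuous_on X b" "continuous_on X c" "continuous_on X d"
  shows "continuous_on X (\<lambda>x. mat2 (a x) (b x) (c x) (d x))"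
proof -
  have "continuous_on X (\<lambda>x. mat2 (a x) (b x) (c x) (d x) $ i $ j)" if "i \<in> {1, 2}" "j \<in> {1, 2}" for i j
    using that by (elim insertE emptyE; hypsubst; unfold mat2_nth) (rule assms)+
  then have "continuous_on X (\<lambda>x. mat2 (a x) (b x) (c x) (d x) $ i $ j)" for i j
    using exhaust_2[of i] exhaust_2[of j] by blast
  then have "continuous_on X (\<lambda>x. \<chi> i j. mat2 (a x) (b x) (c x) (d x) $ i $ j)"
    by (intro continuous_on_vec_lambda)
  then show ?thesis by simp
qed

context circle_lift
begin

text \<open>
  The first two derivatives of \<open>cis \<circ> F\<close>.
\<close>

definition G1 :: "real \<Rightarrow> complex" where "G1 t = \<i> * of_real (F' t) * cis (F t)"
definition G2 :: "real \<Rightarrow> complex" where "G2 t = (\<i> * of_real (F'' t) - (of_real (F' t))\<^sup>2) * cis (F t)"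

text \<open>
  The divided difference of the circle map in lifted coordinates: a quotient of real divided
  differences, which also makes sense on the diagonal.
\<close>

definition delta :: "real \<Rightarrow> real \<Rightarrow> complex" where "delta s t = dd1 G1 s t / dd1 E1 s t"

text \<open>
  The divided difference of order two of the circle map, by the quotient rule for divided
  differences.
\<close>

definition Delta :: "real \<Rightarrow> real \<Rightarrow> real \<Rightarrow> complex"
  where "Delta r s t = (dd2 G2 r s t * dd1 E1 s r - dd1 G1 s r * dd2 E2 r s t) /
    (dd1 E1 s r * dd1 E1 t r * dd1 E1 t s)"

definition interp_lift :: "real \<times> real \<times> real \<Rightarrow> complex^2^2"
  where "interp_lift = (\<lambda>(r, s, t). thiele (cis r) (cis s) (cis (F r)) (delta s r) (delta t r) (Delta r s t))"

lemma G1_deriv: "((\<lambda>t. cis (F t)) has_vector_derivative G1 t) (at t)"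
proof -
  have "(F has_derivative (\<lambda>h. F' t * h)) (at t)" using F_deriv by (simp add: has_field_derivative_def)
  then show ?thesis unfolding has_vector_derivative_def G1_def
    by (auto intro!: derivative_eq_intros simp: scaleR_conv_of_real)
qed

lemma G2_deriv: "(G1 has_vector_derivative G2 t) (at t)"
proof -
  have 1: "((\<lambda>t. cis (F t)) has_vector_derivative \<i> * of_real (F' t) * cis (F t)) (at t)"
    using G1_deriv by (simp add: G1_def)
  have "(F' has_vector_derivative F'' t) (at t)"
    using F'_deriv by (simp add: has_real_derivative_iff_has_vector_derivative)
  then have "((\<lambda>t. complex_of_real (F' t)) has_vector_derivative of_real (F'' t)) (at t)"
    by (rule bounded_linear.has_vector_derivative[OF bounded_linear_of_real])
  then have "((\<lambda>t. \<i> * of_real (F' t)) has_vector_derivative \<i> * of_real (F'' t)) (at t)"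
    by (rule has_vector_derivative_mult_right)
  from has_vector_derivative_mult[OF this 1] show ?thesis
    unfolding G1_def[abs_def] G2_def by (rule has_vector_derivative_eq_rhs) (simp add: power2_eq_square algebra_simps)
qed

lemma G_cont: "continuous_on X G1" "continuous_on X G2"
proof -
  have "continuous_on X F" "continuous_on X F'" "continuous_on X F''"
    using F_cont F'_cont continuous_on_subset[OF F''_cont] by auto
  then show "continuous_on X G1" "continuous_on X G2"
    unfolding G1_def[abs_def] G2_def[abs_def] by (auto intro!: continuous_intros)
qed

lemma delta_eq:
  assumes "\<bar>s - t\<bar> < 2 * pi" "s \<noteq> t"
  shows "delta s t = (cis (F s) - cis (F t)) / (cis s - cis t)"
proof -
  have "of_real (s - t) * dd1 G1 s t = cis (F s) - cis (F t)" by (rule dd1_eq[OF G1_deriv])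
  then have "(cis (F s) - cis (F t)) / (cis s - cis t) = (of_real (s - t) * dd1 G1 s t) / (of_real (s - t) * dd1 E1 s t)"
    by (simp only: dd1_E1)
  also have "complex_of_real (s - t) \<noteq> 0" using assms by simp
  then have "(of_real (s - t) * dd1 G1 s t) / (of_real (s - t) * dd1 E1 s t) = delta s t"
    unfolding delta_def by (simp del: of_real_diff)
  finally show ?thesis ..
qed

lemma Delta_eq:
  assumes "(r, s, t) \<in> lifts3" "s \<noteq> t"
  shows "Delta r s t = (delta t r - delta s r) / (cis t - cis s)"
proof -
  have nz: "dd1 E1 s r \<noteq> 0" "dd1 E1 t r \<noteq> 0" "dd1 E1 t s \<noteq> 0"
    using assms by (auto simp: lifts3_def intro!: dd1_E1_nz)
  have g: "of_real (t - s) * dd2 G2 r s t = dd1 G1 t r - dd1 G1 s r"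
    by (rule dd2_eq[OF G2_deriv G_cont(2)])
  have e: "of_real (t - s) * dd2 E2 r s t = dd1 E1 t r - dd1 E1 s r"
    by (rule dd2_eq[OF E2_deriv E_cont(2)])
  have c: "cis t - cis s = of_real (t - s) * dd1 E1 t s" by (rule dd1_E1[symmetric])
  define h where "h = complex_of_real (t - s)"
  have h: "h \<noteq> 0" using assms by (simp add: h_def)
  have "delta t r - delta s r = (dd1 G1 t r * dd1 E1 s r - dd1 G1 s r * dd1 E1 t r) / (dd1 E1 s r * dd1 E1 t r)"
    using nz by (simp add: delta_def diff_frac_eq mult.commute)
  also have "dd1 G1 t r * dd1 E1 s r - dd1 G1 s r * dd1 E1 t r
      = h * (dd2 G2 r s t * dd1 E1 s r - dd1 G1 s r * dd2 E2 r s t)"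
    using g e unfolding h_def[symmetric] by algebra
  finally have "(delta t r - delta s r) / (cis t - cis s) =
    (h * (dd2 G2 r s t * dd1 E1 s r - dd1 G1 s r * dd2 E2 r s t)) / (h * (dd1 E1 s r * dd1 E1 t r * dd1 E1 t s))"
    unfolding c h_def[symmetric] by (simp add: mult_ac)
  also have "\<dots> = Delta r s t" using h by (simp add: Delta_def)
  finally show ?thesis ..
qed

lemma interp_lift_eq:
  assumes f: "\<And>t. f (cis t) = cis (F t)"
    and p: "(r, s, t) \<in> lifts3" "r \<noteq> s" "r \<noteq> t" "s \<noteq> t"
  shows "interp_lift (r, s, t) = interp_mat f (cis r, cis s, cis t)"
proof -
  have "delta s r = dquot f (cis s) (cis r)" "delta t r = dquot f (cis t) (cis r)"
    using p by (auto simp: delta_eq lifts3_def dquot_def f)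
  then show ?thesis by (simp add: interp_lift_def interp_mat_def Delta_eq[OF p(1,4)] f)
qed

lemma continuous_on_lifts3_coords:
  "continuous_on X (\<lambda>p::real \<times> real \<times> real. fst p)" "continuous_on X (\<lambda>p::real \<times> real \<times> real. fst (snd p))"
  "continuous_on X (\<lambda>p::real \<times> real \<times> real. snd (snd p))"
  by (intro continuous_intros)+

lemma continuous_on_delta:
  assumes "continuous_on X a" "continuous_on X b" "\<And>x. x \<in> X \<Longrightarrow> \<bar>a x - b x\<bar> < 2 * pi"
  shows "continuous_on X (\<lambda>x. delta (a x) (b x))"
  unfolding delta_def
  by (intro continuous_on_divide continuous_on_dd1 E_cont G_cont assms ballI dd1_E1_nz)

lemma continuous_on_interp_lift: "continuous_on lifts3 interp_lift"
proof -
  note c = continuous_on_lifts3_coords[of lifts3]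
  have l: "\<bar>fst (snd p) - fst p\<bar> < 2 * pi" "\<bar>snd (snd p) - fst p\<bar> < 2 * pi" "\<bar>snd (snd p) - fst (snd p)\<bar> < 2 * pi"
    if "p \<in> lifts3" for p using that by (auto simp: lifts3_def)
  have D: "continuous_on lifts3 (\<lambda>p. Delta (fst p) (fst (snd p)) (snd (snd p)))"
    unfolding Delta_def
    by (intro continuous_on_divide continuous_on_mult continuous_on_diff continuous_on_dd1 continuous_on_dd2 E_cont G_cont c)
      (simp add: dd1_E1_nz l)
  have F: "continuous_on lifts3 (\<lambda>p. F (fst p))"
    by (rule continuous_on_compose2[OF F_cont c(1)]) auto
  show ?thesis
    unfolding interp_lift_def case_prod_unfold thiele_def
    by (intro continuous_on_mat2 continuous_intros D c F continuous_on_delta l)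
qed

text \<open>
  A chord of the circle is a sine times the unit vector at the mean angle. As \<open>F\<close> is
  increasing and commutes with the translation by \<open>2\<pi>\<close>, the two sines in the quotient have the same
  sign. This is where orientation enters.
\<close>

lemma delta_polar:
  assumes "\<bar>s - t\<bar> < 2 * pi" "s \<noteq> t"
  obtains \<rho> where "\<rho> > 0" "delta s t = of_real \<rho> * cis ((F s - s + F t - t) / 2)"
proof -
  define y h where "y = sin ((F s - F t) / 2)" and "h = sin ((s - t) / 2)"
  have h0: "h \<noteq> 0" using sin_half_nz assms by (simp add: h_def)
  have pos: "sin ((b - a) / 2) > 0" "sin ((F b - F a) / 2) > 0" if "a < b" "b < a + 2 * pi" for a b
    using that F_strict_mono[of a b] F_strict_mono[of b "a + 2 * pi"] F_period[of a]
    by (auto intro!: sin_gt_zero)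
  have "y / h > 0"
  proof (cases "s > t")
    case True
    then show ?thesis using pos[of t s] assms by (simp add: y_def h_def)
  next
    case False
    then have "sin ((t - s) / 2) > 0" "sin ((F t - F s) / 2) > 0" using pos[of s t] assms by auto
    moreover have "sin ((t - s) / 2) = - h" "sin ((F t - F s) / 2) = - y"
      unfolding h_def y_def by (metis minus_diff_eq minus_divide_left sin_minus)+
    ultimately show ?thesis by (simp add: zero_less_divide_iff)
  qed
  moreover have "delta s t = of_real (y / h) * cis ((F s - s + F t - t) / 2)"
  proof -
    have "delta s t = (of_real (2 * y) * (\<i> * cis ((F s + F t) / 2))) / (of_real (2 * h) * (\<i> * cis ((s + t) / 2)))"
      unfolding delta_eq[OF assms] cis_diff y_def h_def ..
    also have "\<dots> = of_real (y / h) * (cis ((F s + F t) / 2) / cis ((s + t) / 2))" by simp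
    also have "cis ((F s + F t) / 2) / cis ((s + t) / 2) = cis ((F s + F t) / 2 - (s + t) / 2)"
      by (rule cis_divide)
    also have "(F s + F t) / 2 - (s + t) / 2 = (F s - s + F t - t) / 2" by (simp add: field_simps)
    finally show ?thesis .
  qed
  ultimately show ?thesis using that by blast
qed

lemma delta_nz: "\<bar>s - t\<bar> < 2 * pi \<Longrightarrow> delta s t \<noteq> 0"
proof (cases "s = t")
  case True
  then show ?thesis using F'_pos[of t] by (simp add: delta_def dd1_same G1_def)
next
  case False
  assume "\<bar>s - t\<bar> < 2 * pi"
  then obtain \<rho> where "\<rho> > 0" "delta s t = of_real \<rho> * cis ((F s - s + F t - t) / 2)"
    using delta_polar False by blast
  then show ?thesis by simp
qed

text \<open>
  The phase \<open>u\<close> of the interpolation matrix.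
\<close>

definition twist :: "real \<times> real \<times> real \<Rightarrow> complex"
  where "twist = (\<lambda>(r, s, t). cis (F r + F s + F t - r - s - t))"

text \<open>
  The determinant is the product of the three divided differences; in polar form, the product of
  three positive numbers and the phase. Dividing by the phase gives a positive
  \<open>gscale\<close>, so the interpolating map preserves the disc.
\<close>

lemma interp_lift_distinct:
  assumes p: "(r, s, t) \<in> lifts3" "r \<noteq> s" "r \<noteq> t" "s \<noteq> t"
  defines "A \<equiv> interp_lift (r, s, t)" and "u \<equiv> twist (r, s, t)"
  shows "A$2$2 = u * cnj (A$1$1)" "A$2$1 = u * cnj (A$1$2)"
    "gscale A = cmod (delta s r * delta t r * delta t s)"
proof -
  \<comment> \<open>the circle map with lift \<open>F\<close>\<close>
  define f where "f z = cis (F (SOME t. z = cis t))" for z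
  have f: "f (cis t) = cis (F t)" for t
  proof -
    define t' where "t' = (SOME t'. cis t = cis t')"
    have "cis t = cis t'" unfolding t'_def by (rule someI_ex) blast
    then have "sin t' = sin t \<and> cos t' = cos t" by (simp add: complex_eq_iff)
    then obtain k where "t' = t + 2 * pi * of_int k" by (auto simp: sin_cos_eq_iff)
    then have "F t' = F t + 2 * pi * of_int k" by (simp add: F_period_int)
    moreover have "cis (F t + 2 * pi * of_int k) = cis (F t)"
      using sin_cos_eq_iff[of "F t + 2 * pi * of_int k" "F t"] by (auto simp: complex_eq_iff)
    ultimately show ?thesis by (simp add: f_def t'_def)
  qed
  have A: "A = interp_mat f (cis r, cis s, cis t)" unfolding A_def by (rule interp_lift_eq[OF f p])
  have l: "\<bar>s - r\<bar> < 2 * pi" "\<bar>t - r\<bar> < 2 * pi" "\<bar>t - s\<bar> < 2 * pi" using p by (auto simp: lifts3_def)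
  have d: "cis r \<noteq> cis s" "cis r \<noteq> cis t" "cis s \<noteq> cis t"
    using cis_neq[of s r] cis_neq[of t r] cis_neq[of t s] l p by metis+
  have u: "u = (f (cis r) * f (cis s) * f (cis t)) / (cis r * cis s * cis t)"
    by (simp add: u_def twist_def f cis_mult cis_divide algebra_simps)
  show 1: "A$2$2 = u * cnj (A$1$1)" "A$2$1 = u * cnj (A$1$2)"
    unfolding A u by (rule interp_mat_symmetry[OF d]; simp add: f)+
  have dq: "dquot f (cis r) (cis s) = delta s r" "dquot f (cis r) (cis t) = delta t r" "dquot f (cis s) (cis t) = delta t s"
    using l p unfolding dquot_commute[of f "cis r"] dquot_commute[of f "cis s" "cis t"] by (simp_all add: dquot_def f delta_eq)
  have det: "A$1$1 * A$2$2 - A$1$2 * A$2$1 = delta s r * delta t r * delta t s"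
    unfolding A det_interp_mat[OF d] dq ..
  obtain \<rho>1 where 11: "\<rho>1 > 0" "delta s r = of_real \<rho>1 * cis ((F s - s + F r - r) / 2)"
    using delta_polar[of s r] l p by metis
  obtain \<rho>2 where 12: "\<rho>2 > 0" "delta t r = of_real \<rho>2 * cis ((F t - t + F r - r) / 2)"
    using delta_polar[of t r] l p by metis
  obtain \<rho>3 where 13: "\<rho>3 > 0" "delta t s = of_real \<rho>3 * cis ((F t - t + F s - s) / 2)"
    using delta_polar[of t s] l p by metis
  have "delta s r * delta t r * delta t s = of_real (\<rho>1 * \<rho>2 * \<rho>3) *
      cis ((F s - s + F r - r) / 2 + (F t - t + F r - r) / 2 + (F t - t + F s - s) / 2)"
    unfolding 11 12 13 by (simp add: cis_mult[symmetric] mult_ac)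
  also have "(F s - s + F r - r) / 2 + (F t - t + F r - r) / 2 + (F t - t + F s - s) / 2 = F r + F s + F t - r - s - t"
    by (simp add: field_simps)
  finally have prod: "delta s r * delta t r * delta t s = of_real (\<rho>1 * \<rho>2 * \<rho>3) * u" by (simp add: u_def twist_def)
  have gsc: "complex_of_real (gscale A) = A$1$1 * cnj (A$1$1) - A$1$2 * cnj (A$1$2)"
    using gscale_mat2[of "A$1$1" "A$1$2" "A$2$1" "A$2$2"] unfolding mat2_eta .
  have "u * complex_of_real (gscale A) = u * (A$1$1 * cnj (A$1$1) - A$1$2 * cnj (A$1$2))"
    by (simp only: gsc)
  also have "\<dots> = A$1$1 * A$2$2 - A$1$2 * A$2$1"
    unfolding 1 by (simp add: algebra_simps)
  also have "\<dots> = u * of_real (\<rho>1 * \<rho>2 * \<rho>3)" unfolding det prod by (rule mult.commute)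
  finally have "complex_of_real (gscale A) = of_real (\<rho>1 * \<rho>2 * \<rho>3)"
    by (simp add: u_def twist_def)
  then have "gscale A = \<rho>1 * \<rho>2 * \<rho>3" by (simp only: of_real_eq_iff)
  moreover have "cmod (delta s r * delta t r * delta t s) = \<rho>1 * \<rho>2 * \<rho>3"
    using 11(1) 12(1) 13(1) unfolding 11(2) 12(2) 13(2) by (simp add: norm_mult)
  ultimately show "gscale A = cmod (delta s r * delta t r * delta t s)" by simp
qed

text \<open>
  All three equations are closed conditions, hence they survive the passage to
  coinciding nodes.
\<close>

lemma interp_lift_properties:
  assumes p: "(r, s, t) \<in> lifts3"
  defines "A \<equiv> interp_lift (r, s, t)" and "u \<equiv> twist (r, s, t)"
  shows "A$2$2 = u * cnj (A$1$1)" "A$2$1 = u * cnj (A$1$2)"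
    "gscale A = cmod (delta s r * delta t r * delta t s)"
proof -
  have l: "\<bar>fst (snd p) - fst p\<bar> < 2 * pi" "\<bar>snd (snd p) - fst p\<bar> < 2 * pi" "\<bar>snd (snd p) - fst (snd p)\<bar> < 2 * pi"
    if "p \<in> lifts3" for p using that by (auto simp: lifts3_def)
  note c = continuous_on_lifts3_coords[of lifts3]
  have N: "continuous_on lifts3 (\<lambda>p. interp_lift p $ i $ j)" for i j
    by (intro continuous_on_component continuous_on_interp_lift)
  have F: "continuous_on lifts3 (\<lambda>p. F (h p))" if "continuous_on lifts3 h" for h
    by (rule continuous_on_compose2[OF F_cont that]) auto
  have T: "continuous_on lifts3 twist"
    unfolding twist_def case_prod_unfold by (intro continuous_intros F c)
  show "A$2$2 = u * cnj (A$1$1)" unfolding A_def u_def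
    by (rule eq_on_lifts3[where \<phi> = "\<lambda>p. interp_lift p $2$2" and \<psi> = "\<lambda>p. twist p * cnj (interp_lift p $1$1)"])
      (intro continuous_intros N T interp_lift_distinct p | assumption)+
  show "A$2$1 = u * cnj (A$1$2)" unfolding A_def u_def
    by (rule eq_on_lifts3[where \<phi> = "\<lambda>p. interp_lift p $2$1" and \<psi> = "\<lambda>p. twist p * cnj (interp_lift p $1$2)"])
      (intro continuous_intros N T interp_lift_distinct p | assumption)+
  have "gscale (interp_lift (r, s, t)) = (\<lambda>p. cmod (delta (fst (snd p)) (fst p) * delta (snd (snd p)) (fst p) * delta (snd (snd p)) (fst (snd p)))) (r, s, t)"
  proof (rule eq_on_lifts3[OF _ _ _ p])
    show "continuous_on lifts3 (\<lambda>p. gscale (interp_lift p))" unfolding gscale_def by (intro continuous_intros N)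
    show "continuous_on lifts3 (\<lambda>p. cmod (delta (fst (snd p)) (fst p) * delta (snd (snd p)) (fst p) * delta (snd (snd p)) (fst (snd p))))"
      by (intro continuous_on_norm continuous_on_mult continuous_on_delta c l)
  qed (simp add: interp_lift_distinct)
  then show "gscale A = cmod (delta s r * delta t r * delta t s)" by (simp add: A_def)
qed

lemma interp_lift_in_GU:
  assumes p: "(r, s, t) \<in> lifts3"
  shows "interp_lift (r, s, t) \<in> GU"
proof (rule GU_I)
  let ?A = "interp_lift (r, s, t)" and ?u = "twist (r, s, t)"
  show "?A = mat2 (?A$1$1) (?A$1$2) (?u * cnj (?A$1$2)) (?u * cnj (?A$1$1))"
    using interp_lift_properties(1,2)[OF p] mat2_eta[of ?A] by metis
  show "cmod ?u = 1" by (simp add: twist_def)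
  have "delta s r * delta t r * delta t s \<noteq> 0" using p by (simp add: delta_nz lifts3_def)
  then have "gscale ?A > 0" using interp_lift_properties(3)[OF p] by simp
  then show "cmod (?A$1$2) < cmod (?A$1$1)" by (simp add: gscale_def power2_less_imp_less)
qed

text \<open>
  Both the arc between the two points and the complementary arc are shrunk
  by at most the factor \<open>m\<close>; chords are comparable with the shorter arc.
\<close>

lemma norm_delta_ge:
  assumes m: "\<And>t. F' t \<ge> m" "m > 0" and st: "\<bar>s - t\<bar> < 2 * pi"
  shows "cmod (delta s t) \<ge> m / 4"
proof -
  have main: "cmod (delta b a) \<ge> m / 4" if ab: "a < b" "b < a + 2 * pi" for a b
  proof -
    define h y where "h = (b - a) / 2" and "y = (F b - F a) / 2"
    have low: "F d - F c \<ge> m * (d - c)" if cd: "c < d" for c d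
    proof -
      obtain w where "F d - F c = (d - c) * F' w" using F_mvt[OF cd] by blast
      then show ?thesis using m(1)[of w] cd by (simp add: mult.commute mult_left_mono)
    qed
    have y: "y \<ge> m * h" "pi - y \<ge> m * (pi - h)"
      using low[OF ab(1)] low[OF ab(2)] F_period[of a] by (simp_all add: y_def h_def field_simps)
    have h: "0 < h" "h < pi" using ab by (simp_all add: h_def)
    have mh: "0 \<le> m * h" "0 \<le> m * (pi - h)" using h m by simp_all
    have "0 \<le> y" "y \<le> pi" using y mh by linarith+
    then have 1: "sin y \<ge> min y (pi - y) / 4" by (rule sin_ge_min)
    have 2: "min y (pi - y) \<ge> m * min h (pi - h)"
    proof -
      have "m * min h (pi - h) \<le> m * h" "m * min h (pi - h) \<le> m * (pi - h)"
        using m(2) by (intro mult_left_mono; simp)+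
      then show ?thesis using y by (intro min.boundedI) linarith+
    qed
    have "sin h \<le> min h (pi - h)"
      using sin_x_le_x[of h] sin_x_le_x[of "pi - h"] h by simp
    then have 3: "m * sin h \<le> m * min h (pi - h)" using m by (intro mult_left_mono) auto
    have sy: "sin y \<ge> m / 4 * sin h"
      using quarter_trans[OF 1 order_trans[OF 3 2]] by simp
    have sh: "sin h > 0" using h by (simp add: sin_gt_zero)
    have "cmod (delta b a) = \<bar>sin y\<bar> / \<bar>sin h\<bar>"
      using delta_eq[of b a] ab by (simp add: norm_divide cmod_cis_diff y_def h_def)
    also have "\<dots> \<ge> m / 4"
      using sy sh by (simp add: pos_le_divide_eq)
    finally show ?thesis .
  qed
  show ?thesis
  proof (cases s t rule: linorder_cases)
    case less
    have "\<bar>t - s\<bar> < 2 * pi" using st by linarith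
    note ts = this
    have "delta s t = (cis (F s) - cis (F t)) / (cis s - cis t)"
      by (rule delta_eq[OF st less_imp_neq[OF less]])
    also have "\<dots> = (cis (F t) - cis (F s)) / (cis t - cis s)"
      using minus_divide_divide[of "cis (F t) - cis (F s)" "cis t - cis s"] by (simp only: minus_diff_eq)
    also have "\<dots> = delta t s"
      by (rule delta_eq[OF ts less_imp_neq[OF less, symmetric], symmetric])
    finally have "delta s t = delta t s" .
    then show ?thesis using main[of s t] less st by simp
  next
    case equal
    then have "cmod (delta s t) = F' t" using F'_pos[of t] by (simp add: delta_def dd1_same G1_def norm_mult norm_divide)
    then show ?thesis using m(1)[of t] m(2) by linarith
  next
    case greater
    then show ?thesis using main[of t s] st by simp
  qed
qed

text \<open>
  The chord bounds the arc up to a constant as long as the lifted arc stays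
  away from a full turn.
\<close>

lemma norm_dd1_E1_ge:
  assumes "\<bar>s - t\<bar> \<le> 3 * pi / 2"
  shows "cmod (dd1 E1 s t) \<ge> 1 / 12"
proof (cases "s = t")
  case False
  define h where "h = \<bar>s - t\<bar> / 2"
  have h: "0 < h" "h \<le> 3 * pi / 4" using assms False by (simp_all add: h_def)
  have "\<bar>s - t\<bar> * cmod (dd1 E1 s t) = cmod (cis s - cis t)"
    using arg_cong[OF dd1_E1[of s t], of cmod] by (simp add: norm_mult del: of_real_diff)
  also have "\<dots> = 2 * \<bar>sin ((s - t) / 2)\<bar>" by (rule cmod_cis_diff)
  also have "\<bar>sin ((s - t) / 2)\<bar> = \<bar>sin h\<bar>"
  proof -
    have "h = (s - t) / 2 \<or> h = - ((s - t) / 2)" unfolding h_def by linarith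
    then show ?thesis by (metis abs_minus_cancel sin_minus)
  qed
  finally have eq: "\<bar>s - t\<bar> * cmod (dd1 E1 s t) = 2 * \<bar>sin h\<bar>" .
  have "sin h \<ge> min h (pi - h) / 4" using sin_ge_min[of h] h by simp
  moreover have "min h (pi - h) \<ge> h / 3" using h by (intro min.boundedI) linarith+
  ultimately have "h / 3 / 4 \<le> sin h" by (rule quarter_trans)
  then have "\<bar>sin h\<bar> \<ge> h / 12" by linarith
  then have "\<bar>s - t\<bar> * (1 / 12) \<le> \<bar>s - t\<bar> * cmod (dd1 E1 s t)" unfolding eq by (simp add: h_def)
  then show ?thesis using False by (subst (asm) mult_le_cancel_left_pos) auto
qed (simp add: dd1_same norm_mult)

text \<open>
  The first entry of the matrix is a polynomial in divided differences, of order \<open>Q\<^sup>2\<close>, and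
  the scale is a product of three divided differences, at least of order \<open>Q\<^bsup>-3\<^esup>\<close>; so the height of the image of the
  base point is of order \<open>Q\<^sup>4 Q\<^sup>3\<close>. The constant
  does not depend on \<open>F\<close>, so it serves all iterates at once.
\<close>

lemma fst_hact_interp_lift_le:
  assumes Q: "Q \<ge> 1" "\<And>t. F' t \<le> Q" "\<And>t. F' t \<ge> 1 / Q" "\<And>t. \<bar>F'' t\<bar> \<le> Q"
    and p: "\<bar>s - r\<bar> \<le> 3 * pi / 2" "\<bar>t - r\<bar> \<le> 3 * pi / 2" "\<bar>t - s\<bar> \<le> 3 * pi / 2"
  shows "fst (hact (interp_lift (r, s, t)) hbase) \<le> 128 * 5328\<^sup>2 * Q ^ 7"
proof -
  let ?A = "interp_lift (r, s, t)"
  have pp: "3 * pi / 2 < 2 * pi" by simp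
  have l: "\<bar>s - r\<bar> < 2 * pi" "\<bar>t - r\<bar> < 2 * pi" "\<bar>t - s\<bar> < 2 * pi" using p pp by linarith+
  then have L: "(r, s, t) \<in> lifts3" by (simp add: lifts3_def)
  have Q2: "Q \<le> Q\<^sup>2" using Q(1) by (simp add: self_le_power)
  have G1b: "cmod (G1 t) \<le> Q" for t using Q(2)[of t] F'_pos[of t] by (simp add: G1_def norm_mult)
  have G2b: "cmod (G2 t) \<le> 2 * Q\<^sup>2" for t
  proof -
    have "cmod (G2 t) \<le> \<bar>F'' t\<bar> + (F' t)\<^sup>2"
      using norm_triangle_ineq4[of "\<i> * of_real (F'' t)" "(of_real (F' t))\<^sup>2"]
      by (simp add: G2_def norm_mult norm_power)
    moreover have "(F' t)\<^sup>2 \<le> Q\<^sup>2" using Q(2)[of t] F'_pos[of t] by (intro power_mono) auto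
    ultimately show ?thesis using Q(4)[of t] Q2 by linarith
  qed
  have E1b: "cmod (dd1 E1 x y) \<le> 1" for x y by (rule norm_dd1_le[OF E_cont(1)]) (simp add: norm_mult)
  have E2b: "cmod (dd2 E2 x y z) \<le> 1" for x y z by (rule norm_dd2_le[OF E_cont(2)]) simp
  have g1: "cmod (dd1 G1 x y) \<le> Q" for x y by (rule norm_dd1_le[OF G_cont(1) G1b])
  have g2: "cmod (dd2 G2 x y z) \<le> 2 * Q\<^sup>2" for x y z by (rule norm_dd2_le[OF G_cont(2) G2b])
  note e = norm_dd1_E1_ge[OF p(1)] norm_dd1_E1_ge[OF p(2)] norm_dd1_E1_ge[OF p(3)]
  have du: "cmod (delta x y) \<le> 12 * Q" if "cmod (dd1 E1 x y) \<ge> 1 / 12" for x y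
  proof -
    have "cmod (delta x y) \<le> Q / (1 / 12)" unfolding delta_def norm_divide
      using g1[of x y] that Q(1) by (intro frac_le) auto
    then show ?thesis by simp
  qed
  have D: "cmod (Delta r s t) \<le> 5184 * Q\<^sup>2"
  proof -
    have "cmod (dd2 G2 r s t * dd1 E1 s r) \<le> 2 * Q\<^sup>2 * 1"
      unfolding norm_mult by (intro mult_mono g2 E1b) auto
    moreover have "cmod (dd1 G1 s r * dd2 E2 r s t) \<le> Q * 1"
      unfolding norm_mult using Q(1) by (intro mult_mono g1 E2b) auto
    ultimately have num: "cmod (dd2 G2 r s t * dd1 E1 s r - dd1 G1 s r * dd2 E2 r s t) \<le> 3 * Q\<^sup>2"
      using norm_triangle_ineq4[of "dd2 G2 r s t * dd1 E1 s r" "dd1 G1 s r * dd2 E2 r s t"] Q2 by linarith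
    have "1 / 12 * (1 / 12) * (1 / 12) \<le> cmod (dd1 E1 s r) * cmod (dd1 E1 t r) * cmod (dd1 E1 t s)"
      by (intro mult_mono e) auto
    then have "cmod (Delta r s t) \<le> (3 * Q\<^sup>2) / (1 / 12 * (1 / 12) * (1 / 12))"
      unfolding Delta_def norm_divide norm_mult[of "_ * _"] norm_mult[of "dd1 E1 s r"]
      using num by (intro frac_le) auto
    then show ?thesis by simp
  qed
  have "cmod (delta s r * delta t r) \<le> (12 * Q) * (12 * Q)"
    unfolding norm_mult using Q(1) by (intro mult_mono du e) auto
  then have dd: "cmod (delta s r * delta t r) \<le> 144 * Q\<^sup>2" by (simp add: power2_eq_square)
  have a11: "?A$1$1 = delta s r * delta t r - cis (F r) * Delta r s t"
    by (simp add: interp_lift_def thiele_def)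
  have "cmod (?A$1$1) \<le> cmod (delta s r * delta t r) + cmod (cis (F r) * Delta r s t)"
    unfolding a11 by (rule norm_triangle_ineq4)
  also have "\<dots> \<le> 5328 * Q\<^sup>2" using dd D by (simp add: norm_mult)
  finally have a: "cmod (?A$1$1) \<le> 5328 * Q\<^sup>2" .
  have GU: "?A \<in> GU" by (rule interp_lift_in_GU[OF L])
  then have "cmod (?A$1$2) \<le> cmod (?A$1$1)" by (auto simp: GU_def)
  then have ab: "(cmod (?A$1$1))\<^sup>2 + (cmod (?A$1$2))\<^sup>2 \<le> 2 * (5328 * Q\<^sup>2)\<^sup>2"
    using power_mono[OF a, of 2] power_mono[of "cmod (?A$1$2)" "5328 * Q\<^sup>2" 2] a by auto
  have Qi: "1 / Q > 0" using Q(1) by simp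
  have "1 / Q / 4 * (1 / Q / 4) * (1 / Q / 4) \<le> cmod (delta s r) * cmod (delta t r) * cmod (delta t s)"
    using Qi by (intro mult_mono norm_delta_ge Q(3) l) (auto intro!: mult_nonneg_nonneg)
  then have g: "gscale ?A \<ge> 1 / (64 * Q ^ 3)"
    unfolding interp_lift_properties(3)[OF L] norm_mult by (simp add: power3_eq_cube)
  have "fst (hact ?A hbase) \<le> (2 * (5328 * Q\<^sup>2)\<^sup>2) / (1 / (64 * Q ^ 3))"
    unfolding fst_hact_base using ab g Q(1) by (intro frac_le) auto
  also have "\<dots> = 128 * 5328\<^sup>2 * Q ^ 7"
    by (simp add: power_mult_distrib power2_eq_square power_add[symmetric] eval_nat_numeral)
  finally show ?thesis .
qed

end

section \<open>The continuous extension to all triples\<close>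

abbreviation cis3 :: "real \<times> real \<times> real \<Rightarrow> triple"
  where "cis3 \<equiv> \<lambda>(r, s, t). (cis r, cis s, cis t)"

definition distinct3 :: "(triple) set"
  where "distinct3 = {(a, b, c). (a, b, c) \<in> circle3 \<and> a \<noteq> b \<and> a \<noteq> c \<and> b \<noteq> c}"

text \<open>
  The branch of the argument that takes the value \<open>r\<close> at \<open>cis r\<close>.
\<close>

definition local_arg :: "real \<Rightarrow> complex \<Rightarrow> real"
  where "local_arg r a = r + Arg (a / cis r)"

definition local_lift :: "real \<times> real \<times> real \<Rightarrow> triple \<Rightarrow> real \<times> real \<times> real"
  where "local_lift = (\<lambda>(r, s, t) (a, b, c). (local_arg r a, local_arg s b, local_arg t c))"

lemma cis_local_arg:
  assumes "a \<in> circle" shows "cis (local_arg r a) = a"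
proof -
  have "cmod (a / cis r) = 1" using assms by (simp add: norm_divide)
  then have "cis (Arg (a / cis r)) = a / cis r" by (subst cis_Arg) (auto simp: sgn_eq)
  then show ?thesis by (simp add: local_arg_def cis_mult[symmetric])
qed

lemma cis3_local_lift: "x \<in> circle3 \<Longrightarrow> cis3 (local_lift p x) = x"
  by (cases x; cases p) (auto simp: local_lift_def cis_local_arg)

lemma local_arg_tendsto: "(local_arg r \<longlongrightarrow> r) (nhds (cis r))"
proof -
  have "isCont (\<lambda>a. local_arg r a) (cis r)"
    unfolding local_arg_def by (intro continuous_intros isCont_o2[OF _ continuous_at_Arg]) auto
  moreover have "local_arg r (cis r) = r" by (simp add: local_arg_def)
  ultimately show ?thesis by (simp add: isCont_def tendsto_nhds_iff)
qed

lemma local_lift_tendsto: "(local_lift p \<longlongrightarrow> p) (at (cis3 p) within X)"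
proof -
  obtain r s t where p: "p = (r, s, t)" by (metis surj_pair)
  have f: "((\<lambda>x. h (g x)) \<longlongrightarrow> l) (at (cis3 p) within X)"
    if "(h \<longlongrightarrow> l) (nhds (g (cis3 p)))" "isCont g (cis3 p)" for h :: "complex \<Rightarrow> real" and g l
    by (rule filterlim_compose[OF that(1)])
      (rule tendsto_within_subset[OF that(2)[unfolded isCont_def] subset_UNIV])
  have "((\<lambda>x. (local_arg r (fst x), local_arg s (fst (snd x)), local_arg t (snd (snd x)))) \<longlongrightarrow> (r, s, t)) (at (cis3 p) within X)"
    by (intro tendsto_Pair f) (auto simp: p local_arg_tendsto intro!: continuous_intros)
  then show ?thesis by (simp add: p local_lift_def case_prod_unfold)
qed

lemma circle_eq_cis: "z \<in> circle \<Longrightarrow> \<exists>t. z = cis t"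
  by (metis cis_local_arg)

text \<open>
  Lift the second and third point into the window of length \<open>2\<pi>\<close> around a lift of the first.
  If their lifts are more than \<open>3\<pi>/2\<close> apart, moving the lower one up by a full turn brings all
  three together.
\<close>

lemma circle3_lift:
  assumes "x \<in> circle3"
  obtains r s t where "x = cis3 (r, s, t)" "(r, s, t) \<in> lifts3"
    "\<bar>s - r\<bar> \<le> 3 * pi / 2" "\<bar>t - r\<bar> \<le> 3 * pi / 2" "\<bar>t - s\<bar> \<le> 3 * pi / 2"
proof -
  obtain a b c where x: "x = (a, b, c)" "a \<in> circle" "b \<in> circle" "c \<in> circle" using assms by auto
  obtain r where r: "a = cis r" using circle_eq_cis x by blast
  define s t where "s = local_arg r b" and "t = local_arg r c"
  have st: "cis s = b" "cis t = c" using x by (simp_all add: s_def t_def cis_local_arg)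
  have b: "- pi < s - r" "s - r \<le> pi" "- pi < t - r" "t - r \<le> pi"
    using Arg_bounded[of "b / cis r"] Arg_bounded[of "c / cis r"] by (auto simp: s_def t_def local_arg_def)
  have shift: "cis (y + 2 * pi) = cis y" for y by (simp add: cis_mult[symmetric])
  have pp: "x \<le> 3 * pi / 2 \<Longrightarrow> x < 2 * pi" for x using pi_gt_zero by linarith
  note result = that
  have fin: thesis if "cis s' = b" "cis t' = c" "\<bar>s' - r\<bar> \<le> 3 * pi / 2" "\<bar>t' - r\<bar> \<le> 3 * pi / 2" "\<bar>t' - s'\<bar> \<le> 3 * pi / 2" for s' t'
  proof (rule result[of r s' t'])
    show "(r, s', t') \<in> lifts3" using that(3-5) pp unfolding lifts3_def by blast
  qed (use that x r in auto)
  consider "\<bar>t - s\<bar> \<le> 3 * pi / 2" | "t - s > 3 * pi / 2" | "s - t > 3 * pi / 2" by linarith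
  then show ?thesis
  proof cases
    case 1
    show ?thesis by (rule fin[of s t]) (use st b 1 in linarith)+
  next
    case 2
    show ?thesis by (rule fin[of "s + 2 * pi" t]) (use st b 2 shift in \<open>simp; linarith\<close>)+
  next
    case 3
    show ?thesis by (rule fin[of s "t + 2 * pi"]) (use st b 3 shift in \<open>simp; linarith\<close>)+
  qed
qed

text \<open>
  Triples of distinct points accumulate at every triple, so limits along them are
  unique.
\<close>

lemma islimpt_distinct3:
  assumes p: "p \<in> lifts3"
  shows "at (cis3 p) within distinct3 \<noteq> bot"
proof -
  obtain r s t where p': "p = (r, s, t)" by (metis surj_pair)
  let ?x = "\<lambda>\<tau>. cis3 (r, s + \<tau>, t + 2 * \<tau>)"
  have lim: "(?x \<longlongrightarrow> cis3 p) (at (0::real))"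
  proof -
    have "continuous_on UNIV ?x" by (simp add: continuous_intros)
    then have "isCont ?x 0" by (simp add: continuous_on_eq_continuous_at)
    then show ?thesis by (simp add: isCont_def p')
  qed
  have "\<forall>\<^sub>F \<tau> in at (0::real). \<bar>\<tau>\<bar> < 2 * pi \<and> \<tau> \<noteq> 0"
    unfolding eventually_at by (intro exI[of _ "2 * pi"]) (auto simp: dist_real_def)
  then have "\<forall>\<^sub>F \<tau> in at (0::real). ?x \<tau> \<in> distinct3 \<and> ?x \<tau> \<noteq> cis3 p"
    using eventually_perturbed_distinct[OF p[unfolded p']]
  proof eventually_elim
    case (elim \<tau>)
    then have l: "\<bar>(s + \<tau>) - r\<bar> < 2 * pi" "\<bar>(t + 2 * \<tau>) - r\<bar> < 2 * pi" "\<bar>(t + 2 * \<tau>) - (s + \<tau>)\<bar> < 2 * pi"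
      "\<bar>(s + \<tau>) - s\<bar> < 2 * pi" "s + \<tau> \<noteq> s"
      unfolding lifts3_def by auto
    have "cis (s + \<tau>) \<noteq> cis r" by (rule cis_neq[OF l(1)]) (use elim in simp)
    moreover have "cis (t + 2 * \<tau>) \<noteq> cis r" by (rule cis_neq[OF l(2)]) (use elim in simp)
    moreover have "cis (t + 2 * \<tau>) \<noteq> cis (s + \<tau>)" by (rule cis_neq[OF l(3)]) (use elim in simp)
    moreover have "cis (s + \<tau>) \<noteq> cis s" by (rule cis_neq[OF l(4,5)])
    ultimately show ?case by (auto simp: distinct3_def p')
  qed
  then have f: "filterlim ?x (at (cis3 p) within distinct3) (at (0::real))"
    using lim unfolding filterlim_at by (auto elim: eventually_mono)
  show ?thesis
  proof
    assume "at (cis3 p) within distinct3 = bot"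
    then have "filtermap ?x (at (0::real)) = bot" using f by (simp add: filterlim_def bot_unique)
    then have "at (0::real) = bot" by (simp only: filtermap_bot_iff)
    then show False by simp
  qed
qed

lemma eq_on_circle3:
  fixes \<phi> \<psi> :: "triple \<Rightarrow> 'a::t2_space"
  assumes "continuous_on circle3 \<phi>" "continuous_on circle3 \<psi>"
    and eq: "\<And>x. x \<in> distinct3 \<Longrightarrow> \<phi> x = \<psi> x" and x: "x \<in> circle3"
  shows "\<phi> x = \<psi> x"
proof -
  obtain p where p: "x = cis3 p" "p \<in> lifts3" using circle3_lift[OF x] by metis
  have sub: "distinct3 \<subseteq> circle3" by (auto simp: distinct3_def)
  have lim: "(h \<longlongrightarrow> h x) (at x within distinct3)" if "continuous_on circle3 h" for h :: "triple \<Rightarrow> 'a"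
    using that x tendsto_within_subset[OF _ sub] unfolding continuous_on_def by blast
  have "\<forall>\<^sub>F y in at x within distinct3. \<phi> y = \<psi> y"
    using eq by (auto simp: eventually_at_filter)
  then have "(\<phi> \<longlongrightarrow> \<psi> x) (at x within distinct3)"
    using lim[OF assms(2)] tendsto_cong by blast
  moreover have "at x within distinct3 \<noteq> bot" unfolding p(1) by (rule islimpt_distinct3[OF p(2)])
  ultimately show ?thesis using lim[OF assms(1)] tendsto_unique by blast
qed

text \<open>
  Taking the limit by definition avoids the choice of a lift of \<open>f\<close> and of
  lifts of the points.
\<close>

definition interp :: "(complex \<Rightarrow> complex) \<Rightarrow> triple \<Rightarrow> complex^2^2"
  where "interp f x = Lim (at x within distinct3) (interp_mat f)"

context circle_lift
begin

lemma interp_lift_local_lift_tendsto: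
  assumes "p \<in> lifts3"
  shows "((\<lambda>x. interp_lift (local_lift p x)) \<longlongrightarrow> interp_lift p) (at (cis3 p) within X)"
    and "\<forall>\<^sub>F x in at (cis3 p) within X. local_lift p x \<in> lifts3"
proof -
  have "isCont interp_lift p"
    using assms continuous_on_interp_lift open_lifts3 continuous_on_eq_continuous_at by blast
  then show "((\<lambda>x. interp_lift (local_lift p x)) \<longlongrightarrow> interp_lift p) (at (cis3 p) within X)"
    by (rule isCont_tendsto_compose) (rule local_lift_tendsto)
  show "\<forall>\<^sub>F x in at (cis3 p) within X. local_lift p x \<in> lifts3"
    by (rule topological_tendstoD[OF local_lift_tendsto open_lifts3 assms])
qed

context
  fixes f assumes f: "\<And>t. f (cis t) = cis (F t)"
begin

lemma interp_lift_interp_mat: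
  assumes "p \<in> lifts3" "cis3 p \<in> distinct3"
  shows "interp_lift p = interp_mat f (cis3 p)"
  using assms interp_lift_eq[OF f] by (cases p) (auto simp: distinct3_def)

lemma interp_cis3:
  assumes p: "p \<in> lifts3"
  shows "interp f (cis3 p) = interp_lift p"
proof -
  have "\<forall>\<^sub>F x in at (cis3 p) within distinct3. x \<in> distinct3" by (simp add: eventually_at_filter)
  then have "\<forall>\<^sub>F x in at (cis3 p) within distinct3. interp_lift (local_lift p x) = interp_mat f x"
    using interp_lift_local_lift_tendsto(2)[OF p, of distinct3]
  proof eventually_elim
    case (elim x)
    then have "x \<in> circle3" by (auto simp: distinct3_def)
    then have "cis3 (local_lift p x) = x" by (rule cis3_local_lift)
    then show ?case using interp_lift_interp_mat[of "local_lift p x"] elim by metis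
  qed
  then have "(interp_mat f \<longlongrightarrow> interp_lift p) (at (cis3 p) within distinct3)"
    by (rule Lim_transform_eventually[OF interp_lift_local_lift_tendsto(1)[OF p]])
  then show ?thesis unfolding interp_def by (rule tendsto_Lim[OF islimpt_distinct3[OF p]])
qed

lemma continuous_on_interp: "continuous_on circle3 (interp f)"
  unfolding continuous_on_def
proof
  fix x assume "x \<in> circle3"
  then obtain p where p: "x = cis3 p" "p \<in> lifts3" using circle3_lift by metis
  have "\<forall>\<^sub>F y in at x within circle3. y \<in> circle3" by (simp add: eventually_at_filter)
  then have "\<forall>\<^sub>F y in at x within circle3. interp_lift (local_lift p y) = interp f y"
    using interp_lift_local_lift_tendsto(2)[OF p(2), of circle3] unfolding p(1)
    by eventually_elim (metis cis3_local_lift interp_cis3)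
  then show "(interp f \<longlongrightarrow> interp f x) (at x within circle3)"
    using Lim_transform_eventually[OF interp_lift_local_lift_tendsto(1)[OF p(2)]] interp_cis3[OF p(2)]
    unfolding p(1) by simp
qed

lemma continuous_on_circle_map: "continuous_on circle f"
  unfolding continuous_on_def
proof
  fix z assume "z \<in> circle"
  then obtain r where r: "z = cis r" using circle_eq_cis by blast
  have "isCont (\<lambda>t. cis (F t)) r"
    using continuous_on_cis[OF F_cont[of UNIV]] by (simp add: continuous_on_eq_continuous_at)
  then have lim: "((\<lambda>y. cis (F (local_arg r y))) \<longlongrightarrow> cis (F r)) (at z within circle)"
    using tendsto_mono[OF at_within_le_nhds local_arg_tendsto] unfolding r by (rule isCont_tendsto_compose)
  have "\<forall>\<^sub>F y in at z within circle. y \<in> circle" by (simp add: eventually_at_filter)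
  then have "\<forall>\<^sub>F y in at z within circle. cis (F (local_arg r y)) = f y"
    by eventually_elim (metis f cis_local_arg)
  then show "(f \<longlongrightarrow> f z) (at z within circle)"
    using Lim_transform_eventually[OF lim] by (simp add: r f)
qed

lemma interp_distinct:
  assumes "x \<in> distinct3" shows "interp f x = interp_mat f x"
proof -
  have "x \<in> circle3" using assms by (auto simp: distinct3_def)
  then obtain p where "x = cis3 p" "p \<in> lifts3" using circle3_lift by metis
  then show ?thesis using interp_cis3 interp_lift_interp_mat assms by metis
qed

lemma interp_in_GU:
  assumes "x \<in> circle3" shows "interp f x \<in> GU"
proof -
  obtain r s t where "x = cis3 (r, s, t)" "(r, s, t) \<in> lifts3" using circle3_lift[OF assms] by metis
  then show ?thesis using interp_cis3 interp_lift_in_GU by metis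
qed

lemma fst_hact_interp_le:
  assumes "Q \<ge> 1" "\<And>t. F' t \<le> Q" "\<And>t. F' t \<ge> 1 / Q" "\<And>t. \<bar>F'' t\<bar> \<le> Q" and x: "x \<in> circle3"
  shows "fst (hact (interp f x) hbase) \<le> 128 * 5328\<^sup>2 * Q ^ 7"
proof -
  obtain r s t where p: "x = cis3 (r, s, t)" "(r, s, t) \<in> lifts3"
    "\<bar>s - r\<bar> \<le> 3 * pi / 2" "\<bar>t - r\<bar> \<le> 3 * pi / 2" "\<bar>t - s\<bar> \<le> 3 * pi / 2"
    using circle3_lift[OF x] by metis
  show ?thesis unfolding p(1) interp_cis3[OF p(2)] by (rule fst_hact_interp_lift_le) (use assms p in auto)
qed

end

end

definition C2_liftable :: "(complex \<Rightarrow> complex) \<Rightarrow> bool"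
  where "C2_liftable f \<longleftrightarrow> (\<exists>F F' F''. circle_lift F F' F'' \<and> (\<forall>t. f (cis t) = cis (F t)))"

lemma C2_liftableE:
  assumes "C2_liftable f"
  obtains F F' F'' where "circle_lift F F' F''" "\<forall>t. f (cis t) = cis (F t)"
  using assms unfolding C2_liftable_def by blast

lemma C2_liftableD:
  assumes "C2_liftable f"
  shows "continuous_on circle3 (interp f)" "continuous_on circle f"
    "x \<in> distinct3 \<Longrightarrow> interp f x = interp_mat f x" "x \<in> circle3 \<Longrightarrow> interp f x \<in> GU"
    "z \<in> circle \<Longrightarrow> f z \<in> circle" "x \<in> circle3 \<Longrightarrow> diag_act f x \<in> circle3"
proof -
  obtain F F' F'' where F1: "circle_lift F F' F''" and "\<forall>t. f (cis t) = cis (F t)"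
    by (rule C2_liftableE[OF assms])
  then have F2: "f (cis t) = cis (F t)" for t by blast
  note F = F1 F2
  interpret circle_lift F F' F'' by (rule F(1))
  show "continuous_on circle3 (interp f)" "continuous_on circle f"
    "x \<in> distinct3 \<Longrightarrow> interp f x = interp_mat f x" "x \<in> circle3 \<Longrightarrow> interp f x \<in> GU"
    using continuous_on_interp[OF F(2)] continuous_on_circle_map[OF F(2)] interp_distinct[OF F(2)] interp_in_GU[OF F(2)]
    by auto
  show c: "f z \<in> circle" if "z \<in> circle" for z using circle_eq_cis[OF that] F(2) by auto
  show "x \<in> circle3 \<Longrightarrow> diag_act f x \<in> circle3" using c by (auto simp: diag_act_def)
qed

text \<open>
  The exact cocycle relation holds for distinct points and extends by density.
\<close>

lemma interp_compose:
  assumes f: "C2_liftable f" "inj_on f circle" and g: "C2_liftable g" and h: "C2_liftable h"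
    and hgf: "\<And>z. z \<in> circle \<Longrightarrow> h z = g (f z)" and x: "x \<in> circle3"
  shows "interp h x = interp g (diag_act f x) ** interp f x"
proof (rule eq_on_circle3[OF _ _ _ x])
  show "continuous_on circle3 (interp h)" by (rule C2_liftableD[OF h])
  have fc: "continuous_on circle3 (\<lambda>x. f (k x))" if "continuous_on circle3 k" "\<And>x. x \<in> circle3 \<Longrightarrow> k x \<in> circle" for k
    by (rule continuous_on_compose2[OF C2_liftableD(2)[OF f(1)] that(1)]) (use that(2) in auto)
  have "continuous_on circle3 (diag_act f)"
    unfolding diag_act_def case_prod_unfold by (intro continuous_on_Pair fc continuous_intros) auto
  then have G: "continuous_on circle3 (\<lambda>x. interp g (diag_act f x))"
    by (rule continuous_on_compose2[OF C2_liftableD(1)[OF g]]) (use C2_liftableD(6)[OF f(1)] in blast)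
  have M: "continuous_on circle3 (\<lambda>x. A x ** B x)"
    if "continuous_on circle3 A" "continuous_on circle3 B" for A B :: "_ \<Rightarrow> complex^2^2"
    unfolding matrix_matrix_mult_def
    by (intro continuous_on_vec_lambda continuous_on_sum continuous_on_mult continuous_on_component that)
  show "continuous_on circle3 (\<lambda>x. interp g (diag_act f x) ** interp f x)"
    by (intro M G C2_liftableD(1)[OF f(1)])
  fix x assume x: "x \<in> distinct3"
  obtain a b c where abc: "x = (a, b, c)" "a \<in> circle" "b \<in> circle" "c \<in> circle" "a \<noteq> b" "a \<noteq> c" "b \<noteq> c"
    using x by (auto simp: distinct3_def)
  have ne: "f a \<noteq> f b" "f a \<noteq> f c" "f b \<noteq> f c" using f(2) abc by (auto dest: inj_onD)
  then have "diag_act f x \<in> distinct3"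
    using abc C2_liftableD(5)[OF f(1)] by (auto simp: diag_act_def distinct3_def)
  then have "interp g (diag_act f x) = interp_mat g (f a, f b, f c)"
    using C2_liftableD(3)[OF g] by (simp add: diag_act_def abc)
  moreover have "interp_mat h (a, b, c) = interp_mat g (f a, f b, f c) ** interp_mat f (a, b, c)"
    using abc ne hgf by (intro interp_mat_mult) auto
  ultimately show "interp h x = interp g (diag_act f x) ** interp f x"
    using C2_liftableD(3)[OF h x] C2_liftableD(3)[OF f(1) x] by (simp add: abc)
qed

section \<open>The enlarged projective cocycle\<close>

lemma quadratic_three_roots:
  fixes p q r :: complex
  assumes "a \<noteq> b" "a \<noteq> c" "b \<noteq> c"
    and "p * a\<^sup>2 + q * a + r = 0" "p * b\<^sup>2 + q * b + r = 0" "p * c\<^sup>2 + q * c + r = 0"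
  shows "p * z\<^sup>2 + q * z + r = 0"
proof -
  have "(a - b) * (p * (a + b) + q) = 0" using assms(4,5) by algebra
  moreover have "(a - c) * (p * (a + c) + q) = 0" using assms(4,6) by algebra
  ultimately have 1: "p * (a + b) + q = 0" "p * (a + c) + q = 0" using assms by auto
  then have "p * (b - c) = 0" by algebra
  then have "p = 0" using assms by simp
  then show ?thesis using 1 assms by simp
qed

text \<open>
  Equality of two fractional linear maps at a point is a quadratic equation, which
  vanishes identically once it has three roots.
\<close>

lemma moebius_eqI:
  assumes "g \<in> moebius" "h \<in> moebius" "a \<in> circle" "b \<in> circle" "c \<in> circle" "a \<noteq> b" "a \<noteq> c" "b \<noteq> c"
    and "g a = h a" "g b = h b" "g c = h c"
  shows "g = h"
proof -
  obtain A B where A: "A \<in> GU" "g = mob A" and B: "B \<in> GU" "h = mob B"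
    using assms unfolding moebius_eq_image_GU by blast
  define p q r where "p = A$1$1 * B$2$1 - B$1$1 * A$2$1"
    and "q = A$1$1 * B$2$2 + A$1$2 * B$2$1 - B$1$1 * A$2$2 - B$1$2 * A$2$1"
    and "r = A$1$2 * B$2$2 - B$1$2 * A$2$2"
  have iff: "mob A z = mob B z \<longleftrightarrow> p * z\<^sup>2 + q * z + r = 0" if "z \<in> circle" for z
  proof -
    have "mob A z = mob B z \<longleftrightarrow>
      (A$1$1 * z + A$1$2) * (B$2$1 * z + B$2$2) = (B$1$1 * z + B$1$2) * (A$2$1 * z + A$2$2)"
      using mob_denominator_nonzero[OF A(1) that] mob_denominator_nonzero[OF B(1) that] that
      by (simp add: mob_def frac_eq_eq)
    also have "\<dots> \<longleftrightarrow> p * z\<^sup>2 + q * z + r = 0"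
      unfolding p_def q_def r_def by (subst eq_iff_diff_eq_0) (simp add: power2_eq_square algebra_simps)
    finally show ?thesis .
  qed
  have "p * a\<^sup>2 + q * a + r = 0" "p * b\<^sup>2 + q * b + r = 0" "p * c\<^sup>2 + q * c + r = 0"
    using iff assms A B by blast+
  then have "p * z\<^sup>2 + q * z + r = 0" for z using quadratic_three_roots assms by blast
  then have "mob A z = mob B z" for z using iff[of z] by (cases "z \<in> circle") (auto simp: mob_def)
  then show ?thesis using A B by auto
qed

lemma three_point_moebius_eq:
  assumes f: "C2_liftable f" "inj_on f circle" and x: "x \<in> distinct3"
  shows "three_point_moebius f x = mob (interp f x)"
proof -
  obtain a b c where abc: "x = (a, b, c)" "a \<in> circle" "b \<in> circle" "c \<in> circle" "a \<noteq> b" "a \<noteq> c" "b \<noteq> c"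
    using x by (auto simp: distinct3_def)
  have x3: "x \<in> circle3" using abc by simp
  have ne: "f a \<noteq> f b" "f a \<noteq> f c" "f b \<noteq> f c" using f(2) abc by (auto dest: inj_onD)
  then have dq: "dquot f b c \<noteq> 0" "dquot f a c \<noteq> 0" "dquot f a b \<noteq> 0" using abc by (auto simp: dquot_def)
  have A: "interp f x = interp_mat f (a, b, c)" using C2_liftableD(3)[OF f(1) x] abc by simp
  have "mob (interp f x) a = f a" "mob (interp f x) b = f b" "mob (interp f x) c = f c"
    unfolding A mob_def using abc dq interp_mat_apply[of a b c f] by simp_all
  then have d: "diag_act (mob (interp f x)) x = diag_act f x" by (simp add: diag_act_def abc)
  show ?thesis
    unfolding three_point_moebius_def
  proof (rule the_equality)
    show "mob (interp f x) \<in> moebius \<and> diag_act (mob (interp f x)) x = diag_act f x"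
      using d C2_liftableD(4)[OF f(1) x3] by (simp add: moebius_eq_image_GU)
    fix g assume g: "g \<in> moebius \<and> diag_act g x = diag_act f x"
    show "g = mob (interp f x)"
      using g d C2_liftableD(4)[OF f(1) x3]
      by (intro moebius_eqI[OF _ _ abc(2-7)]) (auto simp: moebius_eq_image_GU diag_act_def abc)
  qed
qed

text \<open>
  Distinct triples are dense and the Moebius group is Hausdorff, so the continuous extension
  is unique, and the interpolation matrices provide one.
\<close>

lemma enlarged_cocycle_eq:
  assumes f: "C2_liftable f" "inj_on f circle" and haus: "Hausdorff_space moebius_topology"
    and x: "x \<in> circle3"
  shows "enlarged_cocycle f x = mob (interp f x)"
proof -
  define M where "M = restrict (\<lambda>x. mob (interp f x)) circle3"
  have Mc: "continuous_map (top_of_set circle3) moebius_topology M"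
    unfolding M_def
    by (rule continuous_map_eq[OF continuous_map_mob[OF C2_liftableD(1)[OF f(1)]]]) (use C2_liftableD(4)[OF f(1)] in auto)
  have dist: "(a, b, c) \<in> distinct3" if "a \<in> circle" "b \<in> circle" "c \<in> circle" "distinct [a, b, c]" for a b c
    using that by (auto simp: distinct3_def)
  have "enlarged_cocycle f = M"
    unfolding enlarged_cocycle_def
  proof (rule the_equality)
    have "M (a, b, c) = three_point_moebius f (a, b, c)"
      if "a \<in> circle" "b \<in> circle" "c \<in> circle" "distinct [a, b, c]" for a b c
      using three_point_moebius_eq[OF f dist[OF that]] that by (simp add: M_def)
    then show "M \<in> extensional circle3 \<and> continuous_map (top_of_set circle3) moebius_topology M \<and>
       (\<forall>a\<in>circle. \<forall>b\<in>circle. \<forall>c\<in>circle. distinct [a, b, c] \<longrightarrow> M (a, b, c) = three_point_moebius f (a, b, c))"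
      using Mc by (auto simp: M_def)
    fix M' assume M': "M' \<in> extensional circle3 \<and> continuous_map (top_of_set circle3) moebius_topology M' \<and>
       (\<forall>a\<in>circle. \<forall>b\<in>circle. \<forall>c\<in>circle. distinct [a, b, c] \<longrightarrow> M' (a, b, c) = three_point_moebius f (a, b, c))"
    have eq: "M' y = M y" if "y \<in> distinct3" for y
    proof -
      have "M' y = three_point_moebius f y" "y \<in> circle3" using M' that by (auto simp: distinct3_def)
      then show ?thesis using three_point_moebius_eq[OF f that] by (simp add: M_def)
    qed
    show "M' = M"
    proof
      fix y
      show "M' y = M y"
      proof (cases "y \<in> circle3")
        case True
        then obtain p where p: "y = cis3 p" "p \<in> lifts3" using circle3_lift by metis
        have "y islimpt distinct3"
          using islimpt_distinct3[OF p(2)] unfolding p(1) trivial_limit_within by simp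
        then have "y \<in> closure distinct3" by (simp add: closure_def)
        moreover have "circle3 \<inter> distinct3 = distinct3" by (auto simp: distinct3_def)
        ultimately have "y \<in> ((top_of_set circle3) closure_of distinct3)"
          unfolding closure_of_subtopology using True by simp
        then show ?thesis
          by (rule forall_in_closure_of_eq[OF _ haus _ Mc]) (use M' eq in auto)
      next
        case False
        then have "M' y = undefined" using M' by (intro extensional_arb[of _ circle3]) blast+
        then show ?thesis by (simp only: M_def restrict_apply False if_False)
      qed
    qed
  qed
  then show ?thesis using x by (simp add: M_def)
qed

section \<open>Means along powers of an isometry\<close>

text \<open>
  Midpoints with the convexity of nonpositively curved metrics. Only upper bounds of distances
  are used, so a relation \<open>near c\<close> replaces the metric; for sections it is a uniform bound, with no supremum to
  be handled.
\<close>

locale midpoint_space =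
  fixes E :: "'e set" and mid :: "'e \<Rightarrow> 'e \<Rightarrow> 'e" and near :: "real \<Rightarrow> 'e \<Rightarrow> 'e \<Rightarrow> bool"
  assumes mid_in: "\<phi> \<in> E \<Longrightarrow> \<psi> \<in> E \<Longrightarrow> mid \<phi> \<psi> \<in> E"
    and mid_commute: "mid \<phi> \<psi> = mid \<psi> \<phi>"
    and near_refl: "\<phi> \<in> E \<Longrightarrow> near 0 \<phi> \<phi>"
    and near_mid: "\<phi> \<in> E \<Longrightarrow> \<psi> \<in> E \<Longrightarrow> \<phi>' \<in> E \<Longrightarrow> \<psi>' \<in> E \<Longrightarrow>
      near c \<phi> \<phi>' \<Longrightarrow> near d \<psi> \<psi>' \<Longrightarrow> near ((c + d) / 2) (mid \<phi> \<psi>) (mid \<phi>' \<psi>')"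
begin

definition mid_isometry :: "('e \<Rightarrow> 'e) \<Rightarrow> bool"
  where "mid_isometry U \<longleftrightarrow> (\<forall>\<phi>\<in>E. U \<phi> \<in> E) \<and> (\<forall>\<phi>\<in>E. \<forall>\<psi>\<in>E. U (mid \<phi> \<psi>) = mid (U \<phi>) (U \<psi>)) \<and>
    (\<forall>c. \<forall>\<phi>\<in>E. \<forall>\<psi>\<in>E. near c \<phi> \<psi> \<longrightarrow> near c (U \<phi>) (U \<psi>))"

lemma mid_isometryD:
  assumes "mid_isometry U" "\<phi> \<in> E"
  shows "U \<phi> \<in> E" "\<psi> \<in> E \<Longrightarrow> U (mid \<phi> \<psi>) = mid (U \<phi>) (U \<psi>)"
    "\<psi> \<in> E \<Longrightarrow> near c \<phi> \<psi> \<Longrightarrow> near c (U \<phi>) (U \<psi>)"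
  using assms unfolding mid_isometry_def by blast+

lemma mid_isometry_comp: "mid_isometry U \<Longrightarrow> mid_isometry V \<Longrightarrow> mid_isometry (U \<circ> V)"
  unfolding mid_isometry_def by simp

lemma mid_isometry_funpow: "mid_isometry U \<Longrightarrow> mid_isometry (U ^^ n)"
  by (induction n) (simp_all add: mid_isometry_comp, simp add: mid_isometry_def)

text \<open>
  A mean of \<open>\<phi>, U \<phi>, ..., U\<^bsup>N-1\<^esup> \<phi>\<close> with \<open>N = 2\<^sup>k\<close>: the means over the even and over the odd
  powers differ by \<open>U\<close>, and their midpoint is taken.
\<close>

primrec power_mean :: "nat \<Rightarrow> ('e \<Rightarrow> 'e) \<Rightarrow> 'e \<Rightarrow> 'e"
  where "power_mean 0 U \<phi> = \<phi>"
  | "power_mean (Suc k) U \<phi> = mid (power_mean k (U \<circ> U) \<phi>) (U (power_mean k (U \<circ> U) \<phi>))"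

lemma power_mean_in: "mid_isometry U \<Longrightarrow> \<phi> \<in> E \<Longrightarrow> power_mean k U \<phi> \<in> E"
  by (induction k arbitrary: U) (auto simp: mid_in mid_isometryD mid_isometry_comp)

lemma near_power_mean:
  "mid_isometry U \<Longrightarrow> \<phi> \<in> E \<Longrightarrow> \<psi> \<in> E \<Longrightarrow> near c \<phi> \<psi> \<Longrightarrow>
    near c (power_mean k U \<phi>) (power_mean k U \<psi>)"
proof (induction k arbitrary: U)
  case (Suc k)
  let ?A = "power_mean k (U \<circ> U) \<phi>" and ?B = "power_mean k (U \<circ> U) \<psi>"
  have UU: "mid_isometry (U \<circ> U)" using Suc.prems(1) by (simp add: mid_isometry_comp)
  then have in_E: "?A \<in> E" "?B \<in> E" using Suc.prems by (simp_all add: power_mean_in)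
  have n: "near c ?A ?B" using Suc UU by simp
  then have "near c (U ?A) (U ?B)" using Suc.prems in_E mid_isometryD by blast
  then have "near ((c + c) / 2) (mid ?A (U ?A)) (mid ?B (U ?B))"
    using Suc.prems in_E n by (intro near_mid) (auto simp: mid_isometryD)
  then show ?case by simp
qed simp

lemma power_mean_commute:
  "mid_isometry U \<Longrightarrow> mid_isometry W \<Longrightarrow> U \<circ> W = W \<circ> U \<Longrightarrow> \<phi> \<in> E \<Longrightarrow>
    W (power_mean k U \<phi>) = power_mean k U (W \<phi>)"
proof (induction k arbitrary: U)
  case (Suc k)
  have UU: "mid_isometry (U \<circ> U)" using Suc.prems(1) by (simp add: mid_isometry_comp)
  have "(U \<circ> U) \<circ> W = W \<circ> (U \<circ> U)" using Suc.prems(3) by (metis comp_assoc)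
  then have IH: "W (power_mean k (U \<circ> U) \<phi>) = power_mean k (U \<circ> U) (W \<phi>)"
    using Suc.IH[OF UU] Suc.prems by blast
  have c: "W (U x) = U (W x)" for x using Suc.prems(3) by (metis comp_apply)
  have "power_mean k (U \<circ> U) \<phi> \<in> E" using UU Suc.prems by (simp add: power_mean_in)
  then show ?case using Suc.prems IH by (simp add: mid_isometryD c)
qed simp

text \<open>
  By induction \<open>U \<circ> U\<close> moves the mean \<open>A\<close> over the even powers by at most \<open>c / 2\<^sup>k\<close>. The
  image of the midpoint of \<open>A\<close> and \<open>U A\<close> is the midpoint of \<open>U A\<close> and \<open>U (U A)\<close>, so convexity
  halves this bound.
\<close>

lemma power_mean_almost_invariant:
  "mid_isometry U \<Longrightarrow> \<phi> \<in> E \<Longrightarrow> near c ((U ^^ (2 ^ k)) \<phi>) \<phi> \<Longrightarrow>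
    near (c / 2 ^ k) (U (power_mean k U \<phi>)) (power_mean k U \<phi>)"
proof (induction k arbitrary: U)
  case (Suc k)
  let ?A = "power_mean k (U \<circ> U) \<phi>"
  have UU: "mid_isometry (U \<circ> U)" using Suc.prems(1) by (simp add: mid_isometry_comp)
  then have A: "?A \<in> E" using Suc.prems by (simp add: power_mean_in)
  have "(U \<circ> U) ^^ (2 ^ k) = U ^^ (2 ^ Suc k)"
    using funpow_mult[of "2 ^ k" 2 U] by (simp add: numeral_2_eq_2)
  then have "near c (((U \<circ> U) ^^ (2 ^ k)) \<phi>) \<phi>" using Suc.prems by simp
  from Suc.IH[OF UU Suc.prems(2) this] have "near (c / 2 ^ k) (U (U ?A)) ?A"
    unfolding comp_def .
  then have "near ((0 + c / 2 ^ k) / 2) (mid (U ?A) (U (U ?A))) (mid (U ?A) ?A)"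
    using A Suc.prems by (intro near_mid) (auto simp: near_refl mid_isometryD)
  moreover have "U (mid ?A (U ?A)) = mid (U ?A) (U (U ?A))"
    using A Suc.prems by (simp add: mid_isometryD)
  ultimately show ?case using mid_commute by (simp add: field_simps)
qed simp

lemma foldr_power_mean_in:
  "(\<And>U. U \<in> set Us \<Longrightarrow> mid_isometry U) \<Longrightarrow> \<phi> \<in> E \<Longrightarrow> foldr (power_mean k) Us \<phi> \<in> E"
  by (induction Us) (auto simp: power_mean_in)

lemma near_foldr_power_mean:
  "(\<And>U. U \<in> set Us \<Longrightarrow> mid_isometry U) \<Longrightarrow> \<phi> \<in> E \<Longrightarrow> \<psi> \<in> E \<Longrightarrow> near c \<phi> \<psi> \<Longrightarrow>
    near c (foldr (power_mean k) Us \<phi>) (foldr (power_mean k) Us \<psi>)"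
  by (induction Us) (auto simp: near_power_mean foldr_power_mean_in)

lemma foldr_power_mean_commute:
  assumes "\<And>U. U \<in> set Us \<Longrightarrow> mid_isometry U" and W: "mid_isometry W"
    and "\<And>U. U \<in> set Us \<Longrightarrow> U \<circ> W = W \<circ> U" and "\<phi> \<in> E"
  shows "W (foldr (power_mean k) Us \<phi>) = foldr (power_mean k) Us (W \<phi>)"
  using assms
proof (induction Us)
  case (Cons V Us)
  have F: "foldr (power_mean k) Us \<phi> \<in> E"
    using Cons.prems by (intro foldr_power_mean_in) auto
  have V: "mid_isometry V" and VW: "V \<circ> W = W \<circ> V"
    by (meson Cons.prems(1,3) list.set_intros(1))+
  have "W (foldr (power_mean k) Us \<phi>) = foldr (power_mean k) Us (W \<phi>)"
    using Cons.prems by (intro Cons.IH) auto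
  then show ?case using power_mean_commute[OF V W VW F] by simp
qed simp

text \<open>
  Averaging over the other isometries commutes with \<open>U\<close> and does not expand distances. So it
  preserves an almost invariance achieved before, and it does not increase the displacement by \<open>U\<^sup>N\<close>
  that enters the averaging over \<open>U\<close>.
\<close>

lemma joint_almost_invariant:
  assumes "\<And>U. U \<in> set Us \<Longrightarrow> mid_isometry U"
    and "\<And>U V. U \<in> set Us \<Longrightarrow> V \<in> set Us \<Longrightarrow> U \<circ> V = V \<circ> U"
    and "\<phi> \<in> E" and "U \<in> set Us" and "near c ((U ^^ (2 ^ k)) \<phi>) \<phi>"
  shows "near (c / 2 ^ k) (U (foldr (power_mean k) Us \<phi>)) (foldr (power_mean k) Us \<phi>)"
  using assms
proof (induction Us)
  case (Cons V Us)
  let ?F = "foldr (power_mean k) Us"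
  have F: "?F \<phi> \<in> E" using Cons.prems by (intro foldr_power_mean_in) auto
  have U: "mid_isometry U" and V: "mid_isometry V" using Cons.prems by auto
  show ?case
  proof (cases "U \<in> set Us")
    case True
    then have "near (c / 2 ^ k) (U (?F \<phi>)) (?F \<phi>)" using Cons by simp
    then have "near (c / 2 ^ k) (power_mean k V (U (?F \<phi>))) (power_mean k V (?F \<phi>))"
      using F U V by (simp add: near_power_mean mid_isometryD)
    moreover have "U (power_mean k V (?F \<phi>)) = power_mean k V (U (?F \<phi>))"
      by (rule power_mean_commute[OF V U _ F]) (use Cons.prems(2,4) in \<open>meson list.set_intros(1)\<close>)
    ultimately show ?thesis by simp
  next
    case False
    then have UV: "U = V" using Cons.prems by simp
    have comm: "W \<circ> (U ^^ n) = (U ^^ n) \<circ> W" if "W \<in> set Us" for W n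
    proof (induction n)
      case (Suc n)
      have "W \<circ> U = U \<circ> W" by (rule Cons.prems(2)) (use that Cons.prems(4) in simp_all)
      then show ?case using Suc by (metis comp_assoc funpow.simps(2))
    qed simp
    have Un: "mid_isometry (U ^^ (2 ^ k))" using U by (rule mid_isometry_funpow)
    have "(U ^^ (2 ^ k)) (?F \<phi>) = ?F ((U ^^ (2 ^ k)) \<phi>)"
      using Cons.prems Un comm by (intro foldr_power_mean_commute) auto
    moreover have "near c (?F ((U ^^ (2 ^ k)) \<phi>)) (?F \<phi>)"
      using Cons.prems Un by (intro near_foldr_power_mean) (auto simp: mid_isometryD)
    ultimately have "near c ((U ^^ (2 ^ k)) (?F \<phi>)) (?F \<phi>)" by simp
    then show ?thesis using F U UV by (simp add: power_mean_almost_invariant)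
  qed
qed simp

end

section \<open>Lifts of diffeomorphisms\<close>

text \<open>
  A continuous function with values in the discrete set \<open>2\<pi>\<int>\<close> is constant.
\<close>

lemma cis_eq_1_const:
  fixes h :: "real \<Rightarrow> real"
  assumes "continuous_on UNIV h" "\<And>t. cis (h t) = 1"
  obtains k :: int where "\<And>t. h t = 2 * pi * of_int k"
proof -
  have int: "\<exists>k::int. h t = 2 * pi * of_int k" for t
  proof -
    have "cos (h t) = 1" using assms(2)[of t] by (simp add: complex_eq_iff)
    then obtain k :: int where "h t = of_int k * 2 * pi" by (auto simp: cos_one_2pi_int)
    then show ?thesis by (intro exI[of _ k]) simp
  qed
  have "h constant_on UNIV"
  proof (rule continuous_discrete_range_constant[OF connected_UNIV assms(1)])
    fix x :: real
    have "2 * pi \<le> norm (h y - h x)" if "h y \<noteq> h x" for y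
    proof -
      obtain k l :: int where kl: "h y = 2 * pi * of_int k" "h x = 2 * pi * of_int l" using int by metis
      then have "k \<noteq> l" using that by auto
      then have "1 \<le> \<bar>of_int (k - l) :: real\<bar>" by linarith
      moreover have "norm (h y - h x) = 2 * pi * \<bar>of_int (k - l)\<bar>"
        unfolding kl by (simp add: abs_mult flip: right_diff_distrib)
      ultimately show ?thesis by simp
    qed
    then show "\<exists>e>0. \<forall>y. y \<in> UNIV \<and> h y \<noteq> h x \<longrightarrow> e \<le> norm (h y - h x)"
      by (intro exI[of _ "2 * pi"]) auto
  qed
  then obtain c where c: "\<And>t. h t = c" by (auto simp: constant_on_def)
  then show ?thesis using int[of 0] that by metis
qed

lemma cis_eq_shift:
  fixes h k :: "real \<Rightarrow> real"
  assumes "continuous_on UNIV h" "continuous_on UNIV k" "\<And>t. cis (h t) = cis (k t)"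
  obtains m :: int where "\<And>t. h t = k t + 2 * pi * of_int m"
proof -
  have c: "continuous_on UNIV (\<lambda>t. h t - k t)" by (intro continuous_intros assms)
  have 1: "cis (h t - k t) = 1" for t using assms(3)[of t] by (simp add: cis_divide[symmetric])
  obtain m :: int where "\<And>t. h t - k t = 2 * pi * of_int m"
    using cis_eq_1_const[OF c 1] by blast
  then have "h t = k t + 2 * pi * of_int m" for t by (simp add: diff_eq_eq add.commute)
  then show ?thesis using that by blast
qed

text \<open>
  The lift \<open>F\<close> that is \<open>C\<^sup>2\<close> differs by a constant from the one that is increasing. The inverse
  has a \<open>C\<^sup>2\<close> lift \<open>G\<close>, and \<open>G \<circ> F\<close> is a translation: this forces \<open>F' \<noteq> 0\<close>, and it makes the degrees of
  \<open>F\<close> and \<open>G\<close> multiply to \<open>1\<close>.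
\<close>

lemma C2_diffeo_liftable:
  assumes "f \<in> C2_diffeos"
  shows "C2_liftable f"
proof -
  interpret group circle_group by (rule group_BijGroup)
  define g where "g = cinv f"
  have f: "f \<in> carrier circle_group" "C2_circle f" "C2_circle g" "orientation_preserving f"
    using assms by (auto simp: C2_diffeos_def g_def)
  have g: "g \<in> carrier circle_group" unfolding g_def using f(1) by simp
  have "g \<cdot> f = cone" unfolding g_def using f(1) by simp
  then have gf_one: "compose circle g f = (\<lambda>x\<in>circle. x)" using f(1) g by (simp add: BijGroup_def)
  have gf: "g (f z) = z" if "z \<in> circle" for z
    using fun_cong[OF gf_one, of z] that by (simp only: compose_eq restrict_apply if_True)
  obtain F F' F'' where F: "continuous_on UNIV F" "\<And>t. f (cis t) = cis (F t)"
    "\<And>t. (F has_real_derivative F' t) (at t)" "\<And>t. (F' has_real_derivative F'' t) (at t)" "continuous_on UNIV F''"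
    using f(2) unfolding C2_circle_def is_lift_def C2_real_def by blast
  obtain G G' where G: "continuous_on UNIV G" "\<And>t. g (cis t) = cis (G t)"
    "\<And>t. (G has_real_derivative G' t) (at t)"
    using f(3) unfolding C2_circle_def is_lift_def C2_real_def by blast
  obtain H where H: "continuous_on UNIV H" "\<And>t. f (cis t) = cis (H t)" "strict_mono H"
    using f(4) unfolding orientation_preserving_def is_lift_def by blast
  obtain m0 :: int where "\<And>t. F t = H t + 2 * pi * of_int m0"
    using cis_eq_shift[OF F(1) H(1)] F(2) H(2) by metis
  then have mono: "F s < F t" if "s < t" for s t using H(3) that by (simp add: strict_mono_less)
  have GF: "continuous_on UNIV (\<lambda>t. G (F t))" by (rule continuous_on_compose2[OF G(1) F(1)]) simp
  have "cis (G (F t)) = cis t" for t using gf[of "cis t"] F(2) G(2) by simp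
  then obtain m1 :: int where m1: "\<And>t. G (F t) = t + 2 * pi * of_int m1"
    using cis_eq_shift[OF GF continuous_on_id] by auto
  have shift: "continuous_on UNIV (\<lambda>t. h (t + 2 * pi))" if "continuous_on UNIV h" for h :: "real \<Rightarrow> real"
    by (rule continuous_on_compose2[OF that]) (auto intro!: continuous_intros)
  have c: "cis (t + 2 * pi) = cis t" for t by (simp add: cis_mult[symmetric])
  obtain m :: int where m: "\<And>t. F (t + 2 * pi) = F t + 2 * pi * of_int m"
    using cis_eq_shift[OF shift[OF F(1)] F(1)] F(2) c by metis
  obtain n :: int where n: "\<And>t. G (t + 2 * pi) = G t + 2 * pi * of_int n"
    using cis_eq_shift[OF shift[OF G(1)] G(1)] G(2) c by metis
  have "G (F (0 + 2 * pi)) = G (F 0) + 2 * pi * of_int n * of_int m"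
    unfolding m by (rule periodic_int[where h = G and c = "2 * pi * of_int n", OF n])
  then have "2 * pi * (of_int n * of_int m) = 2 * pi * (1::real)" unfolding m1 by simp
  then have "of_int n * of_int m = (1::real)" by simp
  then have "n * m = 1" by (metis of_int_eq_1_iff of_int_mult)
  moreover have "m > 0"
  proof -
    have "F 0 < F (0 + 2 * pi)" by (rule mono) simp
    then show ?thesis unfolding m by (simp add: zero_less_mult_iff)
  qed
  ultimately have m': "m = 1" using zmult_eq_1_iff by auto
  have pos: "F' t > 0" for t
  proof -
    have "((\<lambda>t. G (F t)) has_real_derivative G' (F t) * F' t) (at t)" by (rule DERIV_chain2[OF G(3) F(3)])
    moreover have "((\<lambda>t. G (F t)) has_real_derivative 1) (at t)"
      unfolding m1 by (auto intro!: derivative_eq_intros)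
    ultimately have "G' (F t) * F' t = 1" by (rule DERIV_unique)
    then have "F' t \<noteq> 0" by auto
    moreover have "\<not> F' t < 0"
    proof
      assume "F' t < 0"
      then obtain d where d: "d > 0" "\<And>h. h > 0 \<Longrightarrow> h < d \<Longrightarrow> F (t + h) < F t"
        using DERIV_neg_dec_right[OF F(3)[of t]] by blast
      have "F (t + d / 2) < F t" "F t < F (t + d / 2)" using d(2)[of "d / 2"] d(1) mono[of t "t + d / 2"] by auto
      then show False by simp
    qed
    ultimately show ?thesis by linarith
  qed
  have "circle_lift F F' F''"
    by unfold_locales (use F(3,4,5) pos m m' in auto)
  then show ?thesis unfolding C2_liftable_def using F(2) by blast
qed

section \<open>Almost invariant sections\<close>

text \<open>
  Extensionality makes sections that agree on all triples equal, so that operators on them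
  can be compared as functions.
\<close>

definition sections :: "(triple \<Rightarrow> real \<times> complex) set"
  where "sections = {\<phi> \<in> extensional circle3. continuous_on circle3 \<phi> \<and> (\<forall>x\<in>circle3. \<phi> x \<in> hyp)}"

definition smid :: "(triple \<Rightarrow> real \<times> complex) \<Rightarrow>
    (triple \<Rightarrow> real \<times> complex) \<Rightarrow> triple \<Rightarrow> real \<times> complex"
  where "smid \<phi> \<psi> = (\<lambda>x\<in>circle3. hmid (\<phi> x) (\<psi> x))"

definition snear :: "real \<Rightarrow> (triple \<Rightarrow> real \<times> complex) \<Rightarrow>
    (triple \<Rightarrow> real \<times> complex) \<Rightarrow> bool"
  where "snear c \<phi> \<psi> \<longleftrightarrow> (\<forall>x\<in>circle3. hdist (\<phi> x) (\<psi> x) \<le> c)"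

lemma continuous_on_restrict: "continuous_on X f \<Longrightarrow> continuous_on X (restrict f X)"
  by (simp cong: continuous_on_cong)

interpretation S: midpoint_space sections smid snear
proof
  fix \<phi> \<psi> \<phi>' \<psi>' c d assume "\<phi> \<in> sections" "\<psi> \<in> sections"
  then show "smid \<phi> \<psi> \<in> sections"
    by (auto simp: sections_def smid_def hmid_in_hyp intro!: continuous_on_restrict continuous_on_hmid)
  assume "\<phi>' \<in> sections" "\<psi>' \<in> sections" "snear c \<phi> \<phi>'" "snear d \<psi> \<psi>'"
  then show "snear ((c + d) / 2) (smid \<phi> \<psi>) (smid \<phi>' \<psi>')"
    using \<open>\<phi> \<in> sections\<close> \<open>\<psi> \<in> sections\<close>
    unfolding snear_def
  proof (intro ballI)
    fix x assume *: "x \<in> circle3" "\<forall>x\<in>circle3. hdist (\<phi> x) (\<phi>' x) \<le> c" "\<forall>x\<in>circle3. hdist (\<psi> x) (\<psi>' x) \<le> d"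
      "\<phi> \<in> sections" "\<psi> \<in> sections" "\<phi>' \<in> sections" "\<psi>' \<in> sections"
    then have "hdist (hmid (\<phi> x) (\<psi> x)) (hmid (\<phi>' x) (\<psi>' x)) \<le> (hdist (\<phi> x) (\<phi>' x) + hdist (\<psi> x) (\<psi>' x)) / 2"
      by (intro hdist_hmid) (auto simp: sections_def)
    also have "\<dots> \<le> (c + d) / 2" using * by (intro divide_right_mono add_mono) auto
    finally show "hdist (smid \<phi> \<psi> x) (smid \<phi>' \<psi>' x) \<le> (c + d) / 2" using * by (simp add: smid_def)
  qed
qed (auto simp: smid_def snear_def sections_def hmid_commute hdist_self)

lemma snear_trans:
  assumes "snear c \<phi> \<psi>" "snear d \<psi> \<omega>" "\<phi> \<in> sections" "\<psi> \<in> sections" "\<omega> \<in> sections"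
  shows "snear (c + d) \<phi> \<omega>"
  unfolding snear_def
proof
  fix x assume x: "x \<in> circle3"
  have "hdist (\<phi> x) (\<omega> x) \<le> hdist (\<phi> x) (\<psi> x) + hdist (\<psi> x) (\<omega> x)"
    using assms(3-5) x by (intro hdist_triangle) (auto simp: sections_def)
  also have "\<dots> \<le> c + d" using assms(1,2) x by (intro add_mono) (auto simp: snear_def)
  finally show "hdist (\<phi> x) (\<omega> x) \<le> c + d" .
qed

lemma snear_commute: "snear c \<phi> \<psi> \<longleftrightarrow> snear c \<psi> \<phi>"
  by (simp add: snear_def hdist_commute)

lemma snear_mono: "snear c \<phi> \<psi> \<Longrightarrow> c \<le> d \<Longrightarrow> snear d \<phi> \<psi>"
  unfolding snear_def by (meson order_trans)

definition base_section :: "triple \<Rightarrow> real \<times> complex"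
  where "base_section = (\<lambda>x\<in>circle3. hbase)"

lemma base_section_in: "base_section \<in> sections"
  by (auto simp: sections_def base_section_def hbase_in_hyp intro!: continuous_on_restrict continuous_intros)

text \<open>
  The action of \<open>f\<close> on sections that is induced by the cocycle: transport the value at
  \<open>f\<^bsup>-1\<^esup> x\<close> to \<open>x\<close>.
\<close>

definition push :: "(complex \<Rightarrow> complex) \<Rightarrow> (triple \<Rightarrow> real \<times> complex) \<Rightarrow>
    triple \<Rightarrow> real \<times> complex"
  where "push f \<phi> = (\<lambda>x\<in>circle3. let y = diag_act (cinv f) x in hact (interp f y) (\<phi> y))"

lemma continuous_on_hact:
  assumes "continuous_on X A" "continuous_on X p" "\<And>x. x \<in> X \<Longrightarrow> A x \<in> GU"
  shows "continuous_on X (\<lambda>x. hact (A x) (p x))"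
proof -
  have "continuous_on X (\<lambda>x. gscale (A x))" unfolding gscale_def by (intro continuous_intros assms)
  moreover have "\<forall>x\<in>X. gscale (A x) \<noteq> 0" using gscale_pos assms(3) by (metis less_irrefl)
  ultimately show ?thesis unfolding hact_def hact_raw_def by (intro continuous_intros assms) auto
qed

locale free_abelian_action =
  fixes \<Gamma> :: "(complex \<Rightarrow> complex) set"
  assumes C2: "\<Gamma> \<subseteq> C2_diffeos"
    and sub: "subgroup \<Gamma> circle_group"
    and comm: "comm_group (circle_group\<lparr>carrier := \<Gamma>\<rparr>)"
    and free: "acts_freely \<Gamma>"
begin

sublocale G: group circle_group by (rule group_BijGroup)

lemma in_carrier: "f \<in> \<Gamma> \<Longrightarrow> f \<in> carrier circle_group"
  using sub subgroup.mem_carrier by metis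

lemma liftable: "f \<in> \<Gamma> \<Longrightarrow> C2_liftable f"
  using C2 C2_diffeo_liftable by blast

lemma bij: "f \<in> \<Gamma> \<Longrightarrow> bij_betw f circle circle"
  using in_carrier[of f] by (simp add: BijGroup_def Bij_def)

lemma inj: "f \<in> \<Gamma> \<Longrightarrow> inj_on f circle"
  using bij bij_betw_imp_inj_on by blast

lemma inv_in: "f \<in> \<Gamma> \<Longrightarrow> cinv f \<in> \<Gamma>"
  using sub by (rule subgroup.m_inv_closed)

lemma mult_in: "f \<in> \<Gamma> \<Longrightarrow> g \<in> \<Gamma> \<Longrightarrow> f \<cdot> g \<in> \<Gamma>"
  using sub by (rule subgroup.m_closed)

lemma one_in: "cone \<in> \<Gamma>"
  using sub by (rule subgroup.one_closed)

lemma pow_in: "f \<in> \<Gamma> \<Longrightarrow> f [^]\<^bsub>circle_group\<^esub> (n::nat) \<in> \<Gamma>"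
  by (induction n) (auto simp: one_in mult_in)

lemma mult_apply: "f \<in> \<Gamma> \<Longrightarrow> g \<in> \<Gamma> \<Longrightarrow> z \<in> circle \<Longrightarrow> (f \<cdot> g) z = f (g z)"
  using in_carrier[of f] in_carrier[of g] by (simp add: BijGroup_def compose_def)

lemma one_apply: "z \<in> circle \<Longrightarrow> cone z = z"
  by (simp add: BijGroup_def)

lemma mult_comm: "f \<in> \<Gamma> \<Longrightarrow> g \<in> \<Gamma> \<Longrightarrow> f \<cdot> g = g \<cdot> f"
  using comm_monoid.m_comm[OF comm_group.axioms(1)[OF comm], of f g] by simp

lemma diag_circle3: "f \<in> \<Gamma> \<Longrightarrow> x \<in> circle3 \<Longrightarrow> diag_act f x \<in> circle3"
  using C2_liftableD(6)[OF liftable] .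

lemma diag_mult: "f \<in> \<Gamma> \<Longrightarrow> g \<in> \<Gamma> \<Longrightarrow> x \<in> circle3 \<Longrightarrow>
    diag_act (f \<cdot> g) x = diag_act f (diag_act g x)"
  by (auto simp: diag_act_def mult_apply)

lemma diag_one: "x \<in> circle3 \<Longrightarrow> diag_act cone x = x"
  by (auto simp: diag_act_def one_apply)

lemma diag_inv:
  assumes "f \<in> \<Gamma>" "x \<in> circle3"
  shows "diag_act f (diag_act (cinv f) x) = x" "diag_act (cinv f) (diag_act f x) = x"
  using diag_mult[of f "cinv f" x] diag_mult[of "cinv f" f x] assms
    inv_in[of f] in_carrier[of f] diag_one[of x] by simp_all

lemma interp_mult:
  assumes "f \<in> \<Gamma>" "g \<in> \<Gamma>" "x \<in> circle3"
  shows "interp (f \<cdot> g) x = interp f (diag_act g x) ** interp g x"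
  using assms(3)
  by (intro interp_compose[OF liftable[OF assms(2)] inj[OF assms(2)] liftable[OF assms(1)]
        liftable[OF mult_in[OF assms(1,2)]]] mult_apply[OF assms(1,2)])

lemma interp_GU: "f \<in> \<Gamma> \<Longrightarrow> x \<in> circle3 \<Longrightarrow> interp f x \<in> GU"
  using C2_liftableD(4)[OF liftable] .

lemma interp_one:
  assumes "x \<in> circle3" shows "interp cone x = mat2 1 0 0 1"
proof (rule eq_on_circle3[OF _ _ _ assms])
  show "continuous_on circle3 (interp cone)" by (rule C2_liftableD(1)[OF liftable[OF one_in]])
  fix x assume x: "x \<in> distinct3"
  then obtain a b c where abc: "x = (a, b, c)" "a \<in> circle" "b \<in> circle" "c \<in> circle" "a \<noteq> b" "a \<noteq> c" "b \<noteq> c"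
    by (auto simp: distinct3_def)
  then show "interp cone x = mat2 1 0 0 1"
    using C2_liftableD(3)[OF liftable[OF one_in] x]
    by (simp add: interp_mat_def dquot_def one_apply thiele_def)
qed (rule continuous_on_const)

lemma push_apply:
  "x \<in> circle3 \<Longrightarrow> push f \<phi> x = hact (interp f (diag_act (cinv f) x)) (\<phi> (diag_act (cinv f) x))"
  by (simp add: push_def Let_def)

lemma push_image:
  assumes "f \<in> \<Gamma>" "x \<in> circle3"
  shows "push f \<phi> (diag_act f x) = hact (interp f x) (\<phi> x)"
  using push_apply[OF diag_circle3[OF assms]] diag_inv[OF assms] by simp

lemma push_in:
  assumes f: "f \<in> \<Gamma>" and \<phi>: "\<phi> \<in> sections"
  shows "push f \<phi> \<in> sections"
proof -
  let ?g = "cinv f"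
  have g: "?g \<in> \<Gamma>" using f by (rule inv_in)
  have gc: "continuous_on circle3 (\<lambda>x. ?g (k x))" if "continuous_on circle3 k" "\<And>x. x \<in> circle3 \<Longrightarrow> k x \<in> circle" for k
    by (rule continuous_on_compose2[OF C2_liftableD(2)[OF liftable[OF g]] that(1)]) (use that(2) in auto)
  have d: "continuous_on circle3 (diag_act ?g)"
    unfolding diag_act_def case_prod_unfold by (intro continuous_on_Pair gc continuous_intros) auto
  have 1: "continuous_on circle3 (\<lambda>x. interp f (diag_act ?g x))"
    by (rule continuous_on_compose2[OF C2_liftableD(1)[OF liftable[OF f]] d]) (use diag_circle3[OF g] in blast)
  have 2: "continuous_on circle3 (\<lambda>x. \<phi> (diag_act ?g x))"
    by (rule continuous_on_compose2[OF _ d, of circle3 \<phi>]) (use \<phi> diag_circle3[OF g] in \<open>simp add: sections_def, blast\<close>)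
  have "continuous_on circle3 (\<lambda>x. hact (interp f (diag_act ?g x)) (\<phi> (diag_act ?g x)))"
    by (rule continuous_on_hact[OF 1 2]) (use interp_GU[OF f] diag_circle3[OF g] in blast)
  then have "continuous_on circle3 (push f \<phi>)" unfolding push_def Let_def by (rule continuous_on_restrict)
  moreover have "push f \<phi> x \<in> hyp" if "x \<in> circle3" for x
    unfolding push_apply[OF that]
    using \<phi> diag_circle3[OF g that] interp_GU[OF f] by (intro hact_in_hyp) (auto simp: sections_def)
  ultimately show ?thesis by (simp add: sections_def push_def)
qed

lemma push_isometry:
  assumes f: "f \<in> \<Gamma>" shows "S.mid_isometry (push f)"
  unfolding S.mid_isometry_def
proof (intro conjI ballI allI impI)
  let ?g = "cinv f"
  have g: "?g \<in> \<Gamma>" using f by (rule inv_in)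
  show "push f \<phi> \<in> sections" if "\<phi> \<in> sections" for \<phi> using f that by (rule push_in)
  show "push f (smid \<phi> \<psi>) = smid (push f \<phi>) (push f \<psi>)" for \<phi> \<psi>
  proof
    fix x
    show "push f (smid \<phi> \<psi>) x = smid (push f \<phi>) (push f \<psi>) x"
    proof (cases "x \<in> circle3")
      case True
      then show ?thesis
        using diag_circle3[OF g True] interp_GU[OF f]
        by (simp only: push_apply smid_def restrict_apply if_True hact_hmid)
    next
      case False
      then show ?thesis by (simp only: push_def smid_def restrict_apply if_False)
    qed
  qed
  show "snear c (push f \<phi>) (push f \<psi>)" if "snear c \<phi> \<psi>" for c \<phi> \<psi>
    unfolding snear_def
  proof
    fix x assume x: "x \<in> circle3"
    have y: "diag_act ?g x \<in> circle3" using g x by (rule diag_circle3)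
    have "hdist (\<phi> (diag_act ?g x)) (\<psi> (diag_act ?g x)) \<le> c"
      using that[unfolded snear_def] y by (rule bspec)
    then show "hdist (push f \<phi> x) (push f \<psi> x) \<le> c"
      unfolding push_apply[OF x] hdist_hact[OF interp_GU[OF f y]] .
  qed
qed

text \<open>
  This is the cocycle relation.
\<close>

lemma push_mult:
  assumes f: "f \<in> \<Gamma>" and g: "g \<in> \<Gamma>"
  shows "push (f \<cdot> g) = push f \<circ> push g"
proof (intro ext)
  fix \<phi> x
  let ?f' = "cinv f" and ?g' = "cinv g"
  show "push (f \<cdot> g) \<phi> x = (push f \<circ> push g) \<phi> x"
  proof (cases "x \<in> circle3")
    case True
    have inv: "cinv (f \<cdot> g) = ?g' \<cdot> ?f'"
      using in_carrier f g by (intro G.inv_mult_group)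
    define y where "y = diag_act ?f' x"
    define z where "z = diag_act ?g' y"
    have y: "y \<in> circle3" unfolding y_def using inv_in[OF f] True by (rule diag_circle3)
    have z: "z \<in> circle3" unfolding z_def using inv_in[OF g] y by (rule diag_circle3)
    have gz: "diag_act g z = y" unfolding z_def by (rule diag_inv[OF g y])
    have "push (f \<cdot> g) \<phi> x = hact (interp (f \<cdot> g) z) (\<phi> z)"
      unfolding push_apply[OF True] inv diag_mult[OF inv_in[OF g] inv_in[OF f] True] y_def z_def ..
    also have "\<dots> = hact (interp f y) (hact (interp g z) (\<phi> z))"
      unfolding interp_mult[OF f g z] gz by (rule hact_mult[OF interp_GU[OF f y] interp_GU[OF g z]])
    also have "\<dots> = push f (push g \<phi>) x"
      unfolding push_apply[OF True] y_def[symmetric] push_apply[OF y] z_def ..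
    finally show ?thesis by simp
  next
    case False
    then show ?thesis by (simp only: push_def restrict_apply if_False comp_apply)
  qed
qed

lemma push_one:
  assumes "\<phi> \<in> sections" shows "push cone \<phi> = \<phi>"
proof
  fix x
  show "push cone \<phi> x = \<phi> x"
  proof (cases "x \<in> circle3")
    case True
    then have "push cone \<phi> x = hact (mat2 1 0 0 1) (\<phi> x)"
      by (simp only: push_apply G.inv_one diag_one interp_one)
    also have "\<dots> = \<phi> x" by (simp add: hact_def hact_raw_def gscale_def)
    finally show ?thesis .
  next
    case False
    then have "\<phi> x = undefined" using assms unfolding sections_def by (intro extensional_arb[of _ circle3]) auto
    then show ?thesis using False by (simp only: push_def restrict_apply if_False)
  qed
qed

lemma push_commute: "f \<in> \<Gamma> \<Longrightarrow> g \<in> \<Gamma> \<Longrightarrow> push f \<circ> push g = push g \<circ> push f"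
  by (simp only: push_mult[symmetric] mult_comm)

lemma push_pow:
  assumes f: "f \<in> \<Gamma>" and \<phi>: "\<phi> \<in> sections"
  shows "(push f ^^ n) \<phi> = push (f [^]\<^bsub>circle_group\<^esub> n) \<phi>"
proof (induction n)
  case 0
  then show ?case using push_one[OF \<phi>] by simp
next
  case (Suc n)
  have "push (f [^]\<^bsub>circle_group\<^esub> Suc n) \<phi> = push (f \<cdot> f [^]\<^bsub>circle_group\<^esub> n) \<phi>"
    using mult_comm[OF f pow_in[OF f]] by simp
  also have "\<dots> = push f ((push f ^^ n) \<phi>)" unfolding push_mult[OF f pow_in[OF f]] Suc by simp
  finally show ?case by simp
qed

text \<open>
  A point at distance \<open>c\<close> from the base point has height \<open>cosh c \<ge> exp c / 2\<close>, so the
  polynomial bound of the height gives a bound of the distance linear in \<open>q\<close>.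
\<close>

lemma snear_push_of_bound:
  assumes f: "f \<in> \<Gamma>" and F: "circle_lift F F' F''" "\<And>t. f (cis t) = cis (F t)"
    and Q: "\<And>t. F' t \<le> exp q" "\<And>t. F' t \<ge> exp (- q)" "\<And>t. \<bar>F'' t\<bar> \<le> exp q" "q \<ge> 0"
  shows "snear (ln (256 * 5328\<^sup>2) + 7 * q) (push f base_section) base_section"
  unfolding snear_def
proof
  interpret circle_lift F F' F'' by (rule F(1))
  fix x assume x: "x \<in> circle3"
  let ?c = "ln (256 * 5328\<^sup>2 :: real) + 7 * q"
  let ?y = "diag_act (cinv f) x"
  have y: "?y \<in> circle3" using inv_in[OF f] x by (rule diag_circle3)
  have c0: "?c \<ge> 0" using Q(4) by simp
  have eq: "push f base_section x = hact (interp f ?y) hbase"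
    unfolding push_apply[OF x] using y by (simp only: base_section_def restrict_apply if_True)
  have "fst (hact (interp f ?y) hbase) \<le> 128 * 5328\<^sup>2 * exp q ^ 7"
    by (rule fst_hact_interp_le[OF F(2) _ Q(1) _ Q(3) y]) (use Q in \<open>auto simp: exp_minus field_simps\<close>)
  also have "\<dots> = exp ?c / 2" by (simp add: exp_add exp_of_nat_mult[symmetric])
  also have "\<dots> \<le> cosh ?c" by (simp add: cosh_def)
  finally have "lor (hact (interp f ?y) hbase) hbase \<le> cosh ?c" by (simp add: lor_def)
  moreover have "hact (interp f ?y) hbase \<in> hyp" by (rule hact_in_hyp[OF interp_GU[OF f y] hbase_in_hyp])
  ultimately have "hdist (hact (interp f ?y) hbase) hbase \<le> ?c"
    using hdist_le_iff[OF _ hbase_in_hyp c0] by blast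
  then show "hdist (push f base_section x) (base_section x) \<le> ?c"
    unfolding eq using x by (simp only: base_section_def restrict_apply if_True)
qed

lemma push_displacement_bounded:
  assumes f: "f \<in> \<Gamma>" obtains c where "c \<ge> 0" "snear c (push f base_section) base_section"
proof -
  obtain F F' F'' where F: "circle_lift F F' F''" and fF: "\<forall>t. f (cis t) = cis (F t)"
    by (rule C2_liftableE[OF liftable[OF f]])
  interpret circle_lift F F' F'' by (rule F)
  obtain K1 where K1: "K1 > 0" "\<And>t. \<bar>F' t\<bar> \<le> K1"
    by (rule periodic_bounded[of F']) (use F'_cont F'_period in auto)
  obtain K2 where K2: "K2 > 0" "\<And>t. \<bar>F'' t\<bar> \<le> K2"
    by (rule periodic_bounded[of F'']) (use F''_cont F''_period in auto)
  obtain m where m: "m > 0" "\<And>t. F' t \<ge> m"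
    by (rule periodic_bounded_below[of F']) (use F'_cont F'_period F'_pos in auto)
  define q where "q = max 0 (max (ln K1) (max (ln K2) (- ln m)))"
  have q: "q \<ge> 0" "ln K1 \<le> q" "ln K2 \<le> q" "- q \<le> ln m" by (auto simp: q_def)
  have "K1 \<le> exp q" "K2 \<le> exp q" "exp (- q) \<le> m"
    using q K1(1) K2(1) m(1) by (metis exp_le_cancel_iff exp_ln)+
  then have b: "F' t \<le> exp q" "F' t \<ge> exp (- q)" "\<bar>F'' t\<bar> \<le> exp q" for t
    using K1(2)[of t] K2(2)[of t] m(2)[of t] by linarith+
  have "snear (ln (256 * 5328\<^sup>2) + 7 * q) (push f base_section) base_section"
    by (rule snear_push_of_bound[OF f F]) (use fF b q in auto)
  moreover have "ln (256 * 5328\<^sup>2) + 7 * q \<ge> 0" using q by simp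
  ultimately show ?thesis using that by blast
qed

text \<open>
  If \<open>f\<close> has finite order, the displacements are periodic in \<open>n\<close>, hence bounded. Otherwise no
  iterate of the lift returns a point to its class modulo \<open>2\<pi>\<close>, and the subexponential
  growth of the derivatives applies.
\<close>

lemma drift_sublinear:
  assumes f: "f \<in> \<Gamma>" and e: "e > 0"
  obtains C where "\<And>n. snear (C + e * real n) ((push f ^^ n) base_section) base_section"
proof (cases "\<exists>m>0. f [^]\<^bsub>circle_group\<^esub> (m::nat) = cone")
  case True
  then obtain m :: nat where m: "m > 0" "f [^]\<^bsub>circle_group\<^esub> m = cone" by blast
  obtain c where c: "c \<ge> 0" "snear c (push f base_section) base_section"
    using push_displacement_bounded[OF f] by blast
  have U: "S.mid_isometry (push f)" using f by (rule push_isometry)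
  have pin: "(push f ^^ n) base_section \<in> sections" for n
    using S.mid_isometryD(1)[OF S.mid_isometry_funpow[OF U] base_section_in] .
  have lin: "snear (real n * c) ((push f ^^ n) base_section) base_section" for n
  proof (induction n)
    case 0
    then show ?case using S.near_refl[OF base_section_in] by simp
  next
    case (Suc n)
    have "snear (real n * c) (push f ((push f ^^ n) base_section)) (push f base_section)"
      by (rule S.mid_isometryD(3)[OF U pin base_section_in Suc])
    from snear_trans[OF this c(2)] have "snear (real n * c + c) (push f ((push f ^^ n) base_section)) base_section"
      using pin[of "Suc n"] pin[of 1] base_section_in by simp
    then show ?case by (simp add: algebra_simps)
  qed
  have per: "(push f ^^ m) base_section = base_section"
    unfolding push_pow[OF f base_section_in] m(2) by (rule push_one[OF base_section_in])
  have "snear (real m * c + e * real n) ((push f ^^ n) base_section) base_section" for n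
  proof -
    have "(push f ^^ n) base_section = (push f ^^ (n mod m)) base_section"
      using funpow_mod_eq[OF per] by metis
    moreover have "real (n mod m) * c \<le> real m * c + e * real n"
      using mod_less_divisor[OF m(1), of n] c(1) e by (intro add_increasing2 mult_right_mono) auto
    ultimately show ?thesis using snear_mono[OF lin] by metis
  qed
  then show ?thesis using that by blast
next
  case False
  obtain F F' F'' where F: "circle_lift F F' F''" and fF: "\<forall>t. f (cis t) = cis (F t)"
    by (rule C2_liftableE[OF liftable[OF f]])
  interpret circle_lift F F' F'' by (rule F)
  have pow: "(f [^]\<^bsub>circle_group\<^esub> n) (cis t) = cis ((F ^^ n) t)" for n t
  proof (induction n)
    case (Suc n)
    have "(f [^]\<^bsub>circle_group\<^esub> Suc n) (cis t) = (f \<cdot> f [^]\<^bsub>circle_group\<^esub> n) (cis t)"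
      using mult_comm[OF f pow_in[OF f]] by simp
    also have "\<dots> = f (cis ((F ^^ n) t))" using mult_apply[OF f pow_in[OF f]] Suc by simp
    finally show ?case using fF by simp
  qed (simp add: one_apply)
  have no_return: "(F ^^ n) t \<noteq> t + 2 * pi * of_int k" if "n > 0" for n t and k :: int
  proof
    assume eq: "(F ^^ n) t = t + 2 * pi * of_int k"
    have "(f [^]\<^bsub>circle_group\<^esub> n) (cis t) = cis t * cis (2 * pi * of_int k)"
      unfolding pow eq cis_mult ..
    also have "cis (2 * pi * of_int k) = 1"
      using sin_npi_int[of "2 * k"] cos_npi_int[of "2 * k"] by (simp add: complex_eq_iff mult_ac)
    finally have "(f [^]\<^bsub>circle_group\<^esub> n) (cis t) = cis t" by simp
    moreover have "f [^]\<^bsub>circle_group\<^esub> n \<noteq> cone" using False that by blast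
    ultimately show False using free pow_in[OF f, of n] unfolding acts_freely_def by force
  qed
  have "e / 7 > 0" using e by simp
  then obtain C where C: "C \<ge> 0" "\<And>n t. DF n t \<le> exp (C + e / 7 * real n)"
    "\<And>n t. DF n t \<ge> exp (- (C + e / 7 * real n))" "\<And>n t. \<bar>D2F n t\<bar> \<le> exp (C + e / 7 * real n)"
    using subexponential_C2_growth[OF no_return] by blast
  have "snear (ln (256 * 5328\<^sup>2) + 7 * C + e * real n) ((push f ^^ n) base_section) base_section" for n
  proof -
    have "snear (ln (256 * 5328\<^sup>2) + 7 * (C + e / 7 * real n)) (push (f [^]\<^bsub>circle_group\<^esub> n) base_section) base_section"
      by (rule snear_push_of_bound[OF pow_in[OF f] iterate pow]) (use C e in auto)
    moreover have "ln (256 * 5328\<^sup>2) + 7 * (C + e / 7 * real n) = ln (256 * 5328\<^sup>2) + 7 * C + e * real n"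
      by simp
    ultimately show ?thesis unfolding push_pow[OF f base_section_in] by (simp only:)
  qed
  then show ?thesis using that by blast
qed

lemma drift_along_powers:
  assumes f: "f \<in> \<Gamma>"
  obtains \<epsilon> where "\<epsilon> \<longlonglongrightarrow> 0" "\<And>k. snear (2 ^ k * \<epsilon> k) ((push f ^^ (2 ^ k)) base_section) base_section"
proof -
  \<comment> \<open>the optimal bound, because \<open>drift_sublinear\<close> gives a separate constant for each slope\<close>
  define \<epsilon> where "\<epsilon> k = (SUP x\<in>circle3. hdist ((push f ^^ (2 ^ k)) base_section x) (base_section x)) / 2 ^ k" for k :: nat
  have U: "S.mid_isometry (push f)" using f by (rule push_isometry)
  have pin: "(push f ^^ n) base_section \<in> sections" for n
    using S.mid_isometryD(1)[OF S.mid_isometry_funpow[OF U] base_section_in] .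
  have ne: "circle3 \<noteq> {}" by (auto intro!: exI[of _ 1])
  have nonneg: "0 \<le> hdist ((push f ^^ n) base_section x) (base_section x)" if "x \<in> circle3" for n x
    using pin[of n] base_section_in that by (intro hdist_nonneg) (auto simp: sections_def)
  have up: "hdist ((push f ^^ n) base_section x) (base_section x) \<le> c"
    if "snear c ((push f ^^ n) base_section) base_section" "x \<in> circle3" for n x c
    using that unfolding snear_def by blast
  have bdd: "bdd_above ((\<lambda>x. hdist ((push f ^^ n) base_section x) (base_section x)) ` circle3)" for n
  proof -
    obtain C where "\<And>n. snear (C + 1 * real n) ((push f ^^ n) base_section) base_section"
      using drift_sublinear[OF f, of 1] by (metis zero_less_one)
    then show ?thesis using up by (intro bdd_aboveI2) blast
  qed
  show ?thesis
  proof (rule that[of \<epsilon>])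
    show "snear (2 ^ k * \<epsilon> k) ((push f ^^ (2 ^ k)) base_section) base_section" for k
      unfolding snear_def \<epsilon>_def using bdd by (auto intro!: cSUP_upper)
    show "\<epsilon> \<longlonglongrightarrow> 0"
    proof (rule LIMSEQ_I)
      fix r :: real assume r: "r > 0"
      then obtain C where C: "\<And>n. snear (C + r / 2 * real n) ((push f ^^ n) base_section) base_section"
        using drift_sublinear[OF f, of "r / 2"] by (metis half_gt_zero)
      have "(\<lambda>k. C / 2 ^ k) \<longlonglongrightarrow> 0" by (rule LIMSEQ_divide_realpow_zero) simp
      then have "\<forall>\<^sub>F k in sequentially. C / 2 ^ k < r / 2" by (rule order_tendstoD) (use r in simp)
      then obtain N where N: "\<And>k. k \<ge> N \<Longrightarrow> C / 2 ^ k < r / 2" unfolding eventually_sequentially by blast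
      have "norm (\<epsilon> k - 0) < r" if "k \<ge> N" for k
      proof -
        let ?s = "SUP x\<in>circle3. hdist ((push f ^^ (2 ^ k)) base_section x) (base_section x)"
        have "?s \<le> C + r / 2 * real (2 ^ k)" by (rule cSUP_least[OF ne]) (rule up[OF C])
        then have "\<epsilon> k \<le> (C + r / 2 * 2 ^ k) / 2 ^ k" unfolding \<epsilon>_def by (intro divide_right_mono) auto
        also have "\<dots> = C / 2 ^ k + r / 2" by (simp add: field_simps)
        also have "\<dots> < r" using N[OF that] by linarith
        finally have "\<epsilon> k < r" .
        moreover have "(1, 1, 1) \<in> circle3" by simp
        then have "0 \<le> ?s" using nonneg bdd by (intro cSUP_upper2)
        then have "\<epsilon> k \<ge> 0" by (simp add: \<epsilon>_def)
        ultimately show ?thesis by simp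
      qed
      then show "\<exists>no. \<forall>n\<ge>no. norm (\<epsilon> n - 0) < r" by blast
    qed
  qed
qed

text \<open>
  The means over the generators are almost invariant under the generators; the
  group elements almost preserving a sequence of sections form a subgroup.
\<close>

lemma almost_invariant_sections:
  assumes S: "finite S" "S \<subseteq> \<Gamma>" "generate circle_group S = \<Gamma>"
  obtains \<phi> where "\<And>n::nat. \<phi> n \<in> sections"
    "\<And>f. f \<in> \<Gamma> \<Longrightarrow> \<exists>\<epsilon>. \<epsilon> \<longlonglongrightarrow> 0 \<and> (\<forall>n. snear (\<epsilon> n) (push f (\<phi> n)) (\<phi> n))"
proof -
  obtain fs where fs: "set fs = S" using S(1) finite_list by blast
  define \<phi> where "\<phi> n = foldr (S.power_mean n) (map push fs) base_section" for n
  have iso: "S.mid_isometry U" if "U \<in> set (map push fs)" for U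
    using that fs S(2) push_isometry by auto
  have comm: "U \<circ> V = V \<circ> U" if UV: "U \<in> set (map push fs)" "V \<in> set (map push fs)" for U V
  proof -
    obtain f g where "f \<in> set fs" "g \<in> set fs" "U = push f" "V = push g" using UV by auto
    moreover from this have "f \<in> \<Gamma>" "g \<in> \<Gamma>" using fs S(2) by auto
    ultimately show ?thesis using push_commute by metis
  qed
  have \<phi>: "\<phi> n \<in> sections" for n
    unfolding \<phi>_def by (rule S.foldr_power_mean_in[OF iso base_section_in])
  have "\<exists>\<epsilon>. \<epsilon> \<longlonglongrightarrow> 0 \<and> (\<forall>n. snear (\<epsilon> n) (push f (\<phi> n)) (\<phi> n))" (is "?P f")
    if "f \<in> generate circle_group S" for f
    using that
  proof (induction rule: generate.induct)
    case one
    have "snear 0 (push cone (\<phi> n)) (\<phi> n)" for n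
      using push_one[OF \<phi>] S.near_refl[OF \<phi>] by simp
    then show ?case by (intro exI[of _ "\<lambda>_. 0"]) simp
  next
    case (incl f)
    then have f: "f \<in> \<Gamma>" using S by blast
    obtain \<epsilon> where \<epsilon>: "\<epsilon> \<longlonglongrightarrow> 0" "\<And>k. snear (2 ^ k * \<epsilon> k) ((push f ^^ (2 ^ k)) base_section) base_section"
      using drift_along_powers[OF f] by blast
    have "snear (2 ^ k * \<epsilon> k / 2 ^ k) (push f (\<phi> k)) (\<phi> k)" for k
      unfolding \<phi>_def by (rule S.joint_almost_invariant[OF iso comm base_section_in _ \<epsilon>(2)]) (use incl fs in auto)
    then show ?case using \<epsilon>(1) by (intro exI[of _ \<epsilon>]) simp
  next
    case (inv f)
    then have f: "f \<in> \<Gamma>" using S by blast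
    let ?g = "cinv f"
    have g: "?g \<in> \<Gamma>" using f by (rule inv_in)
    obtain \<epsilon> where \<epsilon>: "\<epsilon> \<longlonglongrightarrow> 0" "\<And>k. snear (2 ^ k * \<epsilon> k) ((push f ^^ (2 ^ k)) base_section) base_section"
      using drift_along_powers[OF f] by blast
    have 1: "snear (2 ^ k * \<epsilon> k / 2 ^ k) (push f (\<phi> k)) (\<phi> k)" for k
      unfolding \<phi>_def by (rule S.joint_almost_invariant[OF iso comm base_section_in _ \<epsilon>(2)]) (use inv fs in auto)
    have "snear (\<epsilon> k) (push ?g (\<phi> k)) (\<phi> k)" for k
    proof -
      have "snear (\<epsilon> k) (push ?g (push f (\<phi> k))) (push ?g (\<phi> k))"
        using 1[of k] S.mid_isometryD(3)[OF push_isometry[OF g] push_in[OF f \<phi>] \<phi>] by simp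
      moreover have "push ?g (push f (\<phi> k)) = \<phi> k"
        using push_mult[OF g f] in_carrier[OF f] push_one[OF \<phi>] by (simp add: fun_eq_iff)
      ultimately show ?thesis by (simp add: snear_commute)
    qed
    then show ?case using \<epsilon>(1) by blast
  next
    case (eng f g)
    have f: "f \<in> \<Gamma>" and g: "g \<in> \<Gamma>" using eng S by auto
    obtain \<epsilon> where \<epsilon>: "\<epsilon> \<longlonglongrightarrow> 0" "\<And>n. snear (\<epsilon> n) (push f (\<phi> n)) (\<phi> n)" using eng.IH(1) by blast
    obtain \<delta> where \<delta>: "\<delta> \<longlonglongrightarrow> 0" "\<And>n. snear (\<delta> n) (push g (\<phi> n)) (\<phi> n)" using eng.IH(2) by blast
    have "snear (\<delta> n + \<epsilon> n) (push (f \<cdot> g) (\<phi> n)) (\<phi> n)" for n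
    proof -
      have "snear (\<delta> n) (push f (push g (\<phi> n))) (push f (\<phi> n))"
        by (rule S.mid_isometryD(3)[OF push_isometry[OF f] push_in[OF g \<phi>] \<phi> \<delta>(2)])
      from snear_trans[OF this \<epsilon>(2)] show ?thesis
        using push_in[OF f push_in[OF g \<phi>]] push_in[OF f \<phi>] \<phi> unfolding push_mult[OF f g] comp_apply by blast
    qed
    moreover have "(\<lambda>n. \<delta> n + \<epsilon> n) \<longlonglongrightarrow> 0" using tendsto_add[OF \<delta>(1) \<epsilon>(1)] by simp
    ultimately show ?case by blast
  qed
  then show ?thesis using that \<phi> S(3) by metis
qed

end

section \<open>Distance to the rotations\<close>

lemma moebius_map_0_in_rotations: "moebius_map \<kappa> 0 \<in> rotations"
  by (auto simp: rotations_def)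

text \<open>
  A representative of \<open>T\<^sub>\<sigma> = moebius_map 0 \<sigma>\<close>.
\<close>

definition transvection :: "complex \<Rightarrow> complex^2^2"
  where "transvection \<sigma> = mat2 1 (- \<sigma>) (- cnj \<sigma>) 1"

lemma transvection_in_GU: "cmod \<sigma> < 1 \<Longrightarrow> transvection \<sigma> \<in> GU"
  by (rule GU_I[where u = 1 and a = 1 and b = "- \<sigma>"]) (simp_all add: transvection_def)

lemma mob_transvection: "cmod \<sigma> < 1 \<Longrightarrow> mob (transvection \<sigma>) = moebius_map 0 \<sigma>"
  using mob_eq_moebius_map[OF transvection_in_GU, of \<sigma> 0] by (simp add: transvection_def)

lemma moebius_map_in: "cmod \<sigma> < 1 \<Longrightarrow> moebius_map \<kappa> \<sigma> \<in> moebius"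
  unfolding moebius_def by blast

lemma moebius_carrier: "g \<in> moebius \<Longrightarrow> g \<in> carrier circle_group"
  using mob_in_Bij unfolding moebius_eq_image_GU by blast

lemma moebius_map_split:
  assumes "cmod \<sigma> < 1"
  shows "moebius_map \<kappa> \<sigma> = moebius_map \<kappa> 0 \<cdot> moebius_map 0 \<sigma>"
proof -
  have c: "moebius_map \<kappa> 0 \<in> carrier circle_group" "moebius_map 0 \<sigma> \<in> carrier circle_group"
    using assms by (auto intro!: moebius_carrier moebius_map_in)
  have "compose circle (moebius_map \<kappa> 0) (moebius_map 0 \<sigma>) z = moebius_map \<kappa> \<sigma> z" for z
  proof (cases "z \<in> circle")
    case True
    have "moebius_map 0 \<sigma> z \<in> circle"
      using mob_circle[OF transvection_in_GU[OF assms] True] mob_transvection[OF assms] by simp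
    then show ?thesis using True by (simp add: compose_def moebius_map_def)
  qed (simp add: compose_def moebius_map_def)
  then show ?thesis using c by (auto simp: BijGroup_def)
qed

lemma boost_hact: "p \<in> hyp \<Longrightarrow> hact (boost p) p = hbase"
proof -
  assume p: "p \<in> hyp"
  have "boost p ** unboost p = mat2 (of_real ((fst p + 1)\<^sup>2 - (cmod (snd p))\<^sup>2)) 0 0 (of_real ((fst p + 1)\<^sup>2 - (cmod (snd p))\<^sup>2))"
    by (simp add: boost_def unboost_def mat2_mult complex_norm_square[symmetric] power2_eq_square algebra_simps)
  moreover have "(fst p + 1)\<^sup>2 - (cmod (snd p))\<^sup>2 \<noteq> 0"
    unfolding hyp_cmod[OF p] using hyp_fst_ge_1[OF p] by (simp add: power2_eq_square algebra_simps)
  ultimately have "hact (boost p ** unboost p) hbase = hbase"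
    by (simp add: hact_def hact_raw_def gscale_def del: of_real_diff of_real_power)
  then show ?thesis using hact_mult[OF unboost_in_GU(2)[OF p] unboost_in_GU(1)[OF p], of hbase] hact_unboost[OF p] by simp
qed

text \<open>
  A Moebius map is a rotation after a map \<open>T\<^sub>\<sigma>\<close>, and left invariance removes the
  rotation: the distance to the rotations is at most the distance from \<open>T\<^sub>\<sigma>\<close> to the identity, which
  is small for small \<open>\<sigma>\<close> whatever the metric is. And \<open>\<sigma>\<close> is small when the base point moves little, since the
  height of its image is \<open>(1 + \<bar>\<sigma>\<bar>\<^sup>2) / (1 - \<bar>\<sigma>\<bar>\<^sup>2)\<close>.
\<close>

lemma distance_to_rotations:
  assumes d: "left_invariant_moebius_metric d" and e: "e > 0"
  obtains \<delta> where "\<delta> > 0"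
    "\<And>A. A \<in> GU \<Longrightarrow> hdist (hact A hbase) hbase \<le> \<delta> \<Longrightarrow> (INF r\<in>rotations. d (mob A) r) \<in> {0..<e}"
proof -
  have M: "Metric_space moebius d" and top: "Metric_space.mtopology moebius d = moebius_topology"
    and inv: "\<And>g h k. g \<in> moebius \<Longrightarrow> h \<in> moebius \<Longrightarrow> k \<in> moebius \<Longrightarrow>
       d (g \<cdot> h) (g \<cdot> k) = d h k"
    using d by (auto simp: left_invariant_moebius_metric_def)
  interpret Metric_space moebius d by (rule M)
  have "continuous_map (top_of_set (ball 0 1)) moebius_topology (\<lambda>\<sigma>. mob (transvection \<sigma>))"
    by (rule continuous_map_mob) (auto simp: transvection_def intro!: continuous_on_mat2 continuous_intros transvection_in_GU[unfolded transvection_def])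
  then have "openin (top_of_set (ball 0 1)) {\<sigma> \<in> topspace (top_of_set (ball (0::complex) 1)). mob (transvection \<sigma>) \<in> mball (moebius_map 0 0) e}"
    unfolding top[symmetric] by (rule openin_continuous_map_preimage) simp
  then have op: "open {\<sigma> \<in> ball (0::complex) 1. mob (transvection \<sigma>) \<in> mball (moebius_map 0 0) e}"
    by (simp add: openin_open_eq)
  have zero: "0 \<in> {\<sigma> \<in> ball (0::complex) 1. mob (transvection \<sigma>) \<in> mball (moebius_map 0 0) e}"
    using e by (simp add: mob_transvection moebius_map_in)
  obtain \<eta> where \<eta>: "\<eta> > 0" "ball 0 \<eta> \<subseteq> {\<sigma> \<in> ball (0::complex) 1. mob (transvection \<sigma>) \<in> mball (moebius_map 0 0) e}"
    by (rule openE[OF op zero])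
  have close: "d (moebius_map 0 \<sigma>) (moebius_map 0 0) < e" "cmod \<sigma> < 1" if "cmod \<sigma> < \<eta>" for \<sigma>
  proof -
    have "\<sigma> \<in> ball 0 \<eta>" using that by simp
    then have *: "cmod \<sigma> < 1" "mob (transvection \<sigma>) \<in> mball (moebius_map 0 0) e" using \<eta>(2) by auto
    then show "d (moebius_map 0 \<sigma>) (moebius_map 0 0) < e" "cmod \<sigma> < 1"
      by (auto simp: mob_transvection commute)
  qed
  \<comment> \<open>height at most \<open>1 + \<eta>\<^sup>2/2\<close> forces \<open>\<bar>\<sigma>\<bar> \<le> \<eta>/2\<close>\<close>
  define \<delta> where "\<delta> = arcosh (1 + \<eta>\<^sup>2 / 2)"
  have c\<delta>: "cosh \<delta> = 1 + \<eta>\<^sup>2 / 2" unfolding \<delta>_def by (rule cosh_arcosh_real) simp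
  have \<delta>: "\<delta> > 0" unfolding \<delta>_def using \<eta>(1) by (subst arcosh_real_gt_1_iff) auto
  show ?thesis
  proof (rule that[OF \<delta>])
    fix A assume A: "A \<in> GU" and near: "hdist (hact A hbase) hbase \<le> \<delta>"
    define \<sigma> where "\<sigma> = - A$1$2 / A$1$1"
    obtain \<kappa> where \<kappa>: "mob A = moebius_map \<kappa> \<sigma>" "cmod \<sigma> < 1"
      using mob_in_moebius[OF A] unfolding \<sigma>_def by blast
    have a0: "cmod (A$1$1) > 0" "cmod (A$1$1) > cmod (A$1$2)" using A by (auto simp: GU_def)
    have g: "gscale A > 0" using A by (rule gscale_pos)
    have "lor (hact A hbase) hbase \<le> cosh \<delta>"
      using near hdist_le_iff[OF hact_in_hyp[OF A hbase_in_hyp] hbase_in_hyp] \<delta> by simp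
    then have "((cmod (A$1$1))\<^sup>2 + (cmod (A$1$2))\<^sup>2) / gscale A \<le> 1 + \<eta>\<^sup>2 / 2"
      unfolding c\<delta> by (simp add: lor_def fst_hact_base)
    then have "(cmod (A$1$1))\<^sup>2 + (cmod (A$1$2))\<^sup>2 \<le> (1 + \<eta>\<^sup>2 / 2) * gscale A"
      using g by (simp add: pos_divide_le_eq)
    also have "\<dots> = gscale A + \<eta>\<^sup>2 / 2 * gscale A" by (simp add: algebra_simps)
    finally have "2 * (cmod (A$1$2))\<^sup>2 \<le> \<eta>\<^sup>2 / 2 * gscale A" by (simp add: gscale_def)
    moreover have "\<eta>\<^sup>2 / 2 * gscale A \<le> \<eta>\<^sup>2 / 2 * (cmod (A$1$1))\<^sup>2"
      by (intro mult_left_mono) (auto simp: gscale_def)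
    ultimately have "(cmod (A$1$2))\<^sup>2 \<le> (\<eta> / 2 * cmod (A$1$1))\<^sup>2"
      by (simp add: power_mult_distrib power_divide)
    then have "cmod (A$1$2) \<le> \<eta> / 2 * cmod (A$1$1)"
      by (rule power2_le_imp_le) (use \<eta>(1) in simp)
    also have "\<dots> < \<eta> * cmod (A$1$1)" using \<eta>(1) a0 by simp
    finally have "cmod \<sigma> < \<eta>" using a0 by (simp add: \<sigma>_def norm_divide pos_divide_less_eq)
    note s = close[OF this]
    have "d (mob A) (moebius_map \<kappa> 0) = d (moebius_map \<kappa> 0 \<cdot> moebius_map 0 \<sigma>) (moebius_map \<kappa> 0 \<cdot> moebius_map 0 0)"
      unfolding \<kappa>(1) using moebius_map_split[OF s(2), of \<kappa>] moebius_map_split[of 0 \<kappa>] by simp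
    also have "\<dots> = d (moebius_map 0 \<sigma>) (moebius_map 0 0)"
      using s(2) by (intro inv moebius_map_in) auto
    finally have lt: "d (mob A) (moebius_map \<kappa> 0) < e" using s(1) by simp
    have bdd: "bdd_below ((\<lambda>r. d (mob A) r) ` rotations)" by (rule bdd_belowI2[of _ 0]) simp
    have "(INF r\<in>rotations. d (mob A) r) \<le> d (mob A) (moebius_map \<kappa> 0)"
      by (rule cINF_lower[OF bdd moebius_map_0_in_rotations])
    moreover have "0 \<le> (INF r\<in>rotations. d (mob A) r)"
      by (rule cINF_greatest) (use moebius_map_0_in_rotations in auto)
    ultimately show "(INF r\<in>rotations. d (mob A) r) \<in> {0..<e}" using lt by simp
  qed
qed

section \<open>Almost reducibility\<close>

theorem theoremB:
  fixes \<Gamma> :: "(complex \<Rightarrow> complex) set"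
    and d :: "(complex \<Rightarrow> complex) \<Rightarrow> (complex \<Rightarrow> complex) \<Rightarrow> real"
  assumes "\<Gamma> \<subseteq> C2_diffeos"
    and "finitely_generated_subgroup circle_group \<Gamma>"
    and "comm_group (circle_group\<lparr>carrier := \<Gamma>\<rparr>)"
    and "acts_freely \<Gamma>"
    and "left_invariant_moebius_metric d"
  shows "almost_rotation_reducible d \<Gamma> enlarged_cocycle"
proof -
  interpret free_abelian_action \<Gamma>
    by (rule free_abelian_action.intro) (use assms in \<open>auto simp: finitely_generated_subgroup_def\<close>)
  have haus: "Hausdorff_space moebius_topology"
    using assms(5) Metric_space.Hausdorff_space_mtopology[of moebius d]
    by (simp add: left_invariant_moebius_metric_def)
  obtain S where S: "finite S" "S \<subseteq> \<Gamma>" "generate circle_group S = \<Gamma>"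
    using assms(2) by (auto simp: finitely_generated_subgroup_def)
  obtain \<phi> where \<phi>: "\<And>n::nat. \<phi> n \<in> sections"
    "\<And>f. f \<in> \<Gamma> \<Longrightarrow> \<exists>\<epsilon>. \<epsilon> \<longlonglongrightarrow> 0 \<and> (\<forall>n. snear (\<epsilon> n) (push f (\<phi> n)) (\<phi> n))"
    using almost_invariant_sections[OF S] by blast
  have hyp: "\<phi> n x \<in> hyp" if "x \<in> circle3" for n x
    using \<phi>(1)[of n] that unfolding sections_def by blast
  define B where "B n x = mob (boost (\<phi> n x))" for n x
  show ?thesis
    unfolding almost_rotation_reducible_def
  proof (intro exI[of _ B] conjI allI ballI)
    fix n
    have "continuous_on circle3 (\<phi> n)" using \<phi>(1)[of n] by (simp add: sections_def)
    then have "continuous_on circle3 (\<lambda>x. boost (\<phi> n x))"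
      unfolding boost_def by (intro continuous_on_mat2 continuous_intros)
    then show "continuous_map (top_of_set circle3) moebius_topology (B n)"
      unfolding B_def by (rule continuous_map_mob) (rule unboost_in_GU(2)[OF hyp])
  next
    fix f assume f: "f \<in> \<Gamma>"
    obtain \<epsilon> where \<epsilon>: "\<epsilon> \<longlonglongrightarrow> 0" "\<And>n. snear (\<epsilon> n) (push f (\<phi> n)) (\<phi> n)" using \<phi>(2)[OF f] by blast
    \<comment> \<open>\<open>unboost\<close> carries the base point to \<open>\<phi>\<^sub>n x\<close>, the cocycle carries this close to \<open>\<phi>\<^sub>n (f x)\<close>, and \<open>boost\<close> carries that back\<close>
    define Q where "Q n x = boost (\<phi> n (diag_act f x)) ** interp f x ** unboost (\<phi> n x)" for n x
    have Q: "Q n x \<in> GU" "hdist (hact (Q n x) hbase) hbase \<le> \<epsilon> n"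
      "B n (diag_act f x) \<cdot> enlarged_cocycle f x \<cdot> cinv (B n x) = mob (Q n x)"
      if x: "x \<in> circle3" for n x
    proof -
      let ?y = "diag_act f x"
      have y: "?y \<in> circle3" using f x by (rule diag_circle3)
      note b = unboost_in_GU(2)[OF hyp[OF y]] and N = interp_GU[OF f x] and u = unboost_in_GU(1)[OF hyp[OF x]]
      have bN: "boost (\<phi> n ?y) ** interp f x \<in> GU" by (rule GU_mult[OF b N])
      show "Q n x \<in> GU" unfolding Q_def by (rule GU_mult[OF bN u])
      have "hact (Q n x) hbase = hact (boost (\<phi> n ?y)) (push f (\<phi> n) ?y)"
        unfolding Q_def hact_mult[OF bN u] hact_mult[OF b N] hact_unboost[OF hyp[OF x]] push_image[OF f x] ..
      moreover have "hbase = hact (boost (\<phi> n ?y)) (\<phi> n ?y)" by (rule boost_hact[OF hyp[OF y], symmetric])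
      ultimately have "hdist (hact (Q n x) hbase) hbase = hdist (push f (\<phi> n) ?y) (\<phi> n ?y)"
        using hdist_hact[OF b] by metis
      then show "hdist (hact (Q n x) hbase) hbase \<le> \<epsilon> n"
        using \<epsilon>(2)[of n] y unfolding snear_def by metis
      show "B n ?y \<cdot> enlarged_cocycle f x \<cdot> cinv (B n x) = mob (Q n x)"
        unfolding B_def enlarged_cocycle_eq[OF liftable[OF f] inj[OF f] haus x] mob_unboost[OF hyp[OF x]]
          mob_mult'[OF b N] mob_mult'[OF bN u] Q_def ..
    qed
    show "uniform_limit circle3
        (\<lambda>n x. INF r\<in>rotations.
           d (B n (diag_act f x) \<cdot> enlarged_cocycle f x \<cdot> cinv (B n x)) r)
        (\<lambda>x. 0) sequentially"
    proof (rule uniform_limitI)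
      fix e :: real assume "e > 0"
      then obtain \<delta> where \<delta>: "\<delta> > 0"
        "\<And>A. A \<in> GU \<Longrightarrow> hdist (hact A hbase) hbase \<le> \<delta> \<Longrightarrow> (INF r\<in>rotations. d (mob A) r) \<in> {0..<e}"
        using distance_to_rotations[OF assms(5)] by blast
      have "\<forall>\<^sub>F n in sequentially. \<epsilon> n < \<delta>" using \<epsilon>(1) \<delta>(1) by (rule order_tendstoD)
      then show "\<forall>\<^sub>F n in sequentially. \<forall>x\<in>circle3.
          dist (INF r\<in>rotations. d (B n (diag_act f x) \<cdot> enlarged_cocycle f x \<cdot> cinv (B n x)) r) 0 < e"
      proof eventually_elim
        case (elim n)
        show ?case
        proof
          fix x assume x: "x \<in> circle3"
          have "(INF r\<in>rotations. d (mob (Q n x)) r) \<in> {0..<e}"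
            by (rule \<delta>(2)[OF Q(1)[OF x]]) (use Q(2)[OF x, of n] elim in linarith)
          then show "dist (INF r\<in>rotations. d (B n (diag_act f x) \<cdot> enlarged_cocycle f x \<cdot> cinv (B n x)) r) 0 < e"
            unfolding Q(3)[OF x] by (simp add: dist_real_def)
        qed
      qed
    qed
  qed
qed

end
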